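(* Let $\Delta\ge 3$, $c\in[0,\Delta-2]$, $\kappa=\Delta+c$. Against an oblivious adversary, in the fully dynamic model (for rooted or general forests of maximum degree at most $\Delta$ on $n$ vertices), the expected recourse per update of {\textsc{DistMaint}} is $\Theta\!\left(\min\{\Delta/c,\ \log_{\kappa-1} n\}\right)$ (with $\Delta/c$ read as $+\infty$ when $c=0$): every update has expected recourse $O(\min\{\Delta/c,\log_{\kappa-1}n\})$, and there are update sequences for which the expected amortized recourse is $\Omega(\min\{\Delta/c,\log_{\kappa-1}n\})$.
   Context: A dynamic forest on $n$ fixed vertices starts empty; each update either inserts an edge joining two distinct trees or deletes an existing edge; maximum degree stays at most $\Delta$. (In the rooted model each tree has a root, an insertion $(p,r)$ requires $r$ to be a root and makes it a child of $p$, and deleting $(p,r)$ with $p$ the parent of $r$ makes $r$ a root.) The palette is $[\kappa]$; $A(x)$ is the set of colors not used on edges at $x$. Recourse of an update = number of previously colored edges whose color changes. The update sequence is fixed in advance (oblivious adversary). {\textsc{DistMaint}}: every tree has a designated root (initially every vertex is a root; rerooting changes only the designation). FixForbidden$(v,\alpha,\beta)$: if no child edge of $v$ has color $\beta$, stop; else recolor that child edge $(v,w)$ to $\alpha$ and call FixForbidden$(w,\beta,\alpha)$. Insertion of $(p,r)$ with $r$ a root: choose $\beta$ uniformly from $A(p)$, color $(p,r)$ by $\beta$; if no child edge of $r$ has color $\beta$ stop, else let $(r,w)$ be that edge, choose $\alpha$ uniformly from $A(r)$, recolor $(r,w)$ to $\alpha$, call FixForbidden$(w,\beta,\alpha)$.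 In general (unrooted) forests, an insertion $(u,v)$ first names endpoints so that $\deg(v)\le\deg(u)$ if both trees have at most $\Delta$ edges and otherwise so that $v$'s tree has at most as many edges as $u$'s, reroots $v$'s tree at $v$, and then performs the rooted insertion $(u,v)$. Deletion of $(p,r)$ with $p$ the parent of $r$ (in the current rooting) and color $\alpha$: delete it; let $\ell$ be the number of children of $r$; with probability $(\kappa-\ell)/\kappa$ stop; otherwise pick a uniformly random child $w$, let $\beta=\mathrm{color}(r,w)$, recolor $(r,w)$ to $\alpha$, and call FixForbidden$(w,\beta,\alpha)$. Random choices are independent.
   Formalization: The lower bound is stated for n > Δ only, since for very small n it fails (for n = 2 the recourse is always 0, while the claimed bound is positive). *)

theory Defs
  imports "HOL-Probability.Probability"
begin

text \<open>
  Vertices are natural numbers, an edge is an unordered pair \<open>{u, v}\<close>.  The root set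
  contains exactly one vertex of every tree; the parent relation is derived from it, so that
  rerooting changes only the designation of a root.
\<close>

type_synonym vertex = nat
type_synonym edge = "vertex set"
type_synonym color = nat
type_synonym coloring = "edge \<rightharpoonup> color"

record rooted_forest =
  edges :: "edge set"
  roots :: "vertex set"

datatype update = Insert vertex vertex | Delete vertex vertex

datatype model = Rooted | General

definition adj :: "edge set \<Rightarrow> (vertex \<times> vertex) set" where
  "adj E = {(x, y). {x, y} \<in> E}"

definition tree :: "edge set \<Rightarrow> vertex \<Rightarrow> vertex set" where
  "tree E v = {x. (v, x) \<in> (adj E)\<^sup>*}"

definition tree_edges :: "edge set \<Rightarrow> vertex \<Rightarrow> edge set" where
  "tree_edges E v = {e \<in> E. e \<subseteq> tree E v}"

definition deg :: "edge set \<Rightarrow> vertex \<Rightarrow> nat" where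
  "deg E v = card {e \<in> E. v \<in> e}"

text \<open>
  In a forest, \<open>p\<close> is the parent of its neighbour \<open>r\<close> iff the root of their tree lies on the
  side of \<open>p\<close> once the edge between them is removed.
\<close>

definition is_parent :: "rooted_forest \<Rightarrow> vertex \<Rightarrow> vertex \<Rightarrow> bool" where
  "is_parent F p r \<longleftrightarrow>
     {p, r} \<in> edges F \<and> tree (edges F - {{p, r}}) p \<inter> roots F \<noteq> {}"

definition children :: "rooted_forest \<Rightarrow> vertex \<Rightarrow> vertex set" where
  "children F v = {w. is_parent F v w}"

definition empty_forest :: "nat \<Rightarrow> rooted_forest" where
  "empty_forest n = \<lparr>edges = {}, roots = {..<n}\<rparr>"

definition reroot :: "vertex \<Rightarrow> rooted_forest \<Rightarrow> rooted_forest" where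
  "reroot v F = F\<lparr>roots := insert v (roots F - tree (edges F) v)\<rparr>"

definition link :: "vertex \<Rightarrow> vertex \<Rightarrow> rooted_forest \<Rightarrow> rooted_forest" where
  "link p r F = \<lparr>edges = insert {p, r} (edges F), roots = roots F - {r}\<rparr>"

definition cut :: "vertex \<Rightarrow> vertex \<Rightarrow> rooted_forest \<Rightarrow> rooted_forest" where
  "cut p r F = \<lparr>edges = edges F - {{p, r}}, roots = insert r (roots F)\<rparr>"

text \<open>
  Naming of the endpoints of an edge inserted into a general forest, as (parent, child).  The
  rule compares degrees if both trees are small and tree sizes otherwise; \<open>tie\<close> is an
  arbitrary rule, independent of the colors, for the case of equality.
\<close>

type_synonym tie_rule = "rooted_forest \<Rightarrow> vertex \<Rightarrow> vertex \<Rightarrow> bool"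

definition name_endpoints ::
    "tie_rule \<Rightarrow> nat \<Rightarrow> rooted_forest \<Rightarrow> vertex \<Rightarrow> vertex \<Rightarrow> vertex \<times> vertex" where
  "name_endpoints tie \<Delta> F u v =
     (let size = (\<lambda>x. card (tree_edges (edges F) x));
          key = (if size u \<le> \<Delta> \<and> size v \<le> \<Delta> then deg (edges F) else size)
      in if key v < key u then (u, v)
         else if key u < key v then (v, u)
         else if tie F u v then (u, v) else (v, u))"

text \<open>
  Normal form of an update: the arguments are reordered as (parent, child), and in the general
  model the child of an insertion is first made the root of its tree.
\<close>

fun orient ::
    "model \<Rightarrow> tie_rule \<Rightarrow> nat \<Rightarrow> rooted_forest \<Rightarrow> update \<Rightarrow> rooted_forest \<times> update" where
  "orient Rooted tie \<Delta> F (Insert p r) = (F, Insert p r)"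
| "orient General tie \<Delta> F (Insert u v) =
     (let (p, r) = name_endpoints tie \<Delta> F u v in (reroot r F, Insert p r))"
| "orient m tie \<Delta> F (Delete u v) =
     (F, if is_parent F u v then Delete u v else Delete v u)"

fun rooted_forest_step :: "rooted_forest \<times> update \<Rightarrow> rooted_forest" where
  "rooted_forest_step (F, Insert p r) = link p r F"
| "rooted_forest_step (F, Delete p r) = cut p r F"

text \<open>The forest and its roots evolve deterministically; only the coloring is random.\<close>

definition forest_step ::
    "model \<Rightarrow> tie_rule \<Rightarrow> nat \<Rightarrow> rooted_forest \<Rightarrow> update \<Rightarrow> rooted_forest" where
  "forest_step m tie \<Delta> F u = rooted_forest_step (orient m tie \<Delta> F u)"

fun legal :: "model \<Rightarrow> nat \<Rightarrow> nat \<Rightarrow> rooted_forest \<Rightarrow> update \<Rightarrow> bool" where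
  "legal m \<Delta> n F (Insert u v) \<longleftrightarrow>
     u < n \<and> v < n \<and> v \<notin> tree (edges F) u \<and>
     deg (edges F) u < \<Delta> \<and> deg (edges F) v < \<Delta> \<and>
     (m = Rooted \<longrightarrow> v \<in> roots F)"
| "legal m \<Delta> n F (Delete u v) \<longleftrightarrow>
     {u, v} \<in> edges F \<and> (m = Rooted \<longrightarrow> is_parent F u v)"

primrec legal_from ::
    "model \<Rightarrow> tie_rule \<Rightarrow> nat \<Rightarrow> nat \<Rightarrow> rooted_forest \<Rightarrow> update list \<Rightarrow> bool" where
  "legal_from m tie \<Delta> n F [] \<longleftrightarrow> True"
| "legal_from m tie \<Delta> n F (u # us) \<longleftrightarrow>
     legal m \<Delta> n F u \<and> legal_from m tie \<Delta> n (forest_step m tie \<Delta> F u) us"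

definition legal_sequence ::
    "model \<Rightarrow> tie_rule \<Rightarrow> nat \<Rightarrow> nat \<Rightarrow> update list \<Rightarrow> bool" where
  "legal_sequence m tie \<Delta> n us \<longleftrightarrow> legal_from m tie \<Delta> n (empty_forest n) us"

definition avail :: "nat \<Rightarrow> coloring \<Rightarrow> vertex \<Rightarrow> color set" where
  "avail \<kappa> \<phi> x = {1..\<kappa>} - {\<gamma>. \<exists>e. x \<in> e \<and> \<phi> e = Some \<gamma>}"

text \<open>The child \<open>w\<close> below is unique since the coloring stays proper at \<open>v\<close>'s child edges.\<close>

partial_function (tailrec) fix_forbidden ::
    "rooted_forest \<Rightarrow> vertex \<Rightarrow> color \<Rightarrow> color \<Rightarrow> coloring \<Rightarrow> coloring" where
  "fix_forbidden F v \<alpha> \<beta> \<phi> =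
     (if \<exists>w \<in> children F v. \<phi> {v, w} = Some \<beta> then
        let w = (THE w. w \<in> children F v \<and> \<phi> {v, w} = Some \<beta>)
        in fix_forbidden F w \<beta> \<alpha> (\<phi>({v, w} \<mapsto> \<alpha>))
      else \<phi>)"

text \<open>In both procedures \<open>F\<close> is the forest after the update, \<open>\<phi>\<close> the coloring before it.\<close>

definition insert_recolor ::
    "nat \<Rightarrow> rooted_forest \<Rightarrow> vertex \<Rightarrow> vertex \<Rightarrow> coloring \<Rightarrow> coloring pmf" where
  "insert_recolor \<kappa> F p r \<phi> = do {
     \<beta> \<leftarrow> pmf_of_set (avail \<kappa> \<phi> p);
     let \<phi>' = \<phi>({p, r} \<mapsto> \<beta>);
     if \<exists>w \<in> children F r. \<phi>' {r, w} = Some \<beta> then do {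
       let w = (THE w. w \<in> children F r \<and> \<phi>' {r, w} = Some \<beta>);
       \<alpha> \<leftarrow> pmf_of_set (avail \<kappa> \<phi>' r);
       return_pmf (fix_forbidden F w \<beta> \<alpha> (\<phi>'({r, w} \<mapsto> \<alpha>)))
     } else return_pmf \<phi>'
   }"

definition delete_recolor ::
    "nat \<Rightarrow> rooted_forest \<Rightarrow> vertex \<Rightarrow> vertex \<Rightarrow> coloring \<Rightarrow> coloring pmf" where
  "delete_recolor \<kappa> F p r \<phi> = do {
     let \<alpha> = the (\<phi> {p, r});
     let \<phi>' = \<phi>({p, r} := None);
     let l = card (children F r);
     stop \<leftarrow> bernoulli_pmf ((real \<kappa> - real l) / real \<kappa>);
     if stop then return_pmf \<phi>' else do {
       w \<leftarrow> pmf_of_set (children F r);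
       let \<beta> = the (\<phi>' {r, w});
       return_pmf (fix_forbidden F w \<beta> \<alpha> (\<phi>'({r, w} \<mapsto> \<alpha>)))
     }
   }"

fun recolor :: "nat \<Rightarrow> rooted_forest \<times> update \<Rightarrow> coloring \<Rightarrow> coloring pmf" where
  "recolor \<kappa> (F, Insert p r) \<phi> = insert_recolor \<kappa> (link p r F) p r \<phi>"
| "recolor \<kappa> (F, Delete p r) \<phi> = delete_recolor \<kappa> (cut p r F) p r \<phi>"

fun distmaint_step ::
    "model \<Rightarrow> tie_rule \<Rightarrow> nat \<Rightarrow> nat \<Rightarrow> update \<Rightarrow> rooted_forest \<times> coloring
       \<Rightarrow> (rooted_forest \<times> coloring) pmf" where
  "distmaint_step m tie \<Delta> \<kappa> u (F, \<phi>) =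
     map_pmf (Pair (forest_step m tie \<Delta> F u)) (recolor \<kappa> (orient m tie \<Delta> F u) \<phi>)"

definition distmaint ::
    "model \<Rightarrow> tie_rule \<Rightarrow> nat \<Rightarrow> nat \<Rightarrow> nat \<Rightarrow> update list \<Rightarrow> (rooted_forest \<times> coloring) pmf" where
  "distmaint m tie \<Delta> \<kappa> n us =
     foldl (\<lambda>M u. bind_pmf M (distmaint_step m tie \<Delta> \<kappa> u))
       (return_pmf (empty_forest n, Map.empty)) us"

definition recourse :: "coloring \<Rightarrow> coloring \<Rightarrow> nat" where
  "recourse \<phi> \<phi>' = card {e \<in> dom \<phi> \<inter> dom \<phi>'. \<phi> e \<noteq> \<phi>' e}"

text \<open>Expected recourse of the update with (zero-based) index \<open>t\<close> in the sequence \<open>us\<close>.\<close>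

definition expected_recourse ::
    "model \<Rightarrow> tie_rule \<Rightarrow> nat \<Rightarrow> nat \<Rightarrow> nat \<Rightarrow> update list \<Rightarrow> nat \<Rightarrow> real" where
  "expected_recourse m tie \<Delta> \<kappa> n us t =
     measure_pmf.expectation
       (do {
          s \<leftarrow> distmaint m tie \<Delta> \<kappa> n (take t us);
          s' \<leftarrow> distmaint_step m tie \<Delta> \<kappa> (us ! t) s;
          return_pmf (recourse (snd s) (snd s'))
        }) real"

definition amortized_recourse ::
    "model \<Rightarrow> tie_rule \<Rightarrow> nat \<Rightarrow> nat \<Rightarrow> nat \<Rightarrow> update list \<Rightarrow> real" where
  "amortized_recourse m tie \<Delta> \<kappa> n us =
     (\<Sum>t<length us. expected_recourse m tie \<Delta> \<kappa> n us t) / real (length us)"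

text \<open>The quantity \<open>min {\<Delta>/c, log\<^bsub>\<kappa>-1\<^esub> n}\<close>, with \<open>\<Delta>/c\<close> read as infinity for \<open>c = 0\<close>.\<close>

definition recourse_bound :: "nat \<Rightarrow> nat \<Rightarrow> nat \<Rightarrow> real" where
  "recourse_bound \<Delta> c n =
     (let L = log (real (\<Delta> + c) - 1) (real n)
      in if c = 0 then L else min (real \<Delta> / real c) L)"

end

theory Submission
  imports Defs
begin

text \<open>
  The coloring is at all times uniform over the proper edge colorings of the current forest, and
  both updates are a single Kempe swap at \<open>r\<close>.  For an insertion draw \<open>\<alpha>\<close> from \<open>A(r)\<close> and \<open>\<beta>\<close> from
  \<open>A(p)\<close> and swap \<open>\<alpha>, \<beta>\<close> on the component of \<open>r\<close>: if \<open>\<beta>\<close> is free at \<open>r\<close> this component is trivial.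
  For a deletion of an edge colored \<open>\<alpha>\<close> the coin and the random child amount to swapping \<open>\<alpha>\<close> with a
  color \<open>\<beta>\<close> uniform in the whole palette.  The swap is an involution that matches the triples
  \<open>(\<phi>, \<alpha>, \<beta>)\<close> with \<open>\<alpha>\<close> free at \<open>r\<close> and \<open>\<beta>\<close> free at \<open>p\<close> with the triples \<open>(\<psi>, \<alpha>, \<beta>)\<close> with \<open>\<beta>\<close> free
  at both ends, i.e. with a coloring of the forest including the edge together with an arbitrary color
  \<open>\<alpha>\<close>; hence uniformity persists.

  The recourse is the length of the Kempe chain.  Swapping colors below a vertex shows that a
  chain which has reached a vertex continues to a given child with probability \<open>1/(\<kappa>-1)\<close>, so the
  expected recourse is the sum over \<open>d\<close> of \<open>n\<^sub>d\<^sub>+\<^sub>1 / (\<kappa> (\<kappa>-1)\<^sup>d)\<close> where \<open>n\<^sub>d\<close> counts the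
  vertices of depth \<open>d\<close> below \<open>r\<close>.  Since \<open>n\<^sub>d \<le> (\<Delta>-1)\<^sup>d\<close> and the \<open>n\<^sub>d\<close> add up to at most \<open>n\<close>, both
  upper bounds follow.  Up to a constant they are attained by joining and separating, over and over,
  the roots of two equal, nearly complete \<open>(\<Delta>-1)\<close>-ary trees, where it does not matter which root becomes the child.
\<close>

subsection \<open>Rooted forests\<close>

text \<open>All averages are taken after the swap, over \<open>swap_post\<close>. Before it,
  \<alpha> is confined to the colors free at \<open>r\<close>; after it, \<alpha> is an
  unconstrained color of the palette and \<beta> is free at \<open>r\<close>, so that only \<alpha>
  can be met on an edge at \<open>r\<close>. This makes the probability of the first step exactly
  1/\<kappa>, whatever the degree of \<open>r\<close>. Further down, the edge by which the chain
  arrived carries one of the two colors, and the color of a given child edge is uniform among the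
  \<kappa>-1 remaining ones: hence the factor 1/(\<kappa>-1). Insertion and deletion read the same
  triples in opposite directions and so have the same expected recourse.

  The obstacle is that the procedures never swap at once. They recolor edge by edge through improper
  colorings, look only at children, and draw \<alpha> only if it is needed. What connects them to
  swaps is that \<open>r\<close> is the root of its tree as long as the updated edge is absent, so
  that its Kempe component only descends.\<close>

lemma tree_refl [simp]: "x \<in> tree E x"
  by (simp add: tree_def)

lemma tree_sym: "y \<in> tree E x \<Longrightarrow> x \<in> tree E y"
proof -
  have "sym (adj E)"
    by (auto simp: sym_def adj_def insert_commute)
  then show "y \<in> tree E x \<Longrightarrow> x \<in> tree E y"
    unfolding tree_def using sym_rtrancl by (auto dest: symD)
qed

lemma tree_trans: "y \<in> tree E x \<Longrightarrow> z \<in> tree E y \<Longrightarrow> z \<in> tree E x"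
  by (auto simp: tree_def)

lemma tree_mono: "E \<subseteq> E' \<Longrightarrow> tree E x \<subseteq> tree E' x"
  unfolding tree_def using rtrancl_mono[of "adj E" "adj E'"] by (auto simp: adj_def)

lemma tree_edge: "{x, y} \<in> E \<Longrightarrow> y \<in> tree E x"
  by (auto simp: tree_def adj_def)

lemma tree_induct [consumes 1, case_names refl step]:
  assumes "y \<in> tree E x" "P x" 
    "\<And>y z. y \<in> tree E x \<Longrightarrow> P y \<Longrightarrow> {y, z} \<in> E \<Longrightarrow> P z"
  shows "P y"
proof -
  have "(x, y) \<in> (adj E)\<^sup>*" using assms(1) by (simp add: tree_def)
  then show ?thesis
    by (induction rule: rtrancl_induct) (auto simp: adj_def assms tree_def)
qed

text \<open>A walk can be shortened until it crosses the new edge at most once. Applied to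
  \<open>E\<close> with an edge taken out, the equivalence describes cutting as well.\<close>

lemma tree_insert_edge:
  "y \<in> tree (insert {p, r} E) x \<longleftrightarrow>
     y \<in> tree E x \<or> (p \<in> tree E x \<and> y \<in> tree E r) \<or> (r \<in> tree E x \<and> y \<in> tree E p)"
  (is "?L \<longleftrightarrow> ?R")
proof
  assume ?L
  then show ?R
  proof (induction rule: tree_induct)
    case (step y z)
    show ?case
    proof (cases "{y, z} \<in> E")
      case True
      have "z \<in> tree E a" if "y \<in> tree E a" for a
        using that tree_edge[OF True] tree_trans by auto
      then show ?thesis using step.IH by auto
    next
      case False
      then have "y = p \<and> z = r \<or> y = r \<and> z = p"
        using step by (auto simp: doubleton_eq_iff)
      then show ?thesis using step.IH by auto
    qed
  qed simp
next
  assume ?R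
  moreover have "tree E u \<subseteq> tree (insert {p, r} E) u" for u
    by (rule tree_mono) auto
  moreover have "r \<in> tree (insert {p, r} E) p" "p \<in> tree (insert {p, r} E) r"
    by (auto intro!: tree_edge simp: insert_commute)
  ultimately show ?L by (meson subsetD tree_trans)
qed

text \<open>Acyclicity is phrased as every edge being a bridge, the form in which
  \<open>is_parent\<close> can use it: removing an edge separates its ends, and the root of the tree
  stays with exactly one of them.\<close>

locale rooted_forest_on =
  fixes n :: nat and F :: rooted_forest
  assumes edge_ends: "e \<in> edges F \<Longrightarrow> \<exists>x y. e = {x, y} \<and> x \<noteq> y \<and> x < n \<and> y < n"
    and acyclic_edge: "{x, y} \<in> edges F \<Longrightarrow> y \<notin> tree (edges F - {{x, y}}) x"
    and roots_less: "z \<in> roots F \<Longrightarrow> z < n"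
    and ex1_root: "v < n \<Longrightarrow> \<exists>!z. z \<in> roots F \<and> z \<in> tree (edges F) v"
begin

lemma edge_neq: "{x, y} \<in> edges F \<Longrightarrow> x \<noteq> y"
  using edge_ends by (fastforce simp: doubleton_eq_iff)

lemma edge_less: "{x, y} \<in> edges F \<Longrightarrow> x < n \<and> y < n"
  using edge_ends by (fastforce simp: doubleton_eq_iff)

lemma finite_edges: "finite (edges F)"
proof (rule finite_subset)
  show "edges F \<subseteq> Pow {..<n}" using edge_ends by fastforce
qed simp

lemma tree_less: "y \<in> tree (edges F) x \<Longrightarrow> x < n \<Longrightarrow> y < n"
  by (induction rule: tree_induct) (auto dest: edge_less)

lemma root_unique:
  assumes "z \<in> roots F" "z' \<in> roots F" "z' \<in> tree (edges F) z"
  shows "z' = z"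
  using ex1_root[OF roots_less[OF assms(1)]] assms tree_refl by metis

lemma tree_remove_edge:
  assumes "{x, y} \<in> edges F"
  shows "u \<in> tree (edges F) v \<longleftrightarrow> 
    u \<in> tree (edges F - {{x, y}}) v \<or>
    (x \<in> tree (edges F - {{x, y}}) v \<and> u \<in> tree (edges F - {{x, y}}) y) \<or>
    (y \<in> tree (edges F - {{x, y}}) v \<and> u \<in> tree (edges F - {{x, y}}) x)"
proof -
  have "insert {x, y} (edges F - {{x, y}}) = edges F" using assms by auto
  then show ?thesis using tree_insert_edge[of u x y "edges F - {{x, y}}" v] by simp
qed

lemma parent_edge: "is_parent F x y \<Longrightarrow> {x, y} \<in> edges F"
  by (simp add: is_parent_def)

text \<open>\<open>is_parent\<close> only supplies some root on the side of \<open>x\<close>; since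
  the tree has a single root, this witness is \<open>z\<close>.\<close>

lemma parent_root:
  assumes "is_parent F x y" "z \<in> roots F" "z \<in> tree (edges F) y"
  shows "z \<in> tree (edges F - {{x, y}}) x"
proof -
  obtain z' where z': "z' \<in> roots F" "z' \<in> tree (edges F - {{x, y}}) x"
    using assms(1) by (auto simp: is_parent_def)
  then have "z' \<in> tree (edges F) x" using tree_mono[of "edges F - {{x, y}}"] by blast
  moreover have "z \<in> tree (edges F) x"
    using assms(3) tree_edge[OF parent_edge[OF assms(1)]] tree_trans by blast
  ultimately have "z' = z" using root_unique assms(2) z'(1) by (meson tree_sym tree_trans)
  then show ?thesis using z' by simp
qed

lemma parent_total:
  assumes "{x, y} \<in> edges F"
  shows "is_parent F x y \<or> is_parent F y x"
proof -
  obtain z where "z \<in> roots F" "z \<in> tree (edges F) x"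
    using ex1_root edge_less assms by blast
  then show ?thesis using assms tree_remove_edge[OF assms, of z x]
    by (auto simp: is_parent_def insert_commute)
qed

lemma parent_has_root:
  assumes "is_parent F x y"
  obtains z where "z \<in> roots F" "z \<in> tree (edges F - {{x, y}}) x" "z \<in> tree (edges F) y"
proof -
  obtain z where z: "z \<in> roots F" "z \<in> tree (edges F) y"
    using ex1_root edge_less parent_edge[OF assms] by blast
  then show ?thesis using parent_root[OF assms] that by blast
qed

lemma parent_asym: "is_parent F x y \<Longrightarrow> \<not> is_parent F y x"
proof
  assume a: "is_parent F x y" "is_parent F y x"
  obtain z where z: "z \<in> roots F" "z \<in> tree (edges F - {{x, y}}) x" "z \<in> tree (edges F) y"
    using parent_has_root[OF a(1)] by blast
  have "z \<in> tree (edges F) x"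
    using z(3) tree_edge[OF parent_edge[OF a(1)]] tree_trans by blast
  then have "z \<in> tree (edges F - {{x, y}}) y"
    using parent_root[OF a(2) z(1)] by (simp add: insert_commute)
  then have "y \<in> tree (edges F - {{x, y}}) x" using z(2) tree_sym tree_trans by blast
  then show False using acyclic_edge parent_edge[OF a(1)] by blast
qed

lemma root_no_parent: "r \<in> roots F \<Longrightarrow> \<not> is_parent F x r"
proof
  assume a: "r \<in> roots F" "is_parent F x r"
  then have "r \<in> tree (edges F - {{x, r}}) x" using parent_root by simp
  then show False using acyclic_edge parent_edge[OF a(2)] by blast
qed

lemma parent_unique:
  assumes "is_parent F x v" "is_parent F y v"
  shows "x = y"
proof (rule ccontr)
  assume ne: "x \<noteq> y"
  let ?E = "edges F"
  obtain z where z: "z \<in> roots F" "z \<in> tree (?E - {{x, v}}) x" "z \<in> tree ?E v"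
    using parent_has_root[OF assms(1)] by blast
  have zy: "z \<in> tree (?E - {{y, v}}) y" using parent_root[OF assms(2) z(1,3)] .
  \<comment> \<open>The walk from \<open>x\<close> to the root runs without the edge
    \<open>{x, v}\<close>, so it never visits \<open>v\<close> and avoids \<open>{y, v}\<close> too.
    With \<open>{y, v}\<close> removed, \<open>v\<close> therefore still reaches \<open>y\<close> by
    way of \<open>x\<close> and the root, which contradicts \<open>{y, v}\<close> being a
    bridge.\<close>
  have "z \<in> tree (?E - {{y, v}}) x \<and> z \<in> tree (?E - {{x, v}}) x"
    using z(2)
  proof (induction rule: tree_induct)
    case (step u w)
    have "{u, w} \<noteq> {y, v}"
    proof
      assume "{u, w} = {y, v}"
      then have "u = v \<or> w = v" by (auto simp: doubleton_eq_iff)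
      then have "v \<in> tree (?E - {{x, v}}) x"
        using step.hyps(1) tree_trans[OF step.hyps(1) tree_edge[OF step.hyps(2)]] by auto
      then show False using acyclic_edge parent_edge[OF assms(1)] by blast
    qed
    then have "w \<in> tree (?E - {{y, v}}) u" using step.hyps(2) by (intro tree_edge) auto
    then show ?case using step.IH tree_trans[OF step.hyps(1) tree_edge[OF step.hyps(2)]]
      tree_trans by blast
  qed simp
  moreover have "v \<in> tree (?E - {{y, v}}) x"
    using parent_edge[OF assms(1)] ne by (intro tree_edge) (auto simp: doubleton_eq_iff)
  ultimately have "v \<in> tree (?E - {{y, v}}) y" using zy by (meson tree_sym tree_trans)
  then show False using acyclic_edge parent_edge[OF assms(2)] by blast
qed

section \<open>Linking, cutting and rerooting\<close>

lemma link_forest: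
  assumes "p < n" "r \<in> roots F" "r \<notin> tree (edges F) p"
  shows "rooted_forest_on n (link p r F)"
proof
  let ?E = "edges F"
  have nt: "p \<notin> tree ?E r" using assms tree_sym by blast
  have pr: "p \<noteq> r" using assms by auto
  show "\<exists>x y. e = {x, y} \<and> x \<noteq> y \<and> x < n \<and> y < n" if "e \<in> edges (link p r F)" for e
    using that edge_ends[of e] assms(1) pr roots_less[OF assms(2)] by (auto simp: link_def)
  show "y \<notin> tree (edges (link p r F) - {{x, y}}) x" if "{x, y} \<in> edges (link p r F)" for x y
  proof (cases "{x, y} = {p, r}")
    case True
    have "{p, r} \<notin> ?E" using assms(3) tree_edge by blast
    then have "edges (link p r F) - {{x, y}} = ?E" using True by (auto simp: link_def)
    moreover have "x = p \<and> y = r \<or> x = r \<and> y = p" using True by (simp add: doubleton_eq_iff)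
    ultimately show ?thesis using nt assms(3) by metis
  next
    case False
    then have xy: "{x, y} \<in> ?E" using that by (auto simp: link_def)
    have eq: "edges (link p r F) - {{x, y}} = insert {p, r} (?E - {{x, y}})"
      using False by (auto simp: link_def)
    have sub: "tree (?E - {{x, y}}) u \<subseteq> tree ?E u" for u by (rule tree_mono) auto
    have xy': "x \<in> tree ?E y" "y \<in> tree ?E x" 
      using tree_edge[OF xy] tree_sym by auto
    show ?thesis unfolding eq tree_insert_edge
      using acyclic_edge[OF xy] sub nt assms(3) xy' by (meson subsetD tree_sym tree_trans)
  qed
  show "z < n" if "z \<in> roots (link p r F)" for z
    using that roots_less by (auto simp: link_def)
  show "\<exists>!z. z \<in> roots (link p r F) \<and> z \<in> tree (edges (link p r F)) v" if v: "v < n" for v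
  proof -
    obtain z where z: "z \<in> roots F" "z \<in> tree ?E v" using ex1_root[OF v] by blast
    obtain q where q: "q \<in> roots F" "q \<in> tree ?E p" using ex1_root[OF assms(1)] by blast
    have T: "u \<in> tree (edges (link p r F)) v \<longleftrightarrow>
       u \<in> tree ?E v \<or> (p \<in> tree ?E v \<and> u \<in> tree ?E r) \<or> (r \<in> tree ?E v \<and> u \<in> tree ?E p)" for u
      by (simp add: link_def tree_insert_edge)
    have R: "roots (link p r F) = roots F - {r}" by (simp add: link_def)
    have qr: "q \<noteq> r" using q assms(3) by auto
    have r1: "u = r" if "u \<in> roots F" "u \<in> tree ?E r" for u
      using root_unique[OF assms(2)] that by blast
    have q1: "u = q" if "u \<in> roots F" "u \<in> tree ?E p" for u
      using ex1_root[OF assms(1)] that q by blast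
    have z1: "u = z" if "u \<in> roots F" "u \<in> tree ?E v" for u
      using ex1_root[OF v] that z by blast
    show ?thesis
    \<comment> \<open>The tree of \<open>r\<close> inherits the root \<open>q\<close> from the tree
      of \<open>p\<close>; all other vertices keep their root.\<close>
    proof (cases "z = r")
      case True
      then have "r \<in> tree ?E v" using z by simp
      moreover have "p \<notin> tree ?E v" using calculation nt tree_sym tree_trans by blast
      ultimately have "u \<in> tree (edges (link p r F)) v \<longleftrightarrow> u \<in> tree ?E v \<or> u \<in> tree ?E p" for u
        unfolding T by blast
      then show ?thesis unfolding R
        using q qr q1 z1 True by (metis Diff_iff singletonD singletonI)
    next
      case False
      have "r \<notin> tree ?E v" using False z1 assms(2) by blast
      then have "u \<in> tree (edges (link p r F)) v \<longleftrightarrow>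
          u \<in> tree ?E v \<or> (p \<in> tree ?E v \<and> u \<in> tree ?E r)" for u
        unfolding T by blast
      then show ?thesis unfolding R
        using z False r1 z1 by (metis Diff_iff singletonD singletonI)
    qed
  qed
qed

lemma cut_forest:
  assumes "is_parent F p r"
  shows "rooted_forest_on n (cut p r F)"
proof
  let ?E = "edges F"
  let ?E' = "?E - {{p, r}}"
  have pr: "{p, r} \<in> ?E" using parent_edge[OF assms] .
  have sub: "tree ?E' u \<subseteq> tree ?E u" for u by (rule tree_mono) auto
  have nt: "r \<notin> tree ?E' p" using acyclic_edge[OF pr] .
  \<comment> \<open>The old root lies on the side of \<open>p\<close>, so the part hanging from
    \<open>r\<close> contains none and \<open>r\<close> becomes its only root.\<close>
  have nr: "z \<notin> roots F" if "z \<in> tree ?E' r" for z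
  proof
    assume "z \<in> roots F"
    then have "z \<in> tree ?E' p" using parent_root[OF assms] that sub by blast
    then show False using that nt by (meson tree_sym tree_trans)
  qed
  show "\<exists>x y. e = {x, y} \<and> x \<noteq> y \<and> x < n \<and> y < n" if "e \<in> edges (cut p r F)" for e
    using that edge_ends[of e] by (auto simp: cut_def)
  show "y \<notin> tree (edges (cut p r F) - {{x, y}}) x" if "{x, y} \<in> edges (cut p r F)" for x y
  proof -
    have "edges (cut p r F) - {{x, y}} \<subseteq> ?E - {{x, y}}" by (auto simp: cut_def)
    moreover have "{x, y} \<in> ?E" using that by (auto simp: cut_def)
    ultimately show ?thesis using acyclic_edge tree_mono by blast
  qed
  show "z < n" if "z \<in> roots (cut p r F)" for z
    using that roots_less edge_less[OF pr] by (auto simp: cut_def)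
  show "\<exists>!z. z \<in> roots (cut p r F) \<and> z \<in> tree (edges (cut p r F)) v" if v: "v < n" for v
  proof -
    have R: "roots (cut p r F) = insert r (roots F)" and E: "edges (cut p r F) = ?E'"
      by (simp_all add: cut_def)
    show ?thesis
    proof (cases "r \<in> tree ?E' v")
      case True
      then have "z \<notin> roots F" if "z \<in> tree ?E' v" for z
        using nr that by (meson tree_sym tree_trans)
      then show ?thesis unfolding R E using True by auto
    next
      case False
      obtain z where z: "z \<in> roots F" "z \<in> tree ?E v" using ex1_root[OF v] by blast
      have "z \<in> tree ?E' v"
        using z nr False unfolding tree_remove_edge[OF pr, of z v] by blast
      moreover have "u = z" if "u \<in> roots F" "u \<in> tree ?E' v" for u
        using ex1_root[OF v] that z sub by blast
      ultimately show ?thesis unfolding R E using False z(1) by (metis insert_iff)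
    qed
  qed
qed

lemma reroot_forest:
  assumes "r < n"
  shows "rooted_forest_on n (reroot r F)"
proof
  let ?E = "edges F"
  have E: "edges (reroot r F) = ?E" and R: "roots (reroot r F) = insert r (roots F - tree ?E r)"
    by (simp_all add: reroot_def)
  show "\<exists>x y. e = {x, y} \<and> x \<noteq> y \<and> x < n \<and> y < n" if "e \<in> edges (reroot r F)" for e
    using that edge_ends[of e] by (simp add: E)
  show "y \<notin> tree (edges (reroot r F) - {{x, y}}) x" if "{x, y} \<in> edges (reroot r F)" for x y
    using that acyclic_edge by (simp add: E)
  show "z < n" if "z \<in> roots (reroot r F)" for z
    using that roots_less assms by (auto simp: R)
  show "\<exists>!z. z \<in> roots (reroot r F) \<and> z \<in> tree (edges (reroot r F)) v" if v: "v < n" for v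
  proof (cases "r \<in> tree ?E v")
    case True
    then have "tree ?E v \<subseteq> tree ?E r" by (meson subsetI tree_sym tree_trans)
    then show ?thesis unfolding E R using True by (intro ex1I[of _ r]) auto
  next
    case False
    then have "u \<notin> tree ?E r" if "u \<in> tree ?E v" for u
      using that by (meson tree_sym tree_trans)
    then show ?thesis unfolding E R using ex1_root[OF v] False by (metis DiffD1 DiffI insertE insertI2)
  qed
qed

end

lemma empty_forest_on: "rooted_forest_on n (empty_forest n)"
proof -
  have "(adj {})\<^sup>* = Id" by (simp add: adj_def)
  then have "tree {} v = {v}" for v by (auto simp: tree_def)
  then show ?thesis by unfold_locales (auto simp: empty_forest_def)
qed

subsection \<open>Kempe swaps and the recoloring walk\<close>

text \<open>The domain is exactly \<open>E\<close>, which makes the set finite for finite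
  \<open>E\<close> and lets an inserted or deleted edge change the domain by itself alone.\<close>

definition colorings :: "nat \<Rightarrow> edge set \<Rightarrow> coloring set" where
  "colorings \<kappa> E = {\<phi>. dom \<phi> = E \<and> ran \<phi> \<subseteq> {1..\<kappa>} \<and>
     (\<forall>e\<in>E. \<forall>e'\<in>E. e \<noteq> e' \<longrightarrow> e \<inter> e' \<noteq> {} \<longrightarrow> \<phi> e \<noteq> \<phi> e')}"

lemma coloring_SomeD:
  assumes "\<phi> \<in> colorings \<kappa> E" "\<phi> e = Some \<gamma>"
  shows "e \<in> E" "\<gamma> \<in> {1..\<kappa>}"
  using assms by (auto simp: colorings_def ran_def)

lemma coloring_dom: "\<phi> \<in> colorings \<kappa> E \<Longrightarrow> dom \<phi> = E"
  by (simp add: colorings_def)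

lemma coloring_edge:
  assumes "\<phi> \<in> colorings \<kappa> E" "e \<in> E"
  obtains \<gamma> where "\<phi> e = Some \<gamma>" "\<gamma> \<in> {1..\<kappa>}"
proof -
  have "e \<in> dom \<phi>" using assms by (simp add: colorings_def)
  then obtain \<gamma> where "\<phi> e = Some \<gamma>" by blast
  then show thesis using that coloring_SomeD(2)[OF assms(1)] by blast
qed

lemma coloring_proper:
  assumes "\<phi> \<in> colorings \<kappa> E" "\<phi> e = Some \<gamma>" "\<phi> e' = Some \<gamma>" "x \<in> e" "x \<in> e'"
  shows "e = e'"
proof (rule ccontr)
  assume "e \<noteq> e'"
  moreover have "e \<in> E" "e' \<in> E" using coloring_SomeD(1)[OF assms(1)] assms(2,3) by blast+
  moreover have "e \<inter> e' \<noteq> {}" using assms(4,5) by blast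
  ultimately have "\<phi> e \<noteq> \<phi> e'" using assms(1) by (simp add: colorings_def)
  then show False using assms(2,3) by simp
qed

lemma coloring_proper':
  assumes "\<phi> \<in> colorings \<kappa> E" "\<phi> {x, y} = Some \<gamma>" "\<phi> {x, z} = Some \<gamma>"
  shows "y = z"
  using coloring_proper[OF assms, of x] by (auto simp: doubleton_eq_iff)

lemma finite_colorings: "finite E \<Longrightarrow> finite (colorings \<kappa> E)"
  by (rule finite_subset[OF _ finite_set_of_finite_maps[of E "{1..\<kappa>}"]])
    (auto simp: colorings_def)

lemma mem_avail:
  "\<gamma> \<in> avail \<kappa> \<phi> x \<longleftrightarrow> \<gamma> \<in> {1..\<kappa>} \<and> (\<forall>e. x \<in> e \<longrightarrow> \<phi> e \<noteq> Some \<gamma>)"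
  by (auto simp: avail_def)

lemma finite_avail [simp]: "finite (avail \<kappa> \<phi> x)"
  by (simp add: avail_def)

text \<open>Properness makes the colors at \<open>x\<close> distinct. What matters later is that the
  number depends on the degree alone: all fibres of \<open>swap_pre\<close> over colorings then have
  the same size.\<close>

lemma card_avail:
  assumes "\<phi> \<in> colorings \<kappa> E" "finite E"
  shows "card (avail \<kappa> \<phi> x) = \<kappa> - deg E x"
proof -
  let ?I = "{e \<in> E. x \<in> e}"
  have "(\<exists>e. x \<in> e \<and> \<phi> e = Some \<gamma>) \<longleftrightarrow> \<gamma> \<in> (\<lambda>e. the (\<phi> e)) ` ?I" for \<gamma>
    by (force simp: image_iff elim: coloring_edge[OF assms(1)] dest: coloring_SomeD(1)[OF assms(1)])
  then have "avail \<kappa> \<phi> x = {1..\<kappa>} - (\<lambda>e. the (\<phi> e)) ` ?I"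
    unfolding avail_def by blast
  moreover have "(\<lambda>e. the (\<phi> e)) ` ?I \<subseteq> {1..\<kappa>}"
    using coloring_edge[OF assms(1)] by (metis (mono_tags, lifting) image_subsetI mem_Collect_eq option.sel)
  moreover have "inj_on (\<lambda>e. the (\<phi> e)) ?I"
    by (rule inj_onI)
      (metis (mono_tags, lifting) assms(1) coloring_edge coloring_proper mem_Collect_eq option.sel)
  ultimately show ?thesis
    using assms(2) by (simp add: card_Diff_subset card_image deg_def finite_subset)
qed

definition kempe_comp :: "color \<Rightarrow> color \<Rightarrow> vertex \<Rightarrow> coloring \<Rightarrow> vertex set" where
  "kempe_comp a b r \<phi> = tree {e. \<phi> e = Some a \<or> \<phi> e = Some b} r"

text \<open>\<open>W\<close> need not be a whole component because the recoloring walk has swapped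
  only an initial piece of it at each moment. Edges of other colors that meet \<open>W\<close> are
  fixed by the transposition.\<close>

definition flip :: "color \<Rightarrow> color \<Rightarrow> vertex set \<Rightarrow> coloring \<Rightarrow> coloring" where
  "flip a b W \<phi> =
     (\<lambda>e. if e \<inter> W \<noteq> {} then map_option (Transposition.transpose a b) (\<phi> e) else \<phi> e)"

definition kempe :: "color \<Rightarrow> color \<Rightarrow> vertex \<Rightarrow> coloring \<Rightarrow> coloring" where
  "kempe a b r \<phi> = flip a b (kempe_comp a b r \<phi>) \<phi>"

lemma transpose_other:
  "o' \<noteq> Some a \<Longrightarrow> o' \<noteq> Some b \<Longrightarrow> map_option (Transposition.transpose a b) o' = o'"
  by (cases o') (auto simp: transpose_apply_other)

lemma transpose_swap: "Transposition.transpose a b c = d \<longleftrightarrow> c = Transposition.transpose a b d"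
  by (metis transpose_involutory)

lemma transpose_eq_Some:
  "map_option (Transposition.transpose a b) o' = Some c \<longleftrightarrow>
     o' = Some (Transposition.transpose a b c)"
  by (cases o') (auto simp: transpose_swap)

lemma kempe_comp_commute: "kempe_comp b a r \<phi> = kempe_comp a b r \<phi>"
  by (simp add: kempe_comp_def disj_commute)

lemma kempe_commute: "kempe b a r \<phi> = kempe a b r \<phi>"
  by (simp add: kempe_def kempe_comp_commute flip_def Transposition.transpose_commute cong: if_cong)

lemma kempe_same: "kempe a a r \<phi> = \<phi>"
  by (auto simp: kempe_def flip_def fun_eq_iff option.map_ident_strong)

lemma kempe_comp_self [simp]: "r \<in> kempe_comp a b r \<phi>"
  by (simp add: kempe_comp_def)

lemma kempe_comp_step:
  assumes "x \<in> kempe_comp a b r \<phi>" "\<phi> {x, y} = Some a \<or> \<phi> {x, y} = Some b"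
  shows "y \<in> kempe_comp a b r \<phi>"
  using assms tree_edge[of x y "{e. \<phi> e = Some a \<or> \<phi> e = Some b}"] tree_trans
  unfolding kempe_comp_def by blast

lemma kempe_comp_induct [consumes 1, case_names self step]:
  assumes "y \<in> kempe_comp a b r \<phi>" "P r"
    "\<And>y z. y \<in> kempe_comp a b r \<phi> \<Longrightarrow> P y \<Longrightarrow> \<phi> {y, z} = Some a \<or> \<phi> {y, z} = Some b \<Longrightarrow> P z"
  shows "P y"
  using assms(1) unfolding kempe_comp_def
  by (induction rule: tree_induct) (use assms(2,3) in \<open>auto simp: kempe_comp_def\<close>)

context rooted_forest_on
begin

lemma edge_ends_at:
  assumes "e \<in> edges F" "x \<in> e"
  obtains y where "e = {x, y}" "x \<noteq> y"
  using edge_ends[OF assms(1)] assms(2) by (metis insert_commute insert_iff singletonD)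

context
  fixes \<kappa> :: nat and \<phi> :: coloring and a b :: color
  assumes col: "\<phi> \<in> colorings \<kappa> (edges F)"
begin

text \<open>The ends of an edge colored \<open>a\<close> or \<open>b\<close> lie in the component
  together or not at all, and the transposition fixes every other color; so any single end decides
  the fate of the edge.\<close>

lemma kempe_at:
  assumes "x \<in> e"
  shows "kempe a b u \<phi> e =
    (if x \<in> kempe_comp a b u \<phi> then map_option (Transposition.transpose a b) (\<phi> e) else \<phi> e)"
proof (cases "\<phi> e = Some a \<or> \<phi> e = Some b")
  case True
  then have "e \<in> edges F" using coloring_SomeD[OF col] by blast
  then obtain y where y: "e = {x, y}" using edge_ends_at assms by blast
  then have "y \<in> kempe_comp a b u \<phi> \<longleftrightarrow> x \<in> kempe_comp a b u \<phi>"
    using True kempe_comp_step[of _ a b u \<phi>] by (metis insert_commute)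
  then show ?thesis using y by (auto simp: kempe_def flip_def)
next
  case False
  then show ?thesis by (auto simp: kempe_def flip_def transpose_other)
qed

lemma kempe_bichromatic:
  "kempe a b u \<phi> e = Some a \<or> kempe a b u \<phi> e = Some b \<longleftrightarrow> \<phi> e = Some a \<or> \<phi> e = Some b"
  by (auto simp: kempe_def flip_def transpose_eq_Some simp del: map_option_eq_Some)

lemma kempe_comp_kempe: "kempe_comp a b u (kempe a b u \<phi>) = kempe_comp a b u \<phi>"
  unfolding kempe_comp_def kempe_bichromatic by simp

lemma kempe_involution: "kempe a b u (kempe a b u \<phi>) = \<phi>"
proof -
  have "flip a b W (flip a b W \<phi>) = \<phi>" for W
    by (auto simp: flip_def fun_eq_iff option.map_comp o_def option.map_ident)
  then show ?thesis using kempe_comp_kempe by (simp add: kempe_def)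
qed

lemma kempe_coloring:
  assumes "a \<in> {1..\<kappa>}" "b \<in> {1..\<kappa>}"
  shows "kempe a b u \<phi> \<in> colorings \<kappa> (edges F)"
proof -
  have "dom (kempe a b u \<phi>) = edges F"
    using coloring_dom[OF col] by (auto simp: kempe_def flip_def dom_def split: if_splits)
  moreover have "ran (kempe a b u \<phi>) \<subseteq> {1..\<kappa>}"
  proof
    fix c assume "c \<in> ran (kempe a b u \<phi>)"
    then obtain e where "kempe a b u \<phi> e = Some c" by (auto simp: ran_def)
    then have "\<phi> e = Some c \<or> \<phi> e = Some (Transposition.transpose a b c)"
      by (auto simp: kempe_def flip_def transpose_eq_Some split: if_splits)
    then show "c \<in> {1..\<kappa>}"
      using coloring_SomeD(2)[OF col] assms
      by (metis transpose_apply_first transpose_apply_second transpose_apply_other)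
  qed
  moreover have "kempe a b u \<phi> e \<noteq> kempe a b u \<phi> e'"
    if "e \<in> edges F" "e' \<in> edges F" "e \<noteq> e'" "x \<in> e" "x \<in> e'" for e e' x
  proof
    assume eq: "kempe a b u \<phi> e = kempe a b u \<phi> e'"
    then have "\<phi> e = \<phi> e'"
      unfolding kempe_at[OF that(4)] kempe_at[OF that(5)]
      by (simp split: if_splits add: option.inj_map[OF inj_transpose, THEN inj_eq])
    then show False using coloring_edge[OF col that(1)] coloring_proper[OF col] that by metis
  qed
  ultimately show ?thesis unfolding colorings_def by blast
qed

lemma avail_kempe:
  assumes "a \<in> {1..\<kappa>}" "b \<in> {1..\<kappa>}"
  shows "c \<in> avail \<kappa> (kempe a b u \<phi>) x \<longleftrightarrow>
    (if x \<in> kempe_comp a b u \<phi> then Transposition.transpose a b c else c) \<in> avail \<kappa> \<phi> x"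
proof -
  have "Transposition.transpose a b c \<in> {1..\<kappa>} \<longleftrightarrow> c \<in> {1..\<kappa>}"
    using assms by (metis transpose_apply_first transpose_apply_second transpose_apply_other)
  then show ?thesis using kempe_at by (auto simp: mem_avail transpose_eq_Some)
qed

lemma kempe_comp_subset: "kempe_comp a b u \<phi> \<subseteq> tree (edges F) u"
  unfolding kempe_comp_def by (rule tree_mono) (use coloring_SomeD(1)[OF col] in auto)

lemma kempe_comp_avail:
  assumes "a \<in> avail \<kappa> \<phi> u" "b \<in> avail \<kappa> \<phi> u"
  shows "kempe_comp a b u \<phi> = {u}"
proof -
  have "x = u" if "x \<in> kempe_comp a b u \<phi>" for x
    using that assms by (induction rule: kempe_comp_induct) (auto simp: mem_avail)
  then show ?thesis using kempe_comp_self by blast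
qed

lemma kempe_avail:
  assumes "a \<in> avail \<kappa> \<phi> u" "b \<in> avail \<kappa> \<phi> u"
  shows "kempe a b u \<phi> = \<phi>"
  using assms unfolding kempe_def kempe_comp_avail[OF assms]
  by (auto simp: flip_def fun_eq_iff mem_avail intro: transpose_other)

end

end

text \<open>The common ground of both updates: \<open>F\<close> is the forest without the edge
  between \<open>p\<close> and \<open>r\<close>, that is, before an insertion and after a deletion.
  All other edges that get recolored lie in the tree of the root \<open>r\<close>.\<close>

locale rooted_tree_on = rooted_forest_on +
  fixes r :: vertex
  assumes root: "r \<in> roots F"
begin

abbreviation "T \<equiv> tree (edges F) r"

lemma finite_T: "finite T"
  using tree_less roots_less[OF root] by (intro finite_subset[of T "{..<n}"]) auto

lemma children_edge: "x \<in> children F v \<Longrightarrow> {v, x} \<in> edges F"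
  by (simp add: children_def parent_edge)

lemma children_T: "v \<in> T \<Longrightarrow> x \<in> children F v \<Longrightarrow> x \<in> T"
  using children_edge tree_edge tree_trans by blast

lemma edge_children: "{v, x} \<in> edges F \<Longrightarrow> x \<in> children F v \<or> v \<in> children F x"
  using parent_total by (auto simp: children_def)

lemma children_asym: "x \<in> children F v \<Longrightarrow> v \<notin> children F x"
  using parent_asym by (auto simp: children_def)

lemma children_unique: "x \<in> children F v \<Longrightarrow> x \<in> children F u \<Longrightarrow> v = u"
  using parent_unique by (auto simp: children_def)

lemma root_not_child: "r \<notin> children F v"
  using root_no_parent[OF root] by (auto simp: children_def)

text \<open>
  Invariant of the walk: \<open>V\<close> is the path from \<open>r\<close> to the current vertex \<open>v\<close>, the edges of this path
  have been swapped already, and \<open>\<beta>\<close> is the color that the next edge of the chain must have.  The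
  edge \<open>e\<^sub>0\<close> is the updated one; it lies outside the forest whose coloring is swapped.
\<close>

lemma fix_forbidden_flip:
  fixes \<alpha> \<beta> :: color
  assumes col: "\<phi> \<in> colorings \<kappa> (edges F)"
    and ch: "\<And>x. x \<in> T \<Longrightarrow> children F' x = children F x"
    and e0: "e\<^sub>0 \<notin> edges F"
    and V: "v \<in> V" "V \<subseteq> kempe_comp \<alpha> \<beta> r \<phi>" "r \<in> V"
    and closed: "\<And>x y. x \<in> V - {v} \<Longrightarrow> \<phi> {x, y} = Some \<alpha> \<or> \<phi> {x, y} = Some \<beta> \<Longrightarrow> y \<in> V"
    and prev: "\<And>y. \<phi> {v, y} = Some \<alpha> \<Longrightarrow> y \<in> V - {v}"
    and down: "\<And>y. y \<in> V - {v} \<Longrightarrow> \<phi> {v, y} = Some \<alpha> \<or> \<phi> {v, y} = Some \<beta> \<Longrightarrow> v \<in> children F y"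
    and par: "v = r \<or> (\<exists>u \<in> V - {v}. v \<in> children F u)"
  shows "fix_forbidden F' v \<alpha> \<beta> ((flip \<alpha> \<beta> (V - {v}) \<phi>)(e\<^sub>0 := c)) = (kempe \<alpha> \<beta> r \<phi>)(e\<^sub>0 := c)"
  using V closed prev down par
\<comment> \<open>\<open>fix_forbidden\<close> brings no termination argument of its own, so the
  induction is on the part of the component not yet visited, which is finite. The colors are
  generalized because every step exchanges them.\<close>
proof (induction "card (kempe_comp \<alpha> \<beta> r \<phi> - V)" arbitrary: v V \<alpha> \<beta> rule: less_induct)
  case less
  let ?C = "kempe_comp \<alpha> \<beta> r \<phi>"
  let ?\<phi>' = "(flip \<alpha> \<beta> (V - {v}) \<phi>)(e\<^sub>0 := c)"
  note closed = less.prems(4) and prev = less.prems(5) and down = less.prems(6)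
  have CT: "?C \<subseteq> T" using kempe_comp_subset[OF col] .
  have vT: "v \<in> T" using less.prems(1,2) CT by blast
  have ne0: "{v, w} \<noteq> e\<^sub>0" if "w \<in> children F v" for w
    using children_edge[OF that] e0 by auto
  have out: "?\<phi>' {v, w} = \<phi> {v, w}" if "w \<in> children F v" "w \<notin> V" for w
    using that ne0 by (auto simp: flip_def)
  \<comment> \<open>A child \<open>w\<close> on the path whose edge now has color \<beta> would have
    had \<alpha> there originally, but the edge colored \<alpha> at \<open>v\<close> leads
    upwards.\<close>
  have notV: "w \<notin> V" if w: "w \<in> children F v" "?\<phi>' {v, w} = Some \<beta>" for w
  proof
    assume "w \<in> V"
    have "w \<noteq> v" using edge_neq[OF children_edge[OF w(1)]] by auto
    then have "\<phi> {v, w} = Some \<alpha>"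
      using w(2) \<open>w \<in> V\<close> ne0[OF w(1)]
      by (simp add: flip_def transpose_eq_Some del: map_option_eq_Some split: if_splits)
    then have "v \<in> children F w" using down prev by blast
    then show False using children_asym w by blast
  qed
  show ?case
  proof (cases "\<exists>w \<in> children F v. ?\<phi>' {v, w} = Some \<beta>")
    case True
    then obtain w where w: "w \<in> children F v" "?\<phi>' {v, w} = Some \<beta>" by blast
    have wV: "w \<notin> V" using notV w by blast
    have wb: "\<phi> {v, w} = Some \<beta>" using out w wV by simp
    have uniq: "w' = w" if "w' \<in> children F v \<and> ?\<phi>' {v, w'} = Some \<beta>" for w'
    proof -
      have "\<phi> {v, w'} = Some \<beta>" using out[of w'] notV[of w'] that by metis
      then show ?thesis by (rule coloring_proper'[OF col _ wb])
    qed
    have the: "(THE w. w \<in> children F' v \<and> ?\<phi>' {v, w} = Some \<beta>) = w"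
      unfolding ch[OF vT] by (rule the_equality, rule conjI[OF w], rule uniq)
    have wv: "w \<noteq> v" using wV less.prems(1) by auto
    \<comment> \<open>Adding \<open>v\<close> to the swapped set affects only edges that meet the
      path in \<open>v\<close> alone, and of these just \<open>{v, w}\<close> carries \<alpha> or
      \<beta>.\<close>
    have same: "map_option (Transposition.transpose \<alpha> \<beta>) (\<phi> e) = \<phi> e"
      if ve: "v \<in> e" "e \<inter> (V - {v}) = {}" "e \<noteq> {v, w}" for e
    proof (rule transpose_other)
      show "\<phi> e \<noteq> Some \<beta>" using coloring_proper[OF col wb _ insertI1 ve(1)] ve(3) by metis
      show "\<phi> e \<noteq> Some \<alpha>"
      proof
        assume a: "\<phi> e = Some \<alpha>"
        obtain y where "e = {v, y}"
          using edge_ends_at[OF coloring_SomeD(1)[OF col a] ve(1)] by blast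
        then show False using prev[of y] a ve(2) by blast
      qed
    qed
    have upd: "?\<phi>'({v, w} \<mapsto> \<alpha>) = (flip \<beta> \<alpha> (insert w V - {w}) \<phi>)(e\<^sub>0 := c)"
    proof
      fix e
      have eq: "insert w V - {w} = V" using wV by auto
      show "(?\<phi>'({v, w} \<mapsto> \<alpha>)) e = ((flip \<beta> \<alpha> (insert w V - {w}) \<phi>)(e\<^sub>0 := c)) e"
      proof (cases "e = e\<^sub>0 \<or> e = {v, w}")
        case True
        have "{v, w} \<inter> V \<noteq> {}" using less.prems(1) by blast
        then show ?thesis unfolding eq using True ne0[OF w(1)] wb
          by (elim disjE) (simp_all add: flip_def)
      next
        case False
        have "flip \<alpha> \<beta> (V - {v}) \<phi> e = flip \<alpha> \<beta> V \<phi> e"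
        proof (cases "v \<in> e")
          case True
          then have "e \<inter> V \<noteq> {}" using less.prems(1) by blast
          then show ?thesis using same[of e] True False by (simp add: flip_def)
        next
          case False
          then have "e \<inter> (V - {v}) = e \<inter> V" by blast
          then show ?thesis by (simp add: flip_def)
        qed
        then show ?thesis unfolding eq using False
          by (simp add: flip_def Transposition.transpose_commute)
      qed
    qed
    have "fix_forbidden F' v \<alpha> \<beta> ?\<phi>' = fix_forbidden F' w \<beta> \<alpha> (?\<phi>'({v, w} \<mapsto> \<alpha>))"
      using True the ch[OF vT] by (subst fix_forbidden.simps) (auto simp: Let_def)
    also have "\<dots> = fix_forbidden F' w \<beta> \<alpha> ((flip \<beta> \<alpha> (insert w V - {w}) \<phi>)(e\<^sub>0 := c))"
      by (simp only: upd)
    also have "\<dots> = (kempe \<beta> \<alpha> r \<phi>)(e\<^sub>0 := c)"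
    proof (rule less.hyps)
      have wC: "w \<in> ?C" using less.prems(1,2) wb kempe_comp_step by blast
      have "finite ?C" using CT finite_T finite_subset by blast
      then show "card (kempe_comp \<beta> \<alpha> r \<phi> - insert w V) < card (?C - V)"
        using wC wV unfolding kempe_comp_commute[of \<beta>] by (intro psubset_card_mono) auto
      show "insert w V \<subseteq> kempe_comp \<beta> \<alpha> r \<phi>"
        using wC less.prems(2) unfolding kempe_comp_commute[of \<beta>] by auto
      show "y \<in> insert w V"
        if "x \<in> insert w V - {w}" "\<phi> {x, y} = Some \<beta> \<or> \<phi> {x, y} = Some \<alpha>" for x y
      proof (cases "x = v")
        case True
        then show ?thesis using that prev coloring_proper'[OF col wb] by auto
      next
        case False
        then show ?thesis using that closed[of x y] by auto
      qed
      show "y \<in> insert w V - {w}" if "\<phi> {w, y} = Some \<beta>" for y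
        using coloring_proper'[OF col that, of v] wb less.prems(1) wv by (auto simp: insert_commute)
      show "w \<in> children F y"
        if "y \<in> insert w V - {w}" "\<phi> {w, y} = Some \<beta> \<or> \<phi> {w, y} = Some \<alpha>" for y
        using that closed[of y w] wV w(1) by (cases "y = v") (auto simp: insert_commute)
      show "w = r \<or> (\<exists>u\<in>insert w V - {w}. w \<in> children F u)"
        using w less.prems(1) wv by auto
    qed (use less.prems(3) in auto)
    finally show ?thesis by (simp add: kempe_commute)
  next
    case False
    \<comment> \<open>The walk has stopped, so the path is closed: no chain edge leaves it downwards
      by the failed test, nor upwards, since the parent of \<open>v\<close> is already on it. Hence
      it is the whole component.\<close>
    have step: "y \<in> V" if "x \<in> V" "\<phi> {x, y} = Some \<alpha> \<or> \<phi> {x, y} = Some \<beta>" for x y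
    proof (cases "x = v \<and> \<phi> {x, y} = Some \<beta>")
      case True
      then have e: "{v, y} \<in> edges F" using coloring_SomeD[OF col] by blast
      show ?thesis
      proof (cases "y \<in> children F v")
        case True
        show ?thesis
        proof (rule ccontr)
          assume "y \<notin> V"
          then have "?\<phi>' {v, y} = Some \<beta>" 
            using out[OF True] \<open>x = v \<and> \<phi> {x, y} = Some \<beta>\<close> by metis
          then show False using False True by blast
        qed
      next
        case False
        then have "v \<in> children F y" using edge_children[OF e] by blast
        then show ?thesis using less.prems(7) root_not_child children_unique by blast
      qed
    next
      case False
      then show ?thesis using that closed prev by blast
    qed
    have "y \<in> V" if "y \<in> ?C" for y
      using that by (induction rule: kempe_comp_induct) (use step less.prems(3) in auto)
    then have CV: "?C = V" using less.prems(2) by blast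
    have "flip \<alpha> \<beta> (V - {v}) \<phi> e = flip \<alpha> \<beta> V \<phi> e" for e
    proof (cases "v \<in> e \<and> e \<inter> (V - {v}) = {}")
      case True
      have "\<phi> e \<noteq> Some \<gamma>" if g: "\<gamma> = \<alpha> \<or> \<gamma> = \<beta>" for \<gamma>
      proof
        assume a: "\<phi> e = Some \<gamma>"
        obtain y where y: "e = {v, y}" "v \<noteq> y"
          using edge_ends_at[OF coloring_SomeD(1)[OF col a]] True by blast
        then have "y \<in> V" using step[OF less.prems(1), of y] a g by auto
        then show False using True y by auto
      qed
      then show ?thesis using True transpose_other[of "\<phi> e" \<alpha> \<beta>] by (auto simp: flip_def)
    next
      case False
      then show ?thesis using less.prems(1) by (auto simp: flip_def)
    qed
    then have "flip \<alpha> \<beta> (V - {v}) \<phi> = kempe \<alpha> \<beta> r \<phi>" by (simp add: kempe_def CV fun_eq_iff)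
    then show ?thesis
      using False ch[OF vT] by (subst fix_forbidden.simps) (auto simp: Let_def)
  qed
qed

text \<open>The walk begins with the path consisting of \<open>r\<close> alone; as \<alpha> is free
  there, no edge colored \<alpha> has to be accounted for. The parameters \<open>F'\<close> and
  \<open>c\<close> cover insertions (the linked forest, \<open>Some \<beta>\<close>) as well as
  deletions (\<open>F\<close> itself, \<open>None\<close>).\<close>

lemma fix_forbidden_kempe:
  assumes "\<phi> \<in> colorings \<kappa> (edges F)" "\<And>x. x \<in> T \<Longrightarrow> children F' x = children F x"
    "e\<^sub>0 \<notin> edges F" "\<alpha> \<in> avail \<kappa> \<phi> r"
  shows "fix_forbidden F' r \<alpha> \<beta> (\<phi>(e\<^sub>0 := c)) = (kempe \<alpha> \<beta> r \<phi>)(e\<^sub>0 := c)"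
  using fix_forbidden_flip[OF assms(1-3), of r "{r}" \<alpha> \<beta>] assms(4)
  by (auto simp: flip_def mem_avail)

text \<open>Both procedures recolor the first edge themselves and call \<open>fix_forbidden\<close>
  at the child with the colors exchanged; this amounts to one unfolding of a walk begun at
  \<open>r\<close>.\<close>

lemma fix_forbidden_start:
  assumes "\<phi> \<in> colorings \<kappa> (edges F)" "\<And>x. x \<in> T \<Longrightarrow> children F' x = children F x"
    "e\<^sub>0 \<notin> edges F" "\<alpha> \<in> avail \<kappa> \<phi> r" "w \<in> children F r" "\<phi> {r, w} = Some \<beta>"
  shows "fix_forbidden F' w \<beta> \<alpha> (\<phi>(e\<^sub>0 := c, {r, w} \<mapsto> \<alpha>)) = (kempe \<alpha> \<beta> r \<phi>)(e\<^sub>0 := c)"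
proof -
  have ch: "children F' r = children F r" using assms(2) by simp
  have ne: "{r, x} \<noteq> e\<^sub>0" if "x \<in> children F r" for x
    using children_edge[OF that] assms(3) by auto
  have "(THE x. x \<in> children F r \<and> (\<phi>(e\<^sub>0 := c)) {r, x} = Some \<beta>) = w"
    using assms(5,6) ne coloring_proper'[OF assms(1)] by (intro the_equality) auto
  then have "fix_forbidden F' r \<alpha> \<beta> (\<phi>(e\<^sub>0 := c)) =
      fix_forbidden F' w \<beta> \<alpha> (\<phi>(e\<^sub>0 := c, {r, w} \<mapsto> \<alpha>))"
    using assms(5,6) ne ch by (subst fix_forbidden.simps) (auto simp: Let_def)
  then show ?thesis using fix_forbidden_kempe[OF assms(1-4)] by simp
qed

end

subsection \<open>Counting Kempe chains\<close>

text \<open>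
  The two sides of the bijection: in \<open>swap_pre\<close> the colors \<open>\<alpha>, \<beta>\<close> are those drawn by an insertion
  of \<open>{p, r}\<close>, in \<open>swap_post\<close> the edge may receive \<open>\<beta>\<close>.
\<close>

definition swap_pre :: "nat \<Rightarrow> edge set \<Rightarrow> vertex \<Rightarrow> vertex \<Rightarrow> (coloring \<times> color \<times> color) set" where
  "swap_pre \<kappa> E p r = (SIGMA \<phi>:colorings \<kappa> E. avail \<kappa> \<phi> r \<times> avail \<kappa> \<phi> p)"

definition swap_post :: "nat \<Rightarrow> edge set \<Rightarrow> vertex \<Rightarrow> vertex \<Rightarrow> (coloring \<times> color \<times> color) set" where
  "swap_post \<kappa> E p r =
     {(\<psi>, \<alpha>, \<beta>). \<psi> \<in> colorings \<kappa> E \<and> \<alpha> \<in> {1..\<kappa>} \<and> \<beta> \<in> avail \<kappa> \<psi> r \<and> \<beta> \<in> avail \<kappa> \<psi> p}"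

lemma finite_swap_post:
  assumes "finite E"
  shows "finite (swap_post \<kappa> E p r)"
proof (rule finite_subset)
  show "swap_post \<kappa> E p r \<subseteq> colorings \<kappa> E \<times> {1..\<kappa>} \<times> {1..\<kappa>}"
    by (auto simp: swap_post_def mem_avail)
qed (simp add: finite_colorings[OF assms])

definition changed :: "color \<Rightarrow> color \<Rightarrow> vertex \<Rightarrow> coloring \<Rightarrow> edge set" where
  "changed a b r \<phi> = {e \<in> dom \<phi>. kempe a b r \<phi> e \<noteq> \<phi> e}"

context rooted_tree_on
begin

text \<open>At \<open>r\<close> the swap exchanges the roles of \<alpha> and \<beta>, so that one is
  free after it iff the other was before; at \<open>p\<close>, which lies in another tree, it
  changes nothing.\<close>

lemma swap_bij:
  assumes "p \<notin> T"
  shows "bij_betw (\<lambda>(\<phi>, \<alpha>, \<beta>). (kempe \<alpha> \<beta> r \<phi>, \<alpha>, \<beta>))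
    (swap_pre \<kappa> (edges F) p r) (swap_post \<kappa> (edges F) p r)"
proof -
  have av: "\<beta> \<in> avail \<kappa> (kempe \<alpha> \<beta> r \<phi>) r \<longleftrightarrow> \<alpha> \<in> avail \<kappa> \<phi> r"
    "\<alpha> \<in> avail \<kappa> (kempe \<alpha> \<beta> r \<phi>) r \<longleftrightarrow> \<beta> \<in> avail \<kappa> \<phi> r"
    "c \<in> avail \<kappa> (kempe \<alpha> \<beta> r \<phi>) p \<longleftrightarrow> c \<in> avail \<kappa> \<phi> p"
    if "\<phi> \<in> colorings \<kappa> (edges F)" "\<alpha> \<in> {1..\<kappa>}" "\<beta> \<in> {1..\<kappa>}" for \<phi> \<alpha> \<beta> c
  proof -
    have "p \<notin> kempe_comp \<alpha> \<beta> r \<phi>" using kempe_comp_subset[OF that(1)] assms by blast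
    then show "c \<in> avail \<kappa> (kempe \<alpha> \<beta> r \<phi>) p \<longleftrightarrow> c \<in> avail \<kappa> \<phi> p"
      by (simp add: avail_kempe[OF that])
  qed (simp_all add: avail_kempe[OF that])
  have mem: "c \<in> {1..\<kappa>}" if "c \<in> avail \<kappa> \<phi> x" for c \<phi> x using that by (simp add: mem_avail)
  show ?thesis
  proof (rule bij_betw_byWitness[where f' = "\<lambda>(\<phi>, \<alpha>, \<beta>). (kempe \<alpha> \<beta> r \<phi>, \<alpha>, \<beta>)"])
    show "(\<lambda>(\<phi>, \<alpha>, \<beta>). (kempe \<alpha> \<beta> r \<phi>, \<alpha>, \<beta>)) ` swap_pre \<kappa> (edges F) p r
        \<subseteq> swap_post \<kappa> (edges F) p r"
    proof (clarsimp simp: swap_pre_def swap_post_def)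
      fix \<phi> \<alpha> \<beta>
      assume *: "\<phi> \<in> colorings \<kappa> (edges F)" "\<alpha> \<in> avail \<kappa> \<phi> r" "\<beta> \<in> avail \<kappa> \<phi> p"
      note ** = *(1) mem[OF *(2)] mem[OF *(3)]
      show "kempe \<alpha> \<beta> r \<phi> \<in> colorings \<kappa> (edges F) \<and> Suc 0 \<le> \<alpha> \<and> \<alpha> \<le> \<kappa> \<and>
          \<beta> \<in> avail \<kappa> (kempe \<alpha> \<beta> r \<phi>) r \<and> \<beta> \<in> avail \<kappa> (kempe \<alpha> \<beta> r \<phi>) p"
        using av[OF **] kempe_coloring[OF **] * mem[OF *(2)] by simp
    qed
    show "(\<lambda>(\<phi>, \<alpha>, \<beta>). (kempe \<alpha> \<beta> r \<phi>, \<alpha>, \<beta>)) ` swap_post \<kappa> (edges F) p r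
        \<subseteq> swap_pre \<kappa> (edges F) p r"
    proof (clarsimp simp: swap_pre_def swap_post_def)
      fix \<phi> \<alpha> \<beta>
      assume *: "\<phi> \<in> colorings \<kappa> (edges F)" "\<beta> \<in> avail \<kappa> \<phi> r" "\<beta> \<in> avail \<kappa> \<phi> p"
        "Suc 0 \<le> \<alpha>" "\<alpha> \<le> \<kappa>"
      have **: "\<phi> \<in> colorings \<kappa> (edges F)" "\<alpha> \<in> {1..\<kappa>}" "\<beta> \<in> {1..\<kappa>}"
        using * mem[OF *(2)] by auto
      show "kempe \<alpha> \<beta> r \<phi> \<in> colorings \<kappa> (edges F) \<and>
          \<alpha> \<in> avail \<kappa> (kempe \<alpha> \<beta> r \<phi>) r \<and> \<beta> \<in> avail \<kappa> (kempe \<alpha> \<beta> r \<phi>) p"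
        using av[OF **] kempe_coloring[OF **] * by simp
    qed
  qed (auto simp: swap_pre_def swap_post_def kempe_involution)
qed

text \<open>The component of \<open>r\<close> traced downwards only, as the algorithm does; this
  permits induction along the path from the root.\<close>

inductive_set chain :: "color \<Rightarrow> color \<Rightarrow> coloring \<Rightarrow> vertex set"
  for \<alpha> \<beta> :: color and \<phi> :: coloring where
  chain_root: "r \<in> chain \<alpha> \<beta> \<phi>"
| chain_step: "y \<in> chain \<alpha> \<beta> \<phi> \<Longrightarrow> x \<in> children F y \<Longrightarrow>
    \<phi> {y, x} = Some \<alpha> \<or> \<phi> {y, x} = Some \<beta> \<Longrightarrow> x \<in> chain \<alpha> \<beta> \<phi>"

text \<open>An edge leading upwards from a reached vertex ends in its parent, through which the
  vertex was entered.\<close>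

lemma kempe_comp_chain:
  assumes "\<phi> \<in> colorings \<kappa> (edges F)"
  shows "kempe_comp \<alpha> \<beta> r \<phi> = chain \<alpha> \<beta> \<phi>"
proof
  show "chain \<alpha> \<beta> \<phi> \<subseteq> kempe_comp \<alpha> \<beta> r \<phi>"
  proof
    fix x assume "x \<in> chain \<alpha> \<beta> \<phi>"
    then show "x \<in> kempe_comp \<alpha> \<beta> r \<phi>"
      by (induction rule: chain.induct) (blast intro: kempe_comp_self kempe_comp_step)+
  qed
  show "kempe_comp \<alpha> \<beta> r \<phi> \<subseteq> chain \<alpha> \<beta> \<phi>"
  proof
    fix x assume "x \<in> kempe_comp \<alpha> \<beta> r \<phi>"
    then show "x \<in> chain \<alpha> \<beta> \<phi>"
    proof (induction rule: kempe_comp_induct)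
      case self
      show ?case by (rule chain_root)
    next
      case (step y z)
      have "{y, z} \<in> edges F" using step.hyps(2) coloring_SomeD(1)[OF assms] by blast
      then consider "z \<in> children F y" | "y \<in> children F z" using edge_children by blast
      then show ?case
      proof cases
        case 1
        then show ?thesis using step chain_step by blast
      next
        case 2
        from step.IH show ?thesis
        proof cases
          case chain_root
          then show ?thesis using 2 root_not_child by blast
        next
          case (chain_step y')
          then show ?thesis using children_unique[OF 2] by blast
        qed
      qed
    qed
  qed
qed

lemma kempe_comp_child:
  assumes "\<phi> \<in> colorings \<kappa> (edges F)" "x \<in> children F y"
  shows "x \<in> kempe_comp \<alpha> \<beta> r \<phi> \<longleftrightarrow>
    y \<in> kempe_comp \<alpha> \<beta> r \<phi> \<and> (\<phi> {y, x} = Some \<alpha> \<or> \<phi> {y, x} = Some \<beta>)"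
proof
  assume "x \<in> kempe_comp \<alpha> \<beta> r \<phi>"
  then have "x \<in> chain \<alpha> \<beta> \<phi>" using kempe_comp_chain[OF assms(1)] by blast
  then show "y \<in> kempe_comp \<alpha> \<beta> r \<phi> \<and> (\<phi> {y, x} = Some \<alpha> \<or> \<phi> {y, x} = Some \<beta>)"
  proof cases
    case chain_root
    then show ?thesis using assms(2) root_not_child by blast
  next
    case (chain_step y')
    then show ?thesis using children_unique[OF assms(2)] kempe_comp_chain[OF assms(1)] by blast
  qed
qed (use kempe_comp_step in blast)

text \<open>Each vertex of the component other than \<open>r\<close> is charged with the edge to its
  parent, which does change because the two colors differ.\<close>

lemma card_changed:
  assumes col: "\<phi> \<in> colorings \<kappa> (edges F)" and ne: "\<alpha> \<noteq> \<beta>"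
  shows "card (changed \<alpha> \<beta> r \<phi>) = card (kempe_comp \<alpha> \<beta> r \<phi> - {r})"
proof -
  let ?C = "kempe_comp \<alpha> \<beta> r \<phi>"
  define par where "par x = (SOME y. x \<in> children F y)" for x
  have par: "par x = y" if "x \<in> children F y" for x y
    using that children_unique someI[of "\<lambda>y. x \<in> children F y"] unfolding par_def by blast
  have up: "x \<in> children F (par x) \<and> (\<phi> {par x, x} = Some \<alpha> \<or> \<phi> {par x, x} = Some \<beta>)"
    if "x \<in> ?C - {r}" for x
  proof -
    have "x \<in> chain \<alpha> \<beta> \<phi>" "x \<noteq> r" using that kempe_comp_chain[OF col] by auto
    then obtain y where "x \<in> children F y" "\<phi> {y, x} = Some \<alpha> \<or> \<phi> {y, x} = Some \<beta>"
      by (cases rule: chain.cases) auto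
    then show ?thesis using par by simp
  qed
  have "inj_on (\<lambda>x. {par x, x}) (?C - {r})"
  proof (rule inj_onI)
    fix x y assume xy: "x \<in> ?C - {r}" "y \<in> ?C - {r}" "{par x, x} = {par y, y}"
    show "x = y"
    proof (rule ccontr)
      assume "x \<noteq> y"
      then have "par x = y" "par y = x" using xy(3) by (metis doubleton_eq_iff)+
      then show False using up[OF xy(1)] up[OF xy(2)] children_asym by metis
    qed
  qed
  moreover have "(\<lambda>x. {par x, x}) ` (?C - {r}) = changed \<alpha> \<beta> r \<phi>"
  proof (rule set_eqI, rule iffI)
    fix e assume "e \<in> (\<lambda>x. {par x, x}) ` (?C - {r})"
    then obtain x where x: "x \<in> ?C - {r}" "e = {par x, x}" by blast
    have xe: "x \<in> e" using x by blast
    have "\<phi> e = Some \<alpha> \<or> \<phi> e = Some \<beta>" using up[OF x(1)] x(2) by blast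
    moreover have "kempe \<alpha> \<beta> r \<phi> e = map_option (Transposition.transpose \<alpha> \<beta>) (\<phi> e)"
      using kempe_at[OF col xe] x(1) by simp
    ultimately show "e \<in> changed \<alpha> \<beta> r \<phi>" using ne by (auto simp: changed_def)
  next
    fix e assume e: "e \<in> changed \<alpha> \<beta> r \<phi>"
    then have eE: "e \<in> edges F" using coloring_dom[OF col] by (simp add: changed_def)
    obtain u v where uv: "e = {u, v}" using edge_ends[OF eE] by blast
    have ch: "kempe \<alpha> \<beta> r \<phi> e \<noteq> \<phi> e" using e by (simp add: changed_def)
    have "x \<in> ?C" if "x \<in> e" for x
      using ch kempe_at[OF col that, of \<alpha> \<beta> r] by metis
    then have C: "u \<in> ?C" "v \<in> ?C" using uv by blast+
    have *: "e \<in> (\<lambda>x. {par x, x}) ` (?C - {r})" if "e = {y, x}" "x \<in> children F y" "x \<in> ?C" for x y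
    proof -
      have "x \<noteq> r" using root_not_child that by blast
      then show ?thesis using that par[OF that(2)] by blast
    qed
    have "v \<in> children F u \<or> u \<in> children F v" using eE uv edge_children by blast
    then show "e \<in> (\<lambda>x. {par x, x}) ` (?C - {r})"
      using *[of u v] *[of v u] uv C by (metis insert_commute)
  qed
  ultimately show ?thesis using card_image by metis
qed

text \<open>Equal colors do occur in \<open>swap_post\<close>, since \<alpha> ranges over the whole
  palette; then \<beta> is free at \<open>r\<close>, the component is trivial and both sides are
  0.\<close>

lemma card_changed_post:
  assumes "(\<psi>, \<alpha>, \<beta>) \<in> swap_post \<kappa> (edges F) p r"
  shows "card (changed \<alpha> \<beta> r \<psi>) = card (kempe_comp \<alpha> \<beta> r \<psi> - {r})"
proof (cases "\<alpha> = \<beta>")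
  case True
  then have "kempe_comp \<alpha> \<beta> r \<psi> = {r}"
    using assms kempe_comp_avail by (auto simp: swap_post_def)
  then show ?thesis using True by (simp add: changed_def kempe_same)
next
  case False
  then show ?thesis using assms card_changed by (auto simp: swap_post_def)
qed

section \<open>Depth levels below \<open>r\<close>\<close>

primrec lev :: "nat \<Rightarrow> vertex set" where
  "lev 0 = {r}"
| "lev (Suc d) = (\<Union>y\<in>lev d. children F y)"

lemma lev_T: "lev d \<subseteq> T"
  by (induction d) (use children_T in auto)

lemma finite_lev: "finite (lev d)"
  using finite_subset[OF lev_T finite_T] .

lemma lev_unique: "x \<in> lev d \<Longrightarrow> x \<in> lev d' \<Longrightarrow> d = d'"
proof (induction d arbitrary: x d')
  case 0
  then show ?case using root_not_child by (cases d') auto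
next
  case (Suc d)
  then obtain y where y: "y \<in> lev d" "x \<in> children F y" by auto
  then have "x \<noteq> r" using root_not_child by blast
  then obtain d'' where d': "d' = Suc d''" using Suc.prems by (cases d') auto
  then obtain z where "z \<in> lev d''" "x \<in> children F z" using Suc.prems by auto
  then show ?case using Suc.IH y children_unique d' by blast
qed

lemma T_lev: "x \<in> T \<Longrightarrow> \<exists>d. x \<in> lev d"
proof (induction rule: tree_induct)
  case refl
  have "r \<in> lev 0" by simp
  then show ?case by blast
next
  case (step y z)
  then obtain d where d: "y \<in> lev d" by blast
  consider "z \<in> children F y" | "y \<in> children F z" using step.hyps edge_children by blast
  then show ?case
  proof cases
    case 1
    then have "z \<in> lev (Suc d)" using d by auto
    then show ?thesis by blast
  next
    case 2
    then have "y \<noteq> r" using root_not_child by blast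
    then obtain d' where d': "d = Suc d'" using d by (cases d) auto
    then obtain z' where "z' \<in> lev d'" "y \<in> children F z'" using d by auto
    then show ?thesis using children_unique 2 by blast
  qed
qed

lemma sum_card_lev: "(\<Sum>d<k. card (lev d)) \<le> n"
proof -
  have "(\<Sum>d<k. card (lev d)) = card (\<Union>d<k. lev d)"
    by (rule card_UN_disjoint[symmetric]) (use finite_lev lev_unique in auto)
  also have "\<dots> \<le> card {..<n}"
    using lev_T tree_less roots_less[OF root] by (intro card_mono) auto
  finally show ?thesis by simp
qed

text \<open>A vertex of depth \<open>d\<close> would come with \<open>d + 1\<close> disjoint
  nonempty levels. Sums over levels may thus stop at \<open>n\<close>.\<close>

lemma lev_empty:
  assumes "n \<le> d"
  shows "lev d = {}"
proof (rule ccontr)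
  assume ne: "lev d \<noteq> {}"
  have nonempty: "lev k \<noteq> {}" if "k \<le> d" for k
    using that by (induction k rule: inc_induct) (use ne in auto)
  have "(\<Sum>k<Suc d. 1) \<le> (\<Sum>k<Suc d. card (lev k))"
  proof (rule sum_mono)
    fix k assume "k \<in> {..<Suc d}"
    then have "lev k \<noteq> {}" using nonempty[of k] by simp
    then have "card (lev k) \<noteq> 0" using finite_lev[of k] by simp
    then show "1 \<le> card (lev k)" by linarith
  qed
  then show False using sum_card_lev[of "Suc d"] assms by simp
qed

lemma T_minus_root: "T - {r} = (\<Union>d<n. lev (Suc d))"
proof
  show "T - {r} \<subseteq> (\<Union>d<n. lev (Suc d))"
  proof
    fix x assume x: "x \<in> T - {r}"
    then obtain d where d: "x \<in> lev d" using T_lev by blast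
    then obtain d' where d': "d = Suc d'" using x by (cases d) auto
    then have "d' < n" using lev_empty[of "Suc d'"] d by fastforce
    then show "x \<in> (\<Union>d<n. lev (Suc d))" using d d' by blast
  qed
  show "(\<Union>d<n. lev (Suc d)) \<subseteq> T - {r}"
    using lev_T root_not_child by fastforce
qed

text \<open>Divided by the size of \<open>swap_post\<close>, this is the probability that the Kempe
  chain reaches \<open>x\<close>.\<close>

definition count :: "nat \<Rightarrow> vertex \<Rightarrow> vertex \<Rightarrow> nat" where
  "count \<kappa> p x = card {(\<psi>, \<alpha>, \<beta>) \<in> swap_post \<kappa> (edges F) p r. x \<in> kempe_comp \<alpha> \<beta> r \<psi>}"

text \<open>As \<beta> is free at \<open>r\<close>, the chain can enter \<open>x\<close> only by
  color \<alpha>, and \<alpha> is independent of the rest of the triple: exactly one of its \<kappa>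
  values fits. Replacing that value by an arbitrary \<gamma> gives the bijection.\<close>

lemma count_child:
  assumes x: "x \<in> children F r"
  shows "count \<kappa> p x * \<kappa> = card (swap_post \<kappa> (edges F) p r)"
proof -
  let ?Y = "swap_post \<kappa> (edges F) p r"
  let ?A = "{(\<psi>, \<alpha>, \<beta>) \<in> ?Y. x \<in> kempe_comp \<alpha> \<beta> r \<psi>}"
  have iff: "x \<in> kempe_comp \<alpha> \<beta> r \<psi> \<longleftrightarrow> \<psi> {r, x} = Some \<alpha>" if "(\<psi>, \<alpha>, \<beta>) \<in> ?Y" for \<psi> \<alpha> \<beta>
    using that kempe_comp_child[OF _ x] by (auto simp: swap_post_def mem_avail)
  have ex: "\<exists>\<gamma>\<in>{1..\<kappa>}. \<psi> {r, x} = Some \<gamma>" if "(\<psi>, \<alpha>, \<beta>) \<in> ?Y" for \<psi> \<alpha> \<beta>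
  proof -
    have "\<psi> \<in> colorings \<kappa> (edges F)" using that by (simp add: swap_post_def)
    then show ?thesis using coloring_edge[OF _ children_edge[OF x]] by metis
  qed
  have A: "?A = {(\<psi>, \<alpha>, \<beta>) \<in> ?Y. \<psi> {r, x} = Some \<alpha>}" using iff by auto
  have "bij_betw (\<lambda>((\<psi>, \<alpha>, \<beta>), \<gamma>). (\<psi>, \<gamma>, \<beta>)) (?A \<times> {1..\<kappa>}) ?Y"
    unfolding A
  proof (rule bij_betw_byWitness[where f' = "\<lambda>(\<psi>, \<gamma>, \<beta>). ((\<psi>, the (\<psi> {r, x}), \<beta>), \<gamma>)"])
    show "(\<lambda>(\<psi>, \<gamma>, \<beta>). ((\<psi>, the (\<psi> {r, x}), \<beta>), \<gamma>)) ` ?Y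
      \<subseteq> {(\<psi>, \<alpha>, \<beta>) \<in> ?Y. \<psi> {r, x} = Some \<alpha>} \<times> {1..\<kappa>}"
    proof (rule image_subsetI)
      fix t assume t: "t \<in> ?Y"
      obtain \<psi> \<alpha> \<beta> where [simp]: "t = (\<psi>, \<alpha>, \<beta>)" by (cases t)
      show "(\<lambda>(\<psi>, \<gamma>, \<beta>). ((\<psi>, the (\<psi> {r, x}), \<beta>), \<gamma>)) t
        \<in> {(\<psi>, \<alpha>, \<beta>) \<in> ?Y. \<psi> {r, x} = Some \<alpha>} \<times> {1..\<kappa>}"
        using ex[of \<psi> \<alpha> \<beta>] t by (auto simp: swap_post_def)
    qed
  qed (auto simp: swap_post_def)
  then show ?thesis
    using bij_betw_same_card by (fastforce simp: count_def card_cartesian_product)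
qed

text \<open>
  Since neither \<open>\<gamma>\<close> nor \<open>\<delta>\<close> is the color of the parent edge of \<open>y\<close>, this swap stays below \<open>y\<close> and
  cannot disturb the chain on its way from \<open>r\<close> to \<open>y\<close>.
\<close>

lemma kempe_subtree:
  fixes \<alpha> \<beta> \<gamma> \<delta> :: color
  assumes zy: "z \<in> T" "y \<in> children F z"
    and p: "p \<notin> T"
    and Y: "(\<psi>, \<alpha>, \<beta>) \<in> swap_post \<kappa> (edges F) p r"
    and yC: "y \<in> kempe_comp \<alpha> \<beta> r \<psi>"
    and col: "\<gamma> \<in> {1..\<kappa>}" "\<delta> \<in> {1..\<kappa>}" "\<psi> {z, y} \<noteq> Some \<gamma>" "\<psi> {z, y} \<noteq> Some \<delta>"
  shows "(kempe \<delta> \<gamma> y \<psi>, \<alpha>, \<beta>) \<in> swap_post \<kappa> (edges F) p r"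
    and "y \<in> kempe_comp \<alpha> \<beta> r (kempe \<delta> \<gamma> y \<psi>)"
    and "kempe \<delta> \<gamma> y \<psi> {z, y} = \<psi> {z, y}"
proof -
  let ?E' = "edges F - {{z, y}}"
  let ?Q = "tree ?E' y"
  let ?\<psi>' = "kempe \<delta> \<gamma> y \<psi>"
  let ?C = "kempe_comp \<delta> \<gamma> y \<psi>"
  have psi: "\<psi> \<in> colorings \<kappa> (edges F)" using Y by (simp add: swap_post_def)
  have yT: "y \<in> T" using children_T zy by blast
  have par: "is_parent F z y" using zy by (simp add: children_def)
  have zQ: "z \<notin> ?Q" using acyclic_edge[OF parent_edge[OF par]] tree_sym by blast
  have "r \<in> tree ?E' z" using parent_root[OF par root] yT tree_sym by blast
  then have rQ: "r \<notin> ?Q" using zQ tree_sym tree_trans by blast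
  have CQ: "?C \<subseteq> ?Q"
  proof
    fix u assume "u \<in> ?C"
    then show "u \<in> ?Q"
    proof (induction rule: kempe_comp_induct)
      case (step u v)
      have "{u, v} \<noteq> {z, y}" using step.hyps(2) col(3,4) by metis
      moreover have "{u, v} \<in> edges F" using step.hyps(2) coloring_SomeD(1)[OF psi] by blast
      ultimately have "v \<in> tree ?E' u" by (intro tree_edge) blast
      then show ?case by (rule tree_trans[OF step.IH])
    qed simp
  qed
  have CT: "?C \<subseteq> T" using kempe_comp_subset[OF psi, of \<delta> \<gamma> y] yT tree_trans by blast
  show psi': "(?\<psi>', \<alpha>, \<beta>) \<in> swap_post \<kappa> (edges F) p r"
    using Y kempe_coloring[OF psi col(2,1)] avail_kempe[OF psi col(2,1)] CQ rQ CT p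
    by (auto simp: swap_post_def)
  show zy': "?\<psi>' {z, y} = \<psi> {z, y}"
    using kempe_at[OF psi insertI1, of \<delta> \<gamma> y z] zQ CQ by auto
  have keep: "v \<notin> ?Q \<longrightarrow> v \<in> chain \<alpha> \<beta> ?\<psi>'" if "v \<in> chain \<alpha> \<beta> \<psi>" for v
    using that
  proof (induction rule: chain.induct)
    case chain_root
    show ?case by (simp add: chain.chain_root)
  next
    case (chain_step u v)
    show ?case
    proof
      assume v: "v \<notin> ?Q"
      have "u \<notin> ?Q"
      proof
        assume u: "u \<in> ?Q"
        have "{u, v} = {z, y}"
        proof (rule ccontr)
          assume "{u, v} \<noteq> {z, y}"
          then have "v \<in> tree ?E' u" using children_edge[OF chain_step.hyps(2)]
            by (intro tree_edge) blast
          then show False using u v tree_trans by blast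
        qed
        then have "u = y \<and> v = z \<or> u = z" by (metis doubleton_eq_iff)
        then show False using u zQ children_asym chain_step.hyps(2) zy(2) by blast
      qed
      moreover have "?\<psi>' {u, v} = \<psi> {u, v}"
        using kempe_at[OF psi insertI1, of \<delta> \<gamma> y u] calculation CQ by auto
      ultimately show "v \<in> chain \<alpha> \<beta> ?\<psi>'"
        using chain_step chain.chain_step by metis
    qed
  qed
  have "z \<in> kempe_comp \<alpha> \<beta> r \<psi> \<and> (\<psi> {z, y} = Some \<alpha> \<or> \<psi> {z, y} = Some \<beta>)"
    using kempe_comp_child[OF psi zy(2)] yC by blast
  moreover have "?\<psi>' \<in> colorings \<kappa> (edges F)" using psi' by (simp add: swap_post_def)
  moreover have "z \<in> chain \<alpha> \<beta> \<psi> \<Longrightarrow> z \<in> chain \<alpha> \<beta> ?\<psi>'" using keep zQ by blast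
  ultimately show "y \<in> kempe_comp \<alpha> \<beta> r ?\<psi>'"
    using kempe_comp_child[OF _ zy(2)] kempe_comp_chain zy' psi by metis
qed

text \<open>Let \<open>oth\<close> be the one of the two colors that is not on
  \<open>{z, y}\<close>. A chain that has reached \<open>y\<close> proceeds to \<open>x\<close> iff
  \<open>{y, x}\<close> has color \<open>oth\<close>. This edge can have any of the \<kappa>-1
  colors not on \<open>{z, y}\<close>, and swapping \<open>oth\<close> with \<gamma> below
  \<open>y\<close> turns the case \<open>oth\<close> reversibly into the case \<gamma>. So triples
  reaching \<open>y\<close> correspond to pairs of a triple reaching \<open>x\<close> and such a
  \<gamma>.\<close>

lemma count_step:
  assumes zT: "z \<in> T" and zy: "y \<in> children F z" and yx: "x \<in> children F y" and p: "p \<notin> T"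
  shows "count \<kappa> p x * (\<kappa> - 1) = count \<kappa> p y"
proof -
  let ?Y = "swap_post \<kappa> (edges F) p r"
  define A where "A = {(\<psi>, \<alpha>, \<beta>) \<in> ?Y. x \<in> kempe_comp \<alpha> \<beta> r \<psi>}"
  define B where "B = {(\<psi>, \<alpha>, \<beta>) \<in> ?Y. y \<in> kempe_comp \<alpha> \<beta> r \<psi>}"
  define S where "S = (\<lambda>(\<psi>::coloring, \<alpha>::color, \<beta>::color). {1..\<kappa>} - {the (\<psi> {z, y})})"
  define oth where "oth \<psi> \<alpha> \<beta> = (if \<psi> {z, y} = Some \<alpha> then \<beta> else \<alpha>)"
    for \<psi> :: coloring and \<alpha> \<beta> :: color
  have yr: "y \<noteq> r" using zy root_not_child by blast
  have B: "\<exists>\<epsilon>\<in>{1..\<kappa>}. \<psi> {z, y} = Some \<epsilon> \<and> \<epsilon> \<noteq> oth \<psi> \<alpha> \<beta>" "oth \<psi> \<alpha> \<beta> \<in> {1..\<kappa>}"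
      "(\<psi>, \<alpha>, \<beta>) \<in> A \<longleftrightarrow> \<psi> {y, x} = Some (oth \<psi> \<alpha> \<beta>)"
      "\<exists>\<gamma>\<in>{1..\<kappa>}. \<psi> {y, x} = Some \<gamma> \<and> \<psi> {z, y} \<noteq> Some \<gamma>"
      "\<psi> \<in> colorings \<kappa> (edges F)"
    if t: "(\<psi>, \<alpha>, \<beta>) \<in> B" for \<psi> \<alpha> \<beta>
  proof -
    have Y: "(\<psi>, \<alpha>, \<beta>) \<in> ?Y" and yC: "y \<in> kempe_comp \<alpha> \<beta> r \<psi>" using t by (auto simp: B_def)
    show psi: "\<psi> \<in> colorings \<kappa> (edges F)" using Y by (simp add: swap_post_def)
    have ab: "\<alpha> \<in> {1..\<kappa>}" "\<beta> \<in> {1..\<kappa>}" "\<beta> \<in> avail \<kappa> \<psi> r"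
      using Y by (auto simp: swap_post_def mem_avail)
    have "\<alpha> \<noteq> \<beta>"
    proof
      assume "\<alpha> = \<beta>"
      then show False using kempe_comp_avail[OF psi ab(3) ab(3)] yC yr by auto
    qed
    moreover have zyc: "\<psi> {z, y} = Some \<alpha> \<or> \<psi> {z, y} = Some \<beta>"
      using kempe_comp_child[OF psi zy] yC by blast
    ultimately show "\<exists>\<epsilon>\<in>{1..\<kappa>}. \<psi> {z, y} = Some \<epsilon> \<and> \<epsilon> \<noteq> oth \<psi> \<alpha> \<beta>"
      using ab by (auto simp: oth_def)
    show "oth \<psi> \<alpha> \<beta> \<in> {1..\<kappa>}" using ab by (simp add: oth_def)
    have "x \<noteq> z" using zy yx children_asym by blast
    then have ne: "\<psi> {z, y} \<noteq> Some \<gamma>" if "\<psi> {y, x} = Some \<gamma>" for \<gamma>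
      using coloring_proper'[OF psi that, of z] by (metis insert_commute)
    obtain \<gamma> where "\<psi> {y, x} = Some \<gamma>" "\<gamma> \<in> {1..\<kappa>}"
      using coloring_edge[OF psi children_edge[OF yx]] .
    then show "\<exists>\<gamma>\<in>{1..\<kappa>}. \<psi> {y, x} = Some \<gamma> \<and> \<psi> {z, y} \<noteq> Some \<gamma>" using ne by blast
    have "(\<psi>, \<alpha>, \<beta>) \<in> A \<longleftrightarrow> \<psi> {y, x} = Some \<alpha> \<or> \<psi> {y, x} = Some \<beta>"
      using Y yC kempe_comp_child[OF psi yx] by (simp add: A_def)
    also have "\<dots> \<longleftrightarrow> \<psi> {y, x} = Some (oth \<psi> \<alpha> \<beta>)"
      using ne[of \<alpha>] ne[of \<beta>] zyc by (auto simp: oth_def)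
    finally show "(\<psi>, \<alpha>, \<beta>) \<in> A \<longleftrightarrow> \<psi> {y, x} = Some (oth \<psi> \<alpha> \<beta>)" .
  qed
  have AB: "A \<subseteq> B" using kempe_comp_child[OF _ yx] by (auto simp: A_def B_def swap_post_def)
  have swap: "(kempe (oth \<psi> \<alpha> \<beta>) \<gamma> y \<psi>, \<alpha>, \<beta>) \<in> B"
      "kempe (oth \<psi> \<alpha> \<beta>) \<gamma> y \<psi> {z, y} = \<psi> {z, y}"
      "oth (kempe (oth \<psi> \<alpha> \<beta>) \<gamma> y \<psi>) \<alpha> \<beta> = oth \<psi> \<alpha> \<beta>"
      "kempe (oth \<psi> \<alpha> \<beta>) \<gamma> y \<psi> {y, x} =
         map_option (Transposition.transpose (oth \<psi> \<alpha> \<beta>) \<gamma>) (\<psi> {y, x})"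
      "kempe (oth \<psi> \<alpha> \<beta>) \<gamma> y (kempe (oth \<psi> \<alpha> \<beta>) \<gamma> y \<psi>) = \<psi>"
    if t: "(\<psi>, \<alpha>, \<beta>) \<in> B" and g: "\<gamma> \<in> {1..\<kappa>}" "\<psi> {z, y} \<noteq> Some \<gamma>" for \<psi> \<alpha> \<beta> \<gamma>
  proof -
    have Y: "(\<psi>, \<alpha>, \<beta>) \<in> ?Y" and yC: "y \<in> kempe_comp \<alpha> \<beta> r \<psi>" using t by (auto simp: B_def)
    have "\<psi> {z, y} \<noteq> Some (oth \<psi> \<alpha> \<beta>)" using B(1)[OF t] by auto
    note k = kempe_subtree[OF zT zy p Y yC g(1) B(2)[OF t] g(2) this]
    show "(kempe (oth \<psi> \<alpha> \<beta>) \<gamma> y \<psi>, \<alpha>, \<beta>) \<in> B" using k by (simp add: B_def)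
    show "kempe (oth \<psi> \<alpha> \<beta>) \<gamma> y \<psi> {z, y} = \<psi> {z, y}" by (rule k)
    then show "oth (kempe (oth \<psi> \<alpha> \<beta>) \<gamma> y \<psi>) \<alpha> \<beta> = oth \<psi> \<alpha> \<beta>" by (simp add: oth_def)
    show "kempe (oth \<psi> \<alpha> \<beta>) \<gamma> y \<psi> {y, x} =
         map_option (Transposition.transpose (oth \<psi> \<alpha> \<beta>) \<gamma>) (\<psi> {y, x})"
      using kempe_at[OF B(5)[OF t] insertI1] by simp
    show "kempe (oth \<psi> \<alpha> \<beta>) \<gamma> y (kempe (oth \<psi> \<alpha> \<beta>) \<gamma> y \<psi>) = \<psi>"
      by (rule kempe_involution[OF B(5)[OF t]])
  qed
  define f where "f = (\<lambda>((\<psi>, \<alpha>, \<beta>), \<gamma>). (kempe (oth \<psi> \<alpha> \<beta>) \<gamma> y \<psi>, \<alpha>, \<beta>))"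
  \<comment> \<open>The choice of \<gamma> is not lost: after the swap it is the color of
    \<open>{y, x}\<close>, from which \<open>g\<close> reads it off before undoing the swap.\<close>
  define g where "g = (\<lambda>(\<psi>, \<alpha>, \<beta>). ((kempe (oth \<psi> \<alpha> \<beta>) (the (\<psi> {y, x})) y \<psi>, \<alpha>, \<beta>), the (\<psi> {y, x})))"
  have S: "\<gamma> \<in> S (\<psi>, \<alpha>, \<beta>) \<longleftrightarrow> \<gamma> \<in> {1..\<kappa>} \<and> \<psi> {z, y} \<noteq> Some \<gamma>" if "(\<psi>, \<alpha>, \<beta>) \<in> B" for \<psi> \<alpha> \<beta> \<gamma>
    using B(1)[OF that] by (auto simp: S_def)
  have f: "f ((\<psi>, \<alpha>, \<beta>), \<gamma>) \<in> B \<and> g (f ((\<psi>, \<alpha>, \<beta>), \<gamma>)) = ((\<psi>, \<alpha>, \<beta>), \<gamma>)"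
    if t: "(\<psi>, \<alpha>, \<beta>) \<in> A" "\<gamma> \<in> S (\<psi>, \<alpha>, \<beta>)" for \<psi> \<alpha> \<beta> \<gamma>
  proof -
    have tB: "(\<psi>, \<alpha>, \<beta>) \<in> B" using t(1) AB by blast
    have gm: "\<gamma> \<in> {1..\<kappa>}" "\<psi> {z, y} \<noteq> Some \<gamma>" using S[OF tB] t(2) by auto
    have "\<psi> {y, x} = Some (oth \<psi> \<alpha> \<beta>)" using B(3)[OF tB] t(1) by blast
    then have "kempe (oth \<psi> \<alpha> \<beta>) \<gamma> y \<psi> {y, x} = Some \<gamma>" using swap(4)[OF tB gm] by simp
    then show ?thesis using swap(1,3,5)[OF tB gm] by (simp add: f_def g_def)
  qed
  have g: "g (\<psi>, \<alpha>, \<beta>) \<in> Sigma A S \<and> f (g (\<psi>, \<alpha>, \<beta>)) = (\<psi>, \<alpha>, \<beta>)"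
    if tB: "(\<psi>, \<alpha>, \<beta>) \<in> B" for \<psi> \<alpha> \<beta>
  proof -
    obtain \<gamma> where gm: "\<gamma> \<in> {1..\<kappa>}" "\<psi> {z, y} \<noteq> Some \<gamma>" and yxc: "\<psi> {y, x} = Some \<gamma>"
      using B(4)[OF tB] by blast
    note sw = swap[OF tB gm]
    have "kempe (oth \<psi> \<alpha> \<beta>) \<gamma> y \<psi> {y, x} = Some (oth \<psi> \<alpha> \<beta>)" using sw(4) yxc by simp
    then have "(kempe (oth \<psi> \<alpha> \<beta>) \<gamma> y \<psi>, \<alpha>, \<beta>) \<in> A" using B(3)[OF sw(1)] sw(3) by simp
    moreover have "\<gamma> \<in> S (kempe (oth \<psi> \<alpha> \<beta>) \<gamma> y \<psi>, \<alpha>, \<beta>)" using S[OF sw(1)] gm sw(2) by simp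
    ultimately show ?thesis using sw(3,5) yxc by (simp add: f_def g_def)
  qed
  have "bij_betw f (Sigma A S) B"
  proof (rule bij_betw_byWitness[where f' = g])
    show "\<forall>s\<in>Sigma A S. g (f s) = s" "f ` Sigma A S \<subseteq> B" using f by auto
    show "\<forall>t\<in>B. f (g t) = t" using g by auto
    show "g ` B \<subseteq> Sigma A S" by (rule image_subsetI) (metis g prod_cases3)
  qed
  then have "card (Sigma A S) = card B" by (rule bij_betw_same_card)
  moreover have "finite A"
    using finite_swap_post[OF finite_edges] unfolding A_def by (rule rev_finite_subset) auto
  moreover have "card (S t) = \<kappa> - 1" if "t \<in> A" for t
  proof -
    obtain \<psi> \<alpha> \<beta> where [simp]: "t = (\<psi>, \<alpha>, \<beta>)" by (cases t)
    have "(\<psi>, \<alpha>, \<beta>) \<in> B" using that AB by auto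
    then obtain \<epsilon> where "\<epsilon> \<in> {1..\<kappa>}" "\<psi> {z, y} = Some \<epsilon>" using B(1) by metis
    then show ?thesis by (simp add: S_def)
  qed
  ultimately have "card A * (\<kappa> - 1) = card B" by (simp add: card_SigmaI S_def split_def)
  then show ?thesis by (simp add: count_def A_def B_def)
qed

text \<open>The expected number of vertices other than \<open>r\<close> on the chain.\<close>

definition weight :: "nat \<Rightarrow> real" where
  "weight \<kappa> = (\<Sum>d<n. real (card (lev (Suc d))) / (real \<kappa> * (real \<kappa> - 1) ^ d))"

lemma count_lev:
  assumes "p \<notin> T" "2 \<le> \<kappa>" "x \<in> lev (Suc d)"
  shows "real (count \<kappa> p x) =
    real (card (swap_post \<kappa> (edges F) p r)) / (real \<kappa> * (real \<kappa> - 1) ^ d)"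
  using assms(3)
proof (induction d arbitrary: x)
  case 0
  then have "count \<kappa> p x * \<kappa> = card (swap_post \<kappa> (edges F) p r)" using count_child by simp
  then have "real (count \<kappa> p x) * real \<kappa> = real (card (swap_post \<kappa> (edges F) p r))"
    by (metis of_nat_mult)
  then show ?case using assms(2) by (simp add: field_simps)
next
  case (Suc d)
  then obtain y where y: "y \<in> lev (Suc d)" "x \<in> children F y" by auto
  then obtain z where z: "z \<in> lev d" "y \<in> children F z" by auto
  have "count \<kappa> p x * (\<kappa> - 1) = count \<kappa> p y"
    using count_step[OF _ z(2) y(2) assms(1)] z(1) lev_T by blast
  then have "real (count \<kappa> p x) * real (\<kappa> - 1) = real (count \<kappa> p y)"
    by (metis of_nat_mult)
  then have "real (count \<kappa> p x) * (real \<kappa> - 1) = real (count \<kappa> p y)"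
    using assms(2) by (simp add: of_nat_diff)
  then have "real (count \<kappa> p x) = real (count \<kappa> p y) / (real \<kappa> - 1)"
    using assms(2) by (simp add: field_simps)
  then show ?case using Suc.IH[OF y(1)] by (simp add: mult_ac)
qed

text \<open>Linearity of expectation as double counting: changed edges are counted by their lower
  ends, and the sums over triples and vertices are exchanged.\<close>

lemma sum_changed:
  assumes "p \<notin> T" "2 \<le> \<kappa>"
  shows "(\<Sum>(\<psi>, \<alpha>, \<beta>)\<in>swap_post \<kappa> (edges F) p r. real (card (changed \<alpha> \<beta> r \<psi>))) =
    real (card (swap_post \<kappa> (edges F) p r)) * weight \<kappa>"
proof -
  let ?Y = "swap_post \<kappa> (edges F) p r"
  let ?I = "\<lambda>(\<psi>, \<alpha>, \<beta>) x. if x \<in> kempe_comp \<alpha> \<beta> r \<psi> then 1 else 0 :: real"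
  have finY: "finite ?Y" by (rule finite_swap_post[OF finite_edges])
  have "(\<Sum>(\<psi>, \<alpha>, \<beta>)\<in>?Y. real (card (changed \<alpha> \<beta> r \<psi>))) = (\<Sum>t\<in>?Y. \<Sum>x\<in>T - {r}. ?I t x)"
  proof (rule sum.cong[OF refl])
    fix t assume t: "t \<in> ?Y"
    obtain \<psi> \<alpha> \<beta> where [simp]: "t = (\<psi>, \<alpha>, \<beta>)" by (cases t)
    have "\<psi> \<in> colorings \<kappa> (edges F)" using t by (simp add: swap_post_def)
    then have "kempe_comp \<alpha> \<beta> r \<psi> - {r} = (T - {r}) \<inter> {x. x \<in> kempe_comp \<alpha> \<beta> r \<psi>}"
      using kempe_comp_subset by blast
    then show "(case t of (\<psi>, \<alpha>, \<beta>) \<Rightarrow> real (card (changed \<alpha> \<beta> r \<psi>))) = (\<Sum>x\<in>T - {r}. ?I t x)"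
      using t finite_T by (simp add: card_changed_post sum.If_cases)
  qed
  also have "\<dots> = (\<Sum>x\<in>T - {r}. \<Sum>t\<in>?Y. ?I t x)" by (rule sum.swap)
  also have "\<dots> = (\<Sum>x\<in>T - {r}. real (count \<kappa> p x))"
  proof (rule sum.cong[OF refl])
    fix x
    have "(\<Sum>t\<in>?Y. ?I t x) = (\<Sum>t\<in>?Y. if case t of (\<psi>, \<alpha>, \<beta>) \<Rightarrow> x \<in> kempe_comp \<alpha> \<beta> r \<psi> then 1 else 0)"
      by (rule sum.cong) auto
    also have "\<dots> = real (count \<kappa> p x)"
      using finY by (simp add: sum.If_cases count_def Collect_conj_eq[symmetric] Int_def split_def)
    finally show "(\<Sum>t\<in>?Y. ?I t x) = real (count \<kappa> p x)" .
  qed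
  also have "\<dots> = (\<Sum>d<n. \<Sum>x\<in>lev (Suc d). real (count \<kappa> p x))"
    unfolding T_minus_root by (rule sum.UNION_disjoint)
      (use finite_lev lev_unique in blast)+
  also have "\<dots> = (\<Sum>d<n. \<Sum>x\<in>lev (Suc d). real (card ?Y) / (real \<kappa> * (real \<kappa> - 1) ^ d))"
    using count_lev[OF assms] by (intro sum.cong) auto
  also have "\<dots> = real (card ?Y) * weight \<kappa>"
    by (simp add: weight_def sum_distrib_left mult.commute)
  finally show ?thesis .
qed

end

subsection \<open>Laws of the recolorings\<close>

lemma bind_pmf_of_set_Sigma:
  assumes "finite A" "A \<noteq> {}" "\<And>x. x \<in> A \<Longrightarrow> finite (B x)" "\<And>x. x \<in> A \<Longrightarrow> card (B x) = k" "0 < k"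
  shows "bind_pmf (pmf_of_set A) (\<lambda>x. map_pmf (Pair x) (pmf_of_set (B x))) = pmf_of_set (Sigma A B)"
proof -
  have ne: "B x \<noteq> {}" if "x \<in> A" for x using assms(4)[OF that] assms(5) by auto
  have "Sigma A B = (\<Union>x\<in>A. Pair x ` B x)" by auto
  also have "pmf_of_set \<dots> = bind_pmf (pmf_of_set A) (\<lambda>x. pmf_of_set (Pair x ` B x))"
    by (rule pmf_of_set_UN[where n = k])
      (use assms ne in \<open>auto simp: card_image inj_on_def disjoint_family_on_def\<close>)
  also have "\<dots> = bind_pmf (pmf_of_set A) (\<lambda>x. map_pmf (Pair x) (pmf_of_set (B x)))"
    by (rule bind_pmf_cong[OF refl], rule map_pmf_of_set_inj[symmetric])
      (use assms ne in \<open>auto simp: inj_on_def\<close>)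
  finally show ?thesis by simp
qed

text \<open>Equal fibres are essential: otherwise the projection would weight each \<open>x\<close>
  by the size of \<open>B x\<close>.\<close>

lemma map_fst_pmf_of_set_Sigma:
  assumes "finite A" "A \<noteq> {}" "\<And>x. x \<in> A \<Longrightarrow> finite (B x)" "\<And>x. x \<in> A \<Longrightarrow> card (B x) = k" "0 < k"
  shows "map_pmf fst (pmf_of_set (Sigma A B)) = pmf_of_set A"
  using bind_pmf_of_set_Sigma[OF assms, symmetric]
  by (simp add: map_bind_pmf pmf.map_comp o_def bind_return_pmf')

text \<open>Made for deletions, whose coin is the event that a uniform color of the palette
  \<open>S\<close> falls into the set \<open>A\<close> of colors free at \<open>r\<close>.\<close>

lemma pmf_of_set_split:
  assumes "finite S" "A \<subseteq> S" "A \<noteq> {}"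
  shows "map_pmf f (pmf_of_set S) =
    bind_pmf (bernoulli_pmf (real (card A) / real (card S)))
      (\<lambda>b. if b then map_pmf f (pmf_of_set A) else map_pmf f (pmf_of_set (S - A)))"
proof -
  have fin: "finite A" using assms finite_subset by blast
  have c: "0 < card A" "card A \<le> card S" 
    using assms fin by (auto simp: card_gt_0_iff card_mono)
  have S: "S \<noteq> {}" using assms by auto
  have *: "pmf_of_set S =
    bind_pmf (bernoulli_pmf (real (card A) / real (card S)))
      (\<lambda>b. if b then pmf_of_set A else pmf_of_set (S - A))"
  proof (cases "S = A")
    case True
    \<comment> \<open>Here \<open>S - A\<close> is empty and the uniform distribution on it
      unspecified, so the coin must be seen never to select that branch.\<close>
    have "bernoulli_pmf 1 = return_pmf True"
      by (rule pmf_eqI) (case_tac i, auto)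
    then show ?thesis using True c by (simp add: bind_return_pmf)
  next
    case False
    then have D: "S - A \<noteq> {}" "finite (S - A)" using assms by auto
    have cD: "card (S - A) = card S - card A" using card_Diff_subset[OF fin assms(2)] .
    then have "real (card (S - A)) = real (card S) - real (card A)" "0 < card (S - A)"
      using c D by (auto simp: of_nat_diff card_gt_0_iff)
    then show ?thesis using assms fin S D c 
      by (intro pmf_eqI) (auto simp: pmf_bind field_simps indicator_def)
  qed
  show ?thesis by (subst *) (auto simp: map_bind_pmf intro!: bind_pmf_cong)
qed

lemma bij_betw_empty_iff: "bij_betw f A B \<Longrightarrow> A = {} \<longleftrightarrow> B = {}"
  by (auto simp: bij_betw_def)

lemma deg_insert:
  assumes "finite E" "{p, r} \<notin> E"
  shows "deg (insert {p, r} E) x = deg E x + (if x = p \<or> x = r then 1 else 0)"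
proof -
  have "{e \<in> insert {p, r} E. x \<in> e} =
      (if x = p \<or> x = r then insert {p, r} {e \<in> E. x \<in> e} else {e \<in> E. x \<in> e})"
    by auto
  then show ?thesis using assms by (simp add: deg_def)
qed

section \<open>The two procedures as random Kempe swaps\<close>

context rooted_tree_on
begin

lemma edge_to_child: "{r, x} \<in> edges F \<Longrightarrow> x \<in> children F r"
  using edge_children root_not_child by blast

lemma edge_at_root:
  assumes "e \<in> edges F" "r \<in> e"
  obtains x where "x \<in> children F r" "e = {r, x}"
  using edge_ends_at[OF assms] edge_to_child assms(1) by metis

lemma card_children_root: "card (children F r) = deg (edges F) r"
proof -
  have "inj_on (\<lambda>x. {r, x}) (children F r)" by (auto simp: inj_on_def doubleton_eq_iff)
  moreover have "(\<lambda>x. {r, x}) ` children F r = {e \<in> edges F. r \<in> e}"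
  proof
    show "(\<lambda>x. {r, x}) ` children F r \<subseteq> {e \<in> edges F. r \<in> e}" using children_edge by blast
    show "{e \<in> edges F. r \<in> e} \<subseteq> (\<lambda>x. {r, x}) ` children F r"
    proof
      fix e assume "e \<in> {e \<in> edges F. r \<in> e}"
      then have "e \<in> edges F" "r \<in> e" by blast+
      then show "e \<in> (\<lambda>x. {r, x}) ` children F r" by (rule edge_at_root) blast
    qed
  qed
  ultimately show ?thesis unfolding deg_def by (metis card_image)
qed

lemma finite_children_root: "finite (children F r)"
  by (rule finite_subset[OF _ finite_T]) (use children_T[OF tree_refl] in blast)

text \<open>Parents are derived from the position of the root, which the new edge moves out of the
  tree of \<open>r\<close>, so their persistence needs an argument. It descends by levels: once the
  parent of \<open>x\<close> is known in the linked forest, uniqueness of parents forces every other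
  edge at \<open>x\<close> downwards.\<close>

lemma children_link:
  assumes p: "p < n" "p \<notin> T" and x: "x \<in> T"
  shows "children (link p r F) x = children F x"
proof -
  have np: "r \<notin> tree (edges F) p" using p tree_sym by blast
  interpret L: rooted_forest_on n "link p r F" using link_forest[OF p(1) root np] .
  let ?F' = "link p r F"
  have E': "edges ?F' = insert {p, r} (edges F)" by (simp add: link_def)
  have nE: "{p, r} \<notin> edges F" using np tree_edge by blast
  have pr: "is_parent ?F' p r"
  proof -
    obtain q where q: "q \<in> roots F" "q \<in> tree (edges F) p" using ex1_root[OF p(1)] by blast
    then have "q \<noteq> r" using np by blast
    moreover have "edges ?F' - {{p, r}} = edges F" using nE E' by auto
    ultimately show ?thesis using q by (auto simp: is_parent_def link_def)
  qed
  have sub: "y \<in> children ?F' x" if "x \<in> lev d" "y \<in> children F x" for d x y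
    using that
  proof (induction d arbitrary: x y)
    case 0
    then have ry: "{r, y} \<in> edges F" using children_edge by auto
    have "\<not> is_parent ?F' y r" 
    proof
      assume "is_parent ?F' y r"
      then have "y = p" using L.parent_unique pr by blast
      then show False using ry nE by (simp add: insert_commute)
    qed
    then show ?case using L.parent_total[of r y] ry 0 by (auto simp: E' children_def)
  next
    case (Suc d)
    then obtain z where z: "z \<in> lev d" "x \<in> children F z" by auto
    then have zx: "is_parent ?F' z x" using Suc.IH by (simp add: children_def)
    have "{x, y} \<in> edges ?F'" using children_edge[OF Suc.prems(2)] E' by blast
    moreover have "\<not> is_parent ?F' y x"
      using L.parent_unique[OF zx] z(2) Suc.prems(2) children_asym by blast
    ultimately show ?case using L.parent_total by (auto simp: children_def)
  qed
  show ?thesis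
  proof
    show "children F x \<subseteq> children ?F' x" using sub T_lev[OF x] by blast
    show "children ?F' x \<subseteq> children F x"
    proof
      fix y assume y: "y \<in> children ?F' x"
      then have par: "is_parent ?F' x y" by (simp add: children_def)
      have "{x, y} \<noteq> {p, r}"
      proof
        assume "{x, y} = {p, r}"
        then have "x = p \<or> x = r \<and> y = p" by (metis doubleton_eq_iff)
        then show False using x p(2) par L.parent_asym[OF pr] by blast
      qed
      then have xy: "{x, y} \<in> edges F" using L.parent_edge[OF par] unfolding E' by (metis insertE)
      have "x \<notin> children F y"
      proof
        assume c: "x \<in> children F y"
        have "y \<in> T" using x xy tree_edge tree_trans by blast
        then have "is_parent ?F' y x" using sub T_lev c by (fastforce simp: children_def)
        then show False using L.parent_asym par by blast
      qed
      then show "y \<in> children F x" using edge_children[OF xy] by blast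
    qed
  qed
qed

lemma card_avail_pos:
  assumes "\<phi> \<in> colorings \<kappa> (edges F)" "deg (edges F) x < \<kappa>"
  shows "avail \<kappa> \<phi> x \<noteq> {}"
  using card_avail[OF assms(1) finite_edges, of x] assms(2) by auto

text \<open>Drawing \<alpha> even when the procedure does not ask for it leaves the law unchanged:
  if \<beta> causes no conflict, both colors are free at \<open>r\<close> and the swap is the
  identity.\<close>

lemma insert_recolor_kempe:
  assumes p: "p < n" "p \<notin> T" and col: "\<phi> \<in> colorings \<kappa> (edges F)"
    and d: "deg (edges F) p < \<kappa>" "deg (edges F) r < \<kappa>"
  shows "insert_recolor \<kappa> (link p r F) p r \<phi> =
    bind_pmf (pmf_of_set (avail \<kappa> \<phi> p)) (\<lambda>\<beta>.
      map_pmf (\<lambda>\<alpha>. (kempe \<alpha> \<beta> r \<phi>)({p, r} \<mapsto> \<beta>)) (pmf_of_set (avail \<kappa> \<phi> r)))"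
  unfolding insert_recolor_def Let_def
proof (rule bind_pmf_cong[OF refl])
  fix \<beta> assume "\<beta> \<in> set_pmf (pmf_of_set (avail \<kappa> \<phi> p))"
  then have bp: "\<beta> \<in> avail \<kappa> \<phi> p" using card_avail_pos[OF col d(1)] by simp
  let ?\<phi>' = "\<phi>({p, r} \<mapsto> \<beta>)"
  let ?ch = "children (link p r F) r"
  have ch: "?ch = children F r" using children_link[OF p, of r] by simp
  have nE: "{p, r} \<notin> edges F" using p(2) tree_edge tree_sym by blast
  have ne: "{r, w} \<noteq> {p, r}" if "w \<in> children F r" for w
    using children_edge[OF that] nE by metis
  have cond: "(\<exists>w\<in>?ch. ?\<phi>' {r, w} = Some \<beta>) \<longleftrightarrow> (\<exists>w\<in>children F r. \<phi> {r, w} = Some \<beta>)"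
    unfolding ch using ne by simp
  have ne': "avail \<kappa> \<phi> r \<noteq> {}" using card_avail_pos[OF col d(2)] .
  show "(if \<exists>w\<in>?ch. ?\<phi>' {r, w} = Some \<beta>
      then bind_pmf (pmf_of_set (avail \<kappa> ?\<phi>' r)) (\<lambda>\<alpha>. return_pmf
        (fix_forbidden (link p r F) (THE w. w \<in> ?ch \<and> ?\<phi>' {r, w} = Some \<beta>) \<beta> \<alpha>
          (?\<phi>'({r, THE w. w \<in> ?ch \<and> ?\<phi>' {r, w} = Some \<beta>} \<mapsto> \<alpha>))))
      else return_pmf ?\<phi>') =
    map_pmf (\<lambda>\<alpha>. (kempe \<alpha> \<beta> r \<phi>)({p, r} \<mapsto> \<beta>)) (pmf_of_set (avail \<kappa> \<phi> r))"
  proof (cases "\<exists>w\<in>children F r. \<phi> {r, w} = Some \<beta>")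
    case True
    then obtain w where w: "w \<in> children F r" "\<phi> {r, w} = Some \<beta>" by blast
    have "x = w" if "x \<in> ?ch \<and> ?\<phi>' {r, x} = Some \<beta>" for x
    proof -
      have "\<phi> {r, x} = Some \<beta>" using that ne[of x] ch by auto
      then show ?thesis by (rule coloring_proper'[OF col _ w(2)])
    qed
    moreover have "w \<in> ?ch \<and> ?\<phi>' {r, w} = Some \<beta>" using w ne ch by simp
    ultimately have the: "(THE w. w \<in> ?ch \<and> ?\<phi>' {r, w} = Some \<beta>) = w"
      by (intro the_equality)
    \<comment> \<open>The color \<beta> is already in use on \<open>{r, w}\<close>, so giving it to
      \<open>{p, r}\<close> takes no further color away from \<open>r\<close>.\<close>
    have av: "avail \<kappa> ?\<phi>' r = avail \<kappa> \<phi> r"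
    proof (rule set_eqI)
      fix c
      have "r \<in> {r, w}" by simp
      then have "\<beta> \<notin> avail \<kappa> \<phi> r" using w(2) by (auto simp: mem_avail)
      moreover have "\<beta> \<notin> avail \<kappa> ?\<phi>' r" by (auto simp: mem_avail)
      moreover have "\<phi> {p, r} = None" using nE coloring_dom[OF col] by blast
      moreover have "\<phi> {p, r} = None \<Longrightarrow> c \<noteq> \<beta> \<Longrightarrow> ?\<phi>' e = Some c \<longleftrightarrow> \<phi> e = Some c" for e
        by (cases "e = {p, r}") auto
      ultimately show "c \<in> avail \<kappa> ?\<phi>' r \<longleftrightarrow> c \<in> avail \<kappa> \<phi> r"
        unfolding mem_avail by metis
    qed
    show ?thesis unfolding cond the av map_pmf_def using True
    proof (simp, intro bind_pmf_cong[OF refl])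
      fix \<alpha> assume "\<alpha> \<in> set_pmf (pmf_of_set (avail \<kappa> \<phi> r))"
      then have "\<alpha> \<in> avail \<kappa> \<phi> r" using ne' by simp
      then show "return_pmf (fix_forbidden (link p r F) w \<beta> \<alpha> (?\<phi>'({r, w} \<mapsto> \<alpha>))) =
          return_pmf ((kempe \<alpha> \<beta> r \<phi>)({p, r} \<mapsto> \<beta>))"
        using fix_forbidden_start[OF col children_link[OF p] nE _ w, of \<alpha> "Some \<beta>"] by simp
    qed
  next
    case False
    have br: "\<beta> \<in> avail \<kappa> \<phi> r"
    proof -
      have "\<phi> e \<noteq> Some \<beta>" if re: "r \<in> e" for e
      proof
        assume e: "\<phi> e = Some \<beta>"
        obtain x where "x \<in> children F r" "e = {r, x}"
          using edge_at_root[OF coloring_SomeD(1)[OF col e] re] .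
        then show False using False e by blast
      qed
      then show ?thesis using bp by (auto simp: mem_avail)
    qed
    have "map_pmf (\<lambda>\<alpha>. (kempe \<alpha> \<beta> r \<phi>)({p, r} \<mapsto> \<beta>)) (pmf_of_set (avail \<kappa> \<phi> r)) =
      map_pmf (\<lambda>\<alpha>. ?\<phi>') (pmf_of_set (avail \<kappa> \<phi> r))"
      by (rule map_pmf_cong[OF refl]) (use ne' kempe_avail[OF col _ br] in auto)
    then show ?thesis unfolding cond using False by simp
  qed
qed

text \<open>A uniform \<beta> from the palette is free at \<open>r\<close> with the probability of
  the coin, and then the swap does nothing; otherwise it is the color of a uniformly random child
  edge, as child edges have distinct colors.\<close>

lemma delete_recolor_kempe:
  assumes col: "\<phi> \<in> colorings \<kappa> (edges F)" and nE: "{p, r} \<notin> edges F"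
    and a: "\<alpha> \<in> avail \<kappa> \<phi> r"
  shows "delete_recolor \<kappa> F p r (\<phi>({p, r} \<mapsto> \<alpha>)) =
    map_pmf (\<lambda>\<beta>. kempe \<alpha> \<beta> r \<phi>) (pmf_of_set {1..\<kappa>})"
proof -
  let ?A = "avail \<kappa> \<phi> r" and ?c = "\<lambda>w. the (\<phi> {r, w})" and ?K = "\<lambda>\<beta>. kempe \<alpha> \<beta> r \<phi>"
  have "\<phi> {p, r} = None" using nE coloring_dom[OF col] by blast
  then have phi: "(\<phi>({p, r} \<mapsto> \<alpha>))({p, r} := None) = \<phi>" by (auto simp: fun_eq_iff)
  have \<kappa>: "0 < \<kappa>" using a by (auto simp: mem_avail)
  have AS: "?A \<subseteq> {1..\<kappa>}" by (auto simp: avail_def)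
  have img: "{1..\<kappa>} - ?A = ?c ` children F r"
  proof (intro set_eqI iffI)
    fix \<gamma> assume "\<gamma> \<in> {1..\<kappa>} - ?A"
    then obtain e where e: "r \<in> e" "\<phi> e = Some \<gamma>" by (auto simp: avail_def)
    obtain x where "x \<in> children F r" "e = {r, x}"
      using edge_at_root[OF coloring_SomeD(1)[OF col e(2)] e(1)] .
    then show "\<gamma> \<in> ?c ` children F r" using e(2) by force
  next
    fix \<gamma> assume "\<gamma> \<in> ?c ` children F r"
    then obtain x where x: "x \<in> children F r" "\<gamma> = ?c x" by blast
    obtain g where "\<phi> {r, x} = Some g" "g \<in> {1..\<kappa>}"
      using coloring_edge[OF col children_edge[OF x(1)]] .
    then show "\<gamma> \<in> {1..\<kappa>} - ?A" using x(2) by (auto simp: mem_avail)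
  qed
  have some: "\<phi> {r, w} = Some (?c w)" if "w \<in> children F r" for w
    using coloring_edge[OF col children_edge[OF that]] by force
  have inj: "inj_on ?c (children F r)"
    by (rule inj_onI) (metis col coloring_proper' some)
  have cA: "card ?A = \<kappa> - card (children F r)"
    using card_avail[OF col finite_edges] card_children_root by simp
  have "card (children F r) = card ({1..\<kappa>} - ?A)" using img inj card_image by metis
  also have "\<dots> \<le> card {1..\<kappa>}" by (rule card_mono) auto
  finally have le: "card (children F r) \<le> \<kappa>" by simp
  have ratio: "(real \<kappa> - real (card (children F r))) / real \<kappa> = real (card ?A) / real (card {1..\<kappa>})"
    using cA le by (simp add: of_nat_diff)
  have fin: "finite (children F r)" by (rule finite_children_root)
  have "delete_recolor \<kappa> F p r (\<phi>({p, r} \<mapsto> \<alpha>)) =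
    bind_pmf (bernoulli_pmf (real (card ?A) / real (card {1..\<kappa>}))) (\<lambda>stop.
      if stop then return_pmf \<phi> else map_pmf (\<lambda>w. fix_forbidden F w (?c w) \<alpha> (\<phi>({r, w} \<mapsto> \<alpha>)))
        (pmf_of_set (children F r)))"
    unfolding delete_recolor_def Let_def phi ratio map_pmf_def by (simp cong: if_cong)
  also have "\<dots> = bind_pmf (bernoulli_pmf (real (card ?A) / real (card {1..\<kappa>}))) (\<lambda>stop.
      if stop then map_pmf ?K (pmf_of_set ?A) else map_pmf ?K (pmf_of_set ({1..\<kappa>} - ?A)))"
  proof (rule bind_pmf_cong[OF refl])
    fix stop assume stop: "stop \<in> set_pmf (bernoulli_pmf (real (card ?A) / real (card {1..\<kappa>})))"
    show "(if stop then return_pmf \<phi> else map_pmf (\<lambda>w. fix_forbidden F w (?c w) \<alpha> (\<phi>({r, w} \<mapsto> \<alpha>)))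
        (pmf_of_set (children F r))) =
      (if stop then map_pmf ?K (pmf_of_set ?A) else map_pmf ?K (pmf_of_set ({1..\<kappa>} - ?A)))"
    proof (cases stop)
      case True
      have "map_pmf ?K (pmf_of_set ?A) = map_pmf (\<lambda>_. \<phi>) (pmf_of_set ?A)"
      proof (rule map_pmf_cong[OF refl])
        fix \<beta> assume "\<beta> \<in> set_pmf (pmf_of_set ?A)"
        moreover have "?A \<noteq> {}" using a by blast
        ultimately show "?K \<beta> = \<phi>" using kempe_avail[OF col a] by simp
      qed
      then show ?thesis using True by simp
    next
      case False
      \<comment> \<open>Without children all \<kappa> colors would be free and the coin would stop
        with certainty, so the draw of a child is made from a nonempty set.\<close>
      have ne: "children F r \<noteq> {}"
      proof
        assume "children F r = {}"
        then have "real (card ?A) / real (card {1..\<kappa>}) = 1" using cA \<kappa> by simp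
        then have "pmf (bernoulli_pmf (real (card ?A) / real (card {1..\<kappa>}))) False = 0" by simp
        then show False using stop False by (simp add: set_pmf_iff)
      qed
      have "pmf_of_set ({1..\<kappa>} - ?A) = map_pmf ?c (pmf_of_set (children F r))"
        unfolding img using map_pmf_of_set_inj[OF inj ne fin] by simp
      then have "map_pmf ?K (pmf_of_set ({1..\<kappa>} - ?A)) =
          map_pmf (\<lambda>w. ?K (?c w)) (pmf_of_set (children F r))"
        by (simp add: pmf.map_comp o_def)
      also have "\<dots> = map_pmf (\<lambda>w. fix_forbidden F w (?c w) \<alpha> (\<phi>({r, w} \<mapsto> \<alpha>)))
          (pmf_of_set (children F r))"
      proof (rule map_pmf_cong[OF refl])
        fix w assume "w \<in> set_pmf (pmf_of_set (children F r))"
        then have w: "w \<in> children F r" using ne fin by simp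
        have "\<phi>({p, r} := None) = \<phi>" "(?K (?c w))({p, r} := None) = ?K (?c w)"
          using \<open>\<phi> {p, r} = None\<close> by (auto simp: fun_eq_iff kempe_def flip_def)
        then show "?K (?c w) = fix_forbidden F w (?c w) \<alpha> (\<phi>({r, w} \<mapsto> \<alpha>))"
          using fix_forbidden_start[OF col refl nE a w some[OF w], of None] by simp
      qed
      finally show ?thesis using False by simp
    qed
  qed
  also have "\<dots> = map_pmf ?K (pmf_of_set {1..\<kappa>})"
    by (rule pmf_of_set_split[symmetric]) (use AS a in auto)
  finally show ?thesis .
qed

lemma post_bij:
  assumes nE: "{p, r} \<notin> edges F" and pr: "p \<noteq> r"
  shows "bij_betw (\<lambda>(\<psi>, \<alpha>, \<beta>). (\<psi>({p, r} \<mapsto> \<beta>), \<alpha>))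
    (swap_post \<kappa> (edges F) p r) (colorings \<kappa> (insert {p, r} (edges F)) \<times> {1..\<kappa>})"
proof (rule bij_betw_byWitness[where f' = "\<lambda>(\<phi>, \<alpha>). (\<phi>({p, r} := None), \<alpha>, the (\<phi> {p, r}))"])
  let ?E = "edges F" and ?E' = "insert {p, r} (edges F)"
  have none: "\<psi> {p, r} = None" if "\<psi> \<in> colorings \<kappa> ?E" for \<psi>
    using nE coloring_dom[OF that] by blast
  have up: "\<psi>({p, r} \<mapsto> \<beta>) \<in> colorings \<kappa> ?E'"
    if "\<psi> \<in> colorings \<kappa> ?E" "\<beta> \<in> avail \<kappa> \<psi> r" "\<beta> \<in> avail \<kappa> \<psi> p" for \<psi> \<beta>
  proof -
    have b: "\<psi> e \<noteq> Some \<beta>" if "e \<inter> {p, r} \<noteq> {}" for e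
      using that \<open>\<beta> \<in> avail \<kappa> \<psi> r\<close> \<open>\<beta> \<in> avail \<kappa> \<psi> p\<close> by (auto simp: mem_avail)
    have "dom (\<psi>({p, r} \<mapsto> \<beta>)) = ?E'" using that(1) by (simp add: colorings_def)
    moreover have "ran (\<psi>({p, r} \<mapsto> \<beta>)) \<subseteq> {1..\<kappa>}"
      using that none by (auto simp: colorings_def mem_avail)
    moreover have "(\<psi>({p, r} \<mapsto> \<beta>)) e \<noteq> (\<psi>({p, r} \<mapsto> \<beta>)) e'"
      if e: "e \<in> ?E'" "e' \<in> ?E'" "e \<noteq> e'" "e \<inter> e' \<noteq> {}" for e e'
    proof -
      consider "e = {p, r}" "e' \<noteq> {p, r}" | "e' = {p, r}" "e \<noteq> {p, r}" | "e \<noteq> {p, r}" "e' \<noteq> {p, r}"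
        using e(3) by metis
      then show ?thesis
      proof cases
        case 1
        then show ?thesis using b[of e'] e(4) by (simp add: Int_commute)
      next
        case 2
        then show ?thesis using b[of e] e(4) by simp
      next
        case 3
        then show ?thesis using e \<open>\<psi> \<in> colorings \<kappa> ?E\<close> by (simp add: colorings_def)
      qed
    qed
    ultimately show ?thesis unfolding colorings_def by blast
  qed
  have down: "\<phi>({p, r} := None) \<in> colorings \<kappa> ?E \<and> the (\<phi> {p, r}) \<in> avail \<kappa> (\<phi>({p, r} := None)) x"
    if c: "\<phi> \<in> colorings \<kappa> ?E'" and x: "x \<in> {p, r}" for \<phi> x
  proof
    have dom: "dom (\<phi>({p, r} := None)) = ?E" using c nE by (auto simp: colorings_def)
    moreover have "ran (\<phi>({p, r} := None)) \<subseteq> {1..\<kappa>}"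
      using c by (auto simp: colorings_def ran_def)
    moreover have "(\<phi>({p, r} := None)) e \<noteq> (\<phi>({p, r} := None)) e'"
      if "e \<in> ?E" "e' \<in> ?E" "e \<noteq> e'" "e \<inter> e' \<noteq> {}" for e e'
    proof -
      have "e \<noteq> {p, r}" "e' \<noteq> {p, r}" using that nE by metis+
      then show ?thesis using that c by (simp add: colorings_def)
    qed
    ultimately show "\<phi>({p, r} := None) \<in> colorings \<kappa> ?E" by (simp add: colorings_def)
    obtain \<gamma> where g: "\<phi> {p, r} = Some \<gamma>" "\<gamma> \<in> {1..\<kappa>}" using coloring_edge[OF c insertI1] .
    have "(\<phi>({p, r} := None)) e \<noteq> Some \<gamma>" if "x \<in> e" for e
    proof
      assume e: "(\<phi>({p, r} := None)) e = Some \<gamma>"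
      then have ne: "e \<noteq> {p, r}" by auto
      then have "\<phi> e = Some \<gamma>" using e by simp
      then show False using coloring_proper[OF c _ g(1) that x] ne by blast
    qed
    then show "the (\<phi> {p, r}) \<in> avail \<kappa> (\<phi>({p, r} := None)) x" using g by (simp add: mem_avail)
  qed
  show "(\<lambda>(\<psi>, \<alpha>, \<beta>). (\<psi>({p, r} \<mapsto> \<beta>), \<alpha>)) ` swap_post \<kappa> ?E p r \<subseteq> colorings \<kappa> ?E' \<times> {1..\<kappa>}"
    using up by (auto simp: swap_post_def)
  show "(\<lambda>(\<phi>, \<alpha>). (\<phi>({p, r} := None), \<alpha>, the (\<phi> {p, r}))) ` (colorings \<kappa> ?E' \<times> {1..\<kappa>})
      \<subseteq> swap_post \<kappa> ?E p r"
    using down by (auto simp: swap_post_def)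
  show "\<forall>t\<in>swap_post \<kappa> ?E p r. (\<lambda>(\<phi>, \<alpha>). (\<phi>({p, r} := None), \<alpha>, the (\<phi> {p, r})))
      ((\<lambda>(\<psi>, \<alpha>, \<beta>). (\<psi>({p, r} \<mapsto> \<beta>), \<alpha>)) t) = t"
    by (auto simp: swap_post_def intro!: fun_upd_idem none)
  show "\<forall>t\<in>colorings \<kappa> ?E' \<times> {1..\<kappa>}. (\<lambda>(\<psi>, \<alpha>, \<beta>). (\<psi>({p, r} \<mapsto> \<beta>), \<alpha>))
      ((\<lambda>(\<phi>, \<alpha>). (\<phi>({p, r} := None), \<alpha>, the (\<phi> {p, r}))) t) = t"
  proof clarsimp
    fix \<phi> assume c: "\<phi> \<in> colorings \<kappa> ?E'"
    obtain \<gamma> where "\<phi> {p, r} = Some \<gamma>" using coloring_edge[OF c insertI1] by blast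
    then show "\<phi>({p, r} \<mapsto> the (\<phi> {p, r})) = \<phi>" by (simp add: fun_upd_idem)
  qed
qed

section \<open>Uniformity and expected recourse for one update\<close>

lemma expectation_changed:
  assumes "p \<notin> T" "2 \<le> \<kappa>" "swap_post \<kappa> (edges F) p r \<noteq> {}"
  shows "measure_pmf.expectation (pmf_of_set (swap_post \<kappa> (edges F) p r))
    (\<lambda>(\<psi>, \<alpha>, \<beta>). real (card (changed \<alpha> \<beta> r \<psi>))) = weight \<kappa>"
proof -
  have fin: "finite (swap_post \<kappa> (edges F) p r)" by (rule finite_swap_post[OF finite_edges])
  then have "real (card (swap_post \<kappa> (edges F) p r)) \<noteq> 0" using assms(3) by simp
  then show ?thesis
    using sum_changed[OF assms(1,2)] integral_pmf_of_set[OF assms(3) fin]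
    by (simp add: split_def)
qed

lemma insert_step:
  assumes p: "p < n" "p \<notin> T" and d: "deg (edges F) p < \<kappa>" "deg (edges F) r < \<kappa>"
    and k: "2 \<le> \<kappa>" and ne: "colorings \<kappa> (edges F) \<noteq> {}"
  shows "bind_pmf (pmf_of_set (colorings \<kappa> (edges F))) (insert_recolor \<kappa> (link p r F) p r) =
      pmf_of_set (colorings \<kappa> (insert {p, r} (edges F)))"
    and "colorings \<kappa> (insert {p, r} (edges F)) \<noteq> {}"
    and "measure_pmf.expectation (bind_pmf (pmf_of_set (colorings \<kappa> (edges F)))
      (\<lambda>\<phi>. map_pmf (recourse \<phi>) (insert_recolor \<kappa> (link p r F) p r \<phi>))) real = weight \<kappa>"
proof -
  let ?E = "edges F"
  let ?C = "colorings \<kappa> ?E" and ?C' = "colorings \<kappa> (insert {p, r} ?E)"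
  let ?X = "swap_pre \<kappa> ?E p r" and ?Y = "swap_post \<kappa> ?E p r"
  have nE: "{p, r} \<notin> ?E" using p(2) tree_edge tree_sym by blast
  have pr: "p \<noteq> r" using p(2) by auto
  have finC: "finite ?C" by (rule finite_colorings[OF finite_edges])
  have finY: "finite ?Y" by (rule finite_swap_post[OF finite_edges])
  have finX: "finite ?X" using finC by (auto simp: swap_pre_def)
  have X: "?X \<noteq> {}"
  proof -
    obtain \<phi> where c: "\<phi> \<in> ?C" using ne by blast
    obtain \<alpha> \<beta> where "\<alpha> \<in> avail \<kappa> \<phi> r" "\<beta> \<in> avail \<kappa> \<phi> p"
      using card_avail_pos[OF c] d by blast
    then have "(\<phi>, \<alpha>, \<beta>) \<in> ?X" using c by (simp add: swap_pre_def)
    then show ?thesis by blast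
  qed
  have Y: "?Y \<noteq> {}" using bij_betw_empty_iff[OF swap_bij[OF p(2)]] X by simp
  have YX: "map_pmf (\<lambda>(\<phi>, \<alpha>, \<beta>). (kempe \<alpha> \<beta> r \<phi>, \<alpha>, \<beta>)) (pmf_of_set ?X) = pmf_of_set ?Y"
    by (rule map_pmf_of_set_bij_betw[OF swap_bij[OF p(2)] X finX])
  have Sig: "bind_pmf (pmf_of_set ?C) (\<lambda>\<phi>. map_pmf (Pair \<phi>)
      (pmf_of_set (avail \<kappa> \<phi> r \<times> avail \<kappa> \<phi> p))) = pmf_of_set ?X"
    unfolding swap_pre_def
    by (rule bind_pmf_of_set_Sigma[where k = "(\<kappa> - deg ?E r) * (\<kappa> - deg ?E p)"])
      (use finC ne d card_avail finite_edges in \<open>auto simp: card_cartesian_product\<close>)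
  \<comment> \<open>Keeping the old coloring next to the new one serves both claims: the new
    coloring is a marginal, and the recourse is a function of the pair. In terms of
    \<open>swap_post\<close>, \<psi> is the coloring after the swap, and swapping once more recovers
    the old one.\<close>
  have law: "bind_pmf (pmf_of_set ?C) (\<lambda>\<phi>. map_pmf (Pair \<phi>) (insert_recolor \<kappa> (link p r F) p r \<phi>)) =
    map_pmf (\<lambda>(\<psi>, \<alpha>, \<beta>). (kempe \<alpha> \<beta> r \<psi>, \<psi>({p, r} \<mapsto> \<beta>))) (pmf_of_set ?Y)"
  proof -
    have "bind_pmf (pmf_of_set ?C) (\<lambda>\<phi>. map_pmf (Pair \<phi>) (insert_recolor \<kappa> (link p r F) p r \<phi>)) =
      bind_pmf (pmf_of_set ?C) (\<lambda>\<phi>. map_pmf (\<lambda>(\<alpha>, \<beta>). (\<phi>, (kempe \<alpha> \<beta> r \<phi>)({p, r} \<mapsto> \<beta>)))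
        (pmf_of_set (avail \<kappa> \<phi> r \<times> avail \<kappa> \<phi> p)))"
    proof (rule bind_pmf_cong[OF refl])
      fix \<phi> assume "\<phi> \<in> set_pmf (pmf_of_set ?C)"
      then have c: "\<phi> \<in> ?C" using ne finC by simp
      have pair: "pmf_of_set (avail \<kappa> \<phi> r \<times> avail \<kappa> \<phi> p) =
          bind_pmf (pmf_of_set (avail \<kappa> \<phi> r)) (\<lambda>\<alpha>.
            bind_pmf (pmf_of_set (avail \<kappa> \<phi> p)) (\<lambda>\<beta>. return_pmf (\<alpha>, \<beta>)))"
        unfolding map_pmf_def[symmetric]
        by (rule bind_pmf_of_set_Sigma[symmetric, where k = "\<kappa> - deg ?E p"])
          (use card_avail_pos[OF c] card_avail[OF c finite_edges] d in auto)
      show "map_pmf (Pair \<phi>) (insert_recolor \<kappa> (link p r F) p r \<phi>) =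
        map_pmf (\<lambda>(\<alpha>, \<beta>). (\<phi>, (kempe \<alpha> \<beta> r \<phi>)({p, r} \<mapsto> \<beta>)))
          (pmf_of_set (avail \<kappa> \<phi> r \<times> avail \<kappa> \<phi> p))"
        unfolding insert_recolor_kempe[OF p c d] pair
        \<comment> \<open>\<open>swap_pre\<close> lists \<alpha> first, whereas the procedure draws
          \<beta> first; the draws are independent given the coloring.\<close>
        by (subst bind_commute_pmf)
          (simp add: map_pmf_def bind_assoc_pmf bind_return_pmf)
    qed
    also have "\<dots> = map_pmf (\<lambda>(\<phi>, \<alpha>, \<beta>). (\<phi>, (kempe \<alpha> \<beta> r \<phi>)({p, r} \<mapsto> \<beta>))) (pmf_of_set ?X)"
      unfolding Sig[symmetric] by (simp add: map_bind_pmf pmf.map_comp o_def split_def)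
    also have "\<dots> = map_pmf (\<lambda>(\<psi>, \<alpha>, \<beta>). (kempe \<alpha> \<beta> r \<psi>, \<psi>({p, r} \<mapsto> \<beta>))) (pmf_of_set ?Y)"
      unfolding YX[symmetric] pmf.map_comp
      by (rule map_pmf_cong[OF refl])
        (use X finX in \<open>auto simp: swap_pre_def kempe_involution\<close>)
    finally show ?thesis .
  qed
  have P: "map_pmf (\<lambda>(\<psi>, \<alpha>, \<beta>). (\<psi>({p, r} \<mapsto> \<beta>), \<alpha>)) (pmf_of_set ?Y) = pmf_of_set (?C' \<times> {1..\<kappa>})"
    by (rule map_pmf_of_set_bij_betw[OF post_bij[OF nE pr] Y finY])
  have "?C' \<times> {1..\<kappa>} \<noteq> {}" using bij_betw_empty_iff[OF post_bij[OF nE pr]] Y by simp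
  then show C': "?C' \<noteq> {}" by blast
  have finC': "finite ?C'" using finite_colorings finite_edges by blast
  have "bind_pmf (pmf_of_set ?C) (insert_recolor \<kappa> (link p r F) p r) =
    map_pmf snd (bind_pmf (pmf_of_set ?C)
      (\<lambda>\<phi>. map_pmf (Pair \<phi>) (insert_recolor \<kappa> (link p r F) p r \<phi>)))"
    by (simp add: map_bind_pmf pmf.map_comp o_def)
  \<comment> \<open>Every coloring of the larger forest occurs with all \<kappa> values of \<alpha>,
    so forgetting \<alpha> keeps it uniform.\<close>
  also have "\<dots> = map_pmf fst (pmf_of_set (?C' \<times> {1..\<kappa>}))"
    unfolding law P[symmetric] by (simp add: pmf.map_comp o_def split_def)
  also have "\<dots> = pmf_of_set ?C'"
    by (rule map_fst_pmf_of_set_Sigma[where k = \<kappa>]) (use finC' C' k in auto)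
  finally show "bind_pmf (pmf_of_set ?C) (insert_recolor \<kappa> (link p r F) p r) = pmf_of_set ?C'" .
  have "bind_pmf (pmf_of_set ?C) (\<lambda>\<phi>. map_pmf (recourse \<phi>) (insert_recolor \<kappa> (link p r F) p r \<phi>)) =
    map_pmf (\<lambda>(\<phi>, \<psi>). recourse \<phi> \<psi>) (bind_pmf (pmf_of_set ?C)
      (\<lambda>\<phi>. map_pmf (Pair \<phi>) (insert_recolor \<kappa> (link p r F) p r \<phi>)))"
    by (simp add: map_bind_pmf pmf.map_comp o_def)
  also have "\<dots> = map_pmf (\<lambda>(\<psi>, \<alpha>, \<beta>). card (changed \<alpha> \<beta> r \<psi>)) (pmf_of_set ?Y)"
    unfolding law pmf.map_comp
  proof (rule map_pmf_cong[OF refl])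
    fix t assume "t \<in> set_pmf (pmf_of_set ?Y)"
    then have t: "t \<in> ?Y" using Y finY by simp
    obtain \<psi> \<alpha> \<beta> where [simp]: "t = (\<psi>, \<alpha>, \<beta>)" by (cases t)
    have psi: "\<psi> \<in> ?C" and ab: "\<alpha> \<in> {1..\<kappa>}" "\<beta> \<in> {1..\<kappa>}"
      using t by (auto simp: swap_post_def mem_avail)
    have "dom (kempe \<alpha> \<beta> r \<psi>) = ?E" using coloring_dom[OF kempe_coloring[OF psi ab]] .
    moreover have "dom \<psi> = ?E" using coloring_dom[OF psi] .
    ultimately have "{e \<in> dom (kempe \<alpha> \<beta> r \<psi>) \<inter> dom (\<psi>({p, r} \<mapsto> \<beta>)).
        kempe \<alpha> \<beta> r \<psi> e \<noteq> (\<psi>({p, r} \<mapsto> \<beta>)) e} = changed \<alpha> \<beta> r \<psi>"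
      using nE by (auto simp: changed_def)
    then show "((\<lambda>(\<phi>, \<psi>). recourse \<phi> \<psi>) \<circ> (\<lambda>(\<psi>, \<alpha>, \<beta>). (kempe \<alpha> \<beta> r \<psi>, \<psi>({p, r} \<mapsto> \<beta>)))) t =
        (\<lambda>(\<psi>, \<alpha>, \<beta>). card (changed \<alpha> \<beta> r \<psi>)) t"
      by (simp add: recourse_def)
  qed
  finally show "measure_pmf.expectation (bind_pmf (pmf_of_set ?C)
      (\<lambda>\<phi>. map_pmf (recourse \<phi>) (insert_recolor \<kappa> (link p r F) p r \<phi>))) real = weight \<kappa>"
    using expectation_changed[OF p(2) k Y] by (simp add: split_def)
qed

text \<open>The insertion read backwards, with \<open>swap_post\<close> as the source. The color of
  the deleted edge is \<beta> and the uniform palette color is \<alpha>, the reverse of their names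
  in the procedure.\<close>

lemma delete_step:
  assumes p: "p \<notin> T" and d: "deg (edges F) p < \<kappa>" "deg (edges F) r < \<kappa>"
    and k: "2 \<le> \<kappa>" and ne: "colorings \<kappa> (insert {p, r} (edges F)) \<noteq> {}"
  shows "bind_pmf (pmf_of_set (colorings \<kappa> (insert {p, r} (edges F)))) (delete_recolor \<kappa> F p r) =
      pmf_of_set (colorings \<kappa> (edges F))"
    and "colorings \<kappa> (edges F) \<noteq> {}"
    and "measure_pmf.expectation (bind_pmf (pmf_of_set (colorings \<kappa> (insert {p, r} (edges F))))
      (\<lambda>\<phi>. map_pmf (recourse \<phi>) (delete_recolor \<kappa> F p r \<phi>))) real = weight \<kappa>"
proof -
  let ?E = "edges F"
  let ?C = "colorings \<kappa> ?E" and ?C' = "colorings \<kappa> (insert {p, r} ?E)"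
  let ?X = "swap_pre \<kappa> ?E p r" and ?Y = "swap_post \<kappa> ?E p r"
  have nE: "{p, r} \<notin> ?E" using p tree_edge tree_sym by blast
  have pr: "p \<noteq> r" using p by auto
  have finC: "finite ?C" by (rule finite_colorings[OF finite_edges])
  have finC': "finite ?C'" using finite_colorings finite_edges by blast
  have finY: "finite ?Y" by (rule finite_swap_post[OF finite_edges])
  have finX: "finite ?X" using finC by (auto simp: swap_pre_def)
  have k1: "{1..\<kappa>} \<noteq> {}" using k by simp
  have "?C' \<times> {1..\<kappa>} \<noteq> {}" using ne k1 by blast
  then have Y: "?Y \<noteq> {}" using bij_betw_empty_iff[OF post_bij[OF nE pr]] by simp
  then have X: "?X \<noteq> {}"
    using bij_betw_empty_iff[OF swap_bij[OF p]] by simp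
  then show C: "?C \<noteq> {}" by (auto simp: swap_pre_def)
  have YX: "map_pmf (\<lambda>(\<phi>, \<alpha>, \<beta>). (kempe \<alpha> \<beta> r \<phi>, \<alpha>, \<beta>)) (pmf_of_set ?X) = pmf_of_set ?Y"
    by (rule map_pmf_of_set_bij_betw[OF swap_bij[OF p] X finX])
  have P: "map_pmf (\<lambda>(\<psi>, \<alpha>, \<beta>). (\<psi>({p, r} \<mapsto> \<beta>), \<alpha>)) (pmf_of_set ?Y) = pmf_of_set (?C' \<times> {1..\<kappa>})"
    by (rule map_pmf_of_set_bij_betw[OF post_bij[OF nE pr] Y finY])
  have law: "bind_pmf (pmf_of_set ?C') (\<lambda>\<phi>. map_pmf (Pair \<phi>) (delete_recolor \<kappa> F p r \<phi>)) =
    map_pmf (\<lambda>(\<psi>, \<alpha>, \<beta>). (\<psi>({p, r} \<mapsto> \<beta>), kempe \<alpha> \<beta> r \<psi>)) (pmf_of_set ?Y)"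
  proof -
    have "bind_pmf (pmf_of_set ?C') (\<lambda>\<phi>. map_pmf (Pair \<phi>) (delete_recolor \<kappa> F p r \<phi>)) =
      bind_pmf (pmf_of_set ?C') (\<lambda>\<phi>. map_pmf
        (\<lambda>\<alpha>. (\<phi>, kempe \<alpha> (the (\<phi> {p, r})) r (\<phi>({p, r} := None)))) (pmf_of_set {1..\<kappa>}))"
    proof (rule bind_pmf_cong[OF refl])
      fix \<phi> assume "\<phi> \<in> set_pmf (pmf_of_set ?C')"
      then have "(\<phi>, 1) \<in> ?C' \<times> {1..\<kappa>}" using ne finC' k by simp
      then obtain t where t: "t \<in> ?Y" "(\<phi>, 1) = (\<lambda>(\<psi>, \<alpha>, \<beta>). (\<psi>({p, r} \<mapsto> \<beta>), \<alpha>)) t"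
        using post_bij[OF nE pr, of \<kappa>] unfolding bij_betw_def by blast
      obtain \<psi> \<alpha> \<beta> where [simp]: "t = (\<psi>, \<alpha>, \<beta>)" by (cases t)
      have psi: "\<psi> \<in> ?C" and b: "\<beta> \<in> avail \<kappa> \<psi> r" and phi: "\<phi> = \<psi>({p, r} \<mapsto> \<beta>)"
        using t by (auto simp: swap_post_def)
      have "\<psi> {p, r} = None" using nE coloring_dom[OF psi] by blast
      then have "\<phi>({p, r} := None) = \<psi>" by (auto simp: phi fun_eq_iff)
      moreover have "the (\<phi> {p, r}) = \<beta>" by (simp add: phi)
      ultimately show "map_pmf (Pair \<phi>) (delete_recolor \<kappa> F p r \<phi>) =
        map_pmf (\<lambda>\<alpha>. (\<phi>, kempe \<alpha> (the (\<phi> {p, r})) r (\<phi>({p, r} := None)))) (pmf_of_set {1..\<kappa>})"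
        using delete_recolor_kempe[OF psi nE b]
        by (simp add: phi[symmetric] pmf.map_comp o_def kempe_commute[of _ \<beta>])
    qed
    also have "\<dots> = map_pmf (\<lambda>(\<phi>, \<alpha>). (\<phi>, kempe \<alpha> (the (\<phi> {p, r})) r (\<phi>({p, r} := None))))
        (bind_pmf (pmf_of_set ?C') (\<lambda>\<phi>. map_pmf (Pair \<phi>) (pmf_of_set {1..\<kappa>})))"
      by (simp add: map_bind_pmf pmf.map_comp o_def)
    also have "bind_pmf (pmf_of_set ?C') (\<lambda>\<phi>. map_pmf (Pair \<phi>) (pmf_of_set {1..\<kappa>})) =
        pmf_of_set (?C' \<times> {1..\<kappa>})"
      by (rule bind_pmf_of_set_Sigma[where k = \<kappa>]) (use finC' ne k in auto)
    also have "map_pmf (\<lambda>(\<phi>, \<alpha>). (\<phi>, kempe \<alpha> (the (\<phi> {p, r})) r (\<phi>({p, r} := None)))) \<dots> =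
      map_pmf (\<lambda>(\<psi>, \<alpha>, \<beta>). (\<psi>({p, r} \<mapsto> \<beta>), kempe \<alpha> \<beta> r \<psi>)) (pmf_of_set ?Y)"
      unfolding P[symmetric] pmf.map_comp
    proof (rule map_pmf_cong[OF refl])
      fix t assume "t \<in> set_pmf (pmf_of_set ?Y)"
      then have t: "t \<in> ?Y" using Y finY by simp
      obtain \<psi> \<alpha> \<beta> where [simp]: "t = (\<psi>, \<alpha>, \<beta>)" by (cases t)
      have "\<psi> {p, r} = None" using t nE coloring_dom by (fastforce simp: swap_post_def)
      then have "\<psi>({p, r} := None) = \<psi>" by (auto simp: fun_eq_iff)
      then show "((\<lambda>(\<phi>, \<alpha>). (\<phi>, kempe \<alpha> (the (\<phi> {p, r})) r (\<phi>({p, r} := None)))) \<circ>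
          (\<lambda>(\<psi>, \<alpha>, \<beta>). (\<psi>({p, r} \<mapsto> \<beta>), \<alpha>))) t =
        (\<lambda>(\<psi>, \<alpha>, \<beta>). (\<psi>({p, r} \<mapsto> \<beta>), kempe \<alpha> \<beta> r \<psi>)) t" by simp
    qed
    finally show ?thesis .
  qed
  have "bind_pmf (pmf_of_set ?C') (delete_recolor \<kappa> F p r) =
    map_pmf snd (bind_pmf (pmf_of_set ?C') (\<lambda>\<phi>. map_pmf (Pair \<phi>) (delete_recolor \<kappa> F p r \<phi>)))"
    by (simp add: map_bind_pmf pmf.map_comp o_def)
  also have "\<dots> = map_pmf fst (pmf_of_set ?X)"
    unfolding law YX[symmetric] pmf.map_comp
    by (rule map_pmf_cong[OF refl])
      (use X finX in \<open>auto simp: swap_pre_def kempe_involution\<close>)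
  also have "\<dots> = pmf_of_set ?C" unfolding swap_pre_def
    by (rule map_fst_pmf_of_set_Sigma[where k = "(\<kappa> - deg ?E r) * (\<kappa> - deg ?E p)"])
      (use finC C d card_avail finite_edges in \<open>auto simp: card_cartesian_product\<close>)
  finally show "bind_pmf (pmf_of_set ?C') (delete_recolor \<kappa> F p r) = pmf_of_set ?C" .
  have "bind_pmf (pmf_of_set ?C') (\<lambda>\<phi>. map_pmf (recourse \<phi>) (delete_recolor \<kappa> F p r \<phi>)) =
    map_pmf (\<lambda>(\<phi>, \<psi>). recourse \<phi> \<psi>)
      (bind_pmf (pmf_of_set ?C') (\<lambda>\<phi>. map_pmf (Pair \<phi>) (delete_recolor \<kappa> F p r \<phi>)))"
    by (simp add: map_bind_pmf pmf.map_comp o_def)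
  also have "\<dots> = map_pmf (\<lambda>(\<psi>, \<alpha>, \<beta>). card (changed \<alpha> \<beta> r \<psi>)) (pmf_of_set ?Y)"
    unfolding law pmf.map_comp
  proof (rule map_pmf_cong[OF refl])
    fix t assume "t \<in> set_pmf (pmf_of_set ?Y)"
    then have t: "t \<in> ?Y" using Y finY by simp
    obtain \<psi> \<alpha> \<beta> where [simp]: "t = (\<psi>, \<alpha>, \<beta>)" by (cases t)
    have psi: "\<psi> \<in> ?C" and ab: "\<alpha> \<in> {1..\<kappa>}" "\<beta> \<in> {1..\<kappa>}"
      using t by (auto simp: swap_post_def mem_avail)
    have "dom (kempe \<alpha> \<beta> r \<psi>) = ?E" using coloring_dom[OF kempe_coloring[OF psi ab]] .
    moreover have "dom \<psi> = ?E" using coloring_dom[OF psi] .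
    ultimately have "{e \<in> dom (\<psi>({p, r} \<mapsto> \<beta>)) \<inter> dom (kempe \<alpha> \<beta> r \<psi>).
        (\<psi>({p, r} \<mapsto> \<beta>)) e \<noteq> kempe \<alpha> \<beta> r \<psi> e} = changed \<alpha> \<beta> r \<psi>"
      using nE by (auto simp: changed_def)
    then show "((\<lambda>(\<phi>, \<psi>). recourse \<phi> \<psi>) \<circ> (\<lambda>(\<psi>, \<alpha>, \<beta>). (\<psi>({p, r} \<mapsto> \<beta>), kempe \<alpha> \<beta> r \<psi>))) t =
        (\<lambda>(\<psi>, \<alpha>, \<beta>). card (changed \<alpha> \<beta> r \<psi>)) t"
      by (simp add: recourse_def)
  qed
  finally show "measure_pmf.expectation (bind_pmf (pmf_of_set ?C')
      (\<lambda>\<phi>. map_pmf (recourse \<phi>) (delete_recolor \<kappa> F p r \<phi>))) real = weight \<kappa>"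
    using expectation_changed[OF p k Y] by (simp add: split_def)
qed

end

subsection \<open>The upper bound\<close>

text \<open>Nonemptiness belongs to the invariant because the uniform distribution on an empty set
  is unspecified; each update hands it on through the bijections.\<close>

definition valid_state :: "nat \<Rightarrow> nat \<Rightarrow> nat \<Rightarrow> rooted_forest \<Rightarrow> bool" where
  "valid_state n \<Delta> \<kappa> F \<longleftrightarrow> rooted_forest_on n F \<and> (\<forall>v. deg (edges F) v \<le> \<Delta>) \<and>
     colorings \<kappa> (edges F) \<noteq> {}"

definition coloring_law :: "nat \<Rightarrow> rooted_forest \<Rightarrow> coloring pmf" where
  "coloring_law \<kappa> F = pmf_of_set (colorings \<kappa> (edges F))"

definition recourse_law ::
    "model \<Rightarrow> tie_rule \<Rightarrow> nat \<Rightarrow> nat \<Rightarrow> rooted_forest \<Rightarrow> update \<Rightarrow> nat pmf" where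
  "recourse_law m tie \<Delta> \<kappa> F u =
     bind_pmf (coloring_law \<kappa> F) (\<lambda>\<phi>. map_pmf (recourse \<phi>) (recolor \<kappa> (orient m tie \<Delta> F u) \<phi>))"

text \<open>Which end becomes the child is left open, so that the consequences hold for every naming
  rule. Legality is symmetric in the two ends except for the root condition of the rooted
  model.\<close>

lemma orient_insert:
  assumes F: "rooted_forest_on n F" and legal: "legal m \<Delta> n F (Insert u v)"
  obtains G p r where "orient m tie \<Delta> F (Insert u v) = (G, Insert p r)" "edges G = edges F"
    "(p, r) = (u, v) \<or> (p, r) = (v, u)" "rooted_tree_on n G r" "p < n" "p \<notin> tree (edges G) r"
    "deg (edges G) p < \<Delta>" "deg (edges G) r < \<Delta>"
proof -
  interpret rooted_forest_on n F by (rule F)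
  have vu: "v \<notin> tree (edges F) u" "u \<notin> tree (edges F) v" using legal tree_sym by auto
  have uv: "u < n" "v < n" "deg (edges F) u < \<Delta>" "deg (edges F) v < \<Delta>" using legal by auto
  show ?thesis
  proof (cases m)
    case Rooted
    then have "rooted_tree_on n F v"
      using legal F by (simp add: rooted_tree_on_def rooted_tree_on_axioms_def)
    then show ?thesis using that[of F u v] Rooted vu uv by simp
  next
    case General
    obtain p r where pr: "name_endpoints tie \<Delta> F u v = (p, r)" by fastforce
    then have or: "(p, r) = (u, v) \<or> (p, r) = (v, u)"
      by (auto simp: name_endpoints_def Let_def split: if_splits)
    then have "r < n" using uv by auto
    then have "rooted_tree_on n (reroot r F) r"
      using reroot_forest by (simp add: rooted_tree_on_def rooted_tree_on_axioms_def reroot_def)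
    moreover have "edges (reroot r F) = edges F" by (simp add: reroot_def)
    moreover have "orient m tie \<Delta> F (Insert u v) = (reroot r F, Insert p r)"
      using General pr by simp
    ultimately show ?thesis using that[of "reroot r F" p r] or vu uv by auto
  qed
qed

lemma orient_delete:
  assumes F: "rooted_forest_on n F" and legal: "legal m \<Delta> n F (Delete u v)"
  obtains p r where "orient m tie \<Delta> F (Delete u v) = (F, Delete p r)"
    "{p, r} = {u, v}" "is_parent F p r"
proof -
  have eq: "orient m tie \<Delta> F (Delete u v) =
      (F, if is_parent F u v then Delete u v else Delete v u)" by (cases m) simp_all
  show ?thesis
  proof (cases "is_parent F u v")
    case True
    then have "orient m tie \<Delta> F (Delete u v) = (F, Delete u v)" unfolding eq by simp
    then show ?thesis using True by (rule that[OF _ refl])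
  next
    case False
    have "{u, v} \<in> edges F" using legal by simp
    then have "is_parent F v u" using rooted_forest_on.parent_total[OF F] False by blast
    moreover have "orient m tie \<Delta> F (Delete u v) = (F, Delete v u)" unfolding eq using False by simp
    ultimately show ?thesis using that[of v u] by (metis insert_commute)
  qed
qed

lemma insert_update:
  assumes F: "valid_state n \<Delta> \<kappa> F" and legal: "legal m \<Delta> n F (Insert u v)"
    and k: "\<Delta> \<le> \<kappa>" "2 \<le> \<kappa>"
  obtains G r where "rooted_tree_on n G r" "edges G = edges F" "r = u \<or> r = v" "deg (edges G) r < \<Delta>"
    "valid_state n \<Delta> \<kappa> (forest_step m tie \<Delta> F (Insert u v))"
    "edges (forest_step m tie \<Delta> F (Insert u v)) = insert {u, v} (edges F)"
    "bind_pmf (coloring_law \<kappa> F) (recolor \<kappa> (orient m tie \<Delta> F (Insert u v))) =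
      coloring_law \<kappa> (forest_step m tie \<Delta> F (Insert u v))"
    "measure_pmf.expectation (recourse_law m tie \<Delta> \<kappa> F (Insert u v)) real =
      rooted_tree_on.weight n G r \<kappa>"
proof -
  have FF: "rooted_forest_on n F" and degF: "\<And>v. deg (edges F) v \<le> \<Delta>"
    and ne: "colorings \<kappa> (edges F) \<noteq> {}" using F by (auto simp: valid_state_def)
  obtain G p r where or: "orient m tie \<Delta> F (Insert u v) = (G, Insert p r)" "edges G = edges F"
    "(p, r) = (u, v) \<or> (p, r) = (v, u)" "rooted_tree_on n G r" "p < n" "p \<notin> tree (edges G) r"
    "deg (edges G) p < \<Delta>" "deg (edges G) r < \<Delta>"
    using orient_insert[OF FF legal] .
  interpret G: rooted_tree_on n G r by (rule or(4))
  have d: "deg (edges G) p < \<kappa>" "deg (edges G) r < \<kappa>" using or k by auto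
  have neG: "colorings \<kappa> (edges G) \<noteq> {}" using ne or(2) by simp
  note step = G.insert_step[OF or(5,6) d k(2) neG]
  have uv: "{p, r} = {u, v}" using or(3) by auto
  have fs: "forest_step m tie \<Delta> F (Insert u v) = link p r G"
    unfolding forest_step_def or(1) by simp
  have rc: "recolor \<kappa> (G, Insert p r) = insert_recolor \<kappa> (link p r G) p r" by (rule ext) simp
  have E': "edges (link p r G) = insert {p, r} (edges F)" by (simp add: link_def or(2))
  have "r \<notin> tree (edges G) p" using or(6) tree_sym by blast
  then have link: "rooted_forest_on n (link p r G)" using G.link_forest[OF or(5) G.root] by blast
  have nE: "{p, r} \<notin> edges G" using or(6) tree_edge tree_sym by blast
  have "deg (insert {p, r} (edges G)) x \<le> \<Delta>" for x
    using deg_insert[OF G.finite_edges nE, of x] degF[of x] or(2,7,8) by auto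
  then have "valid_state n \<Delta> \<kappa> (link p r G)"
    using step(2) link by (simp add: valid_state_def E' or(2))
  moreover have "bind_pmf (coloring_law \<kappa> F) (recolor \<kappa> (orient m tie \<Delta> F (Insert u v))) =
      coloring_law \<kappa> (link p r G)"
    unfolding or(1) rc coloring_law_def using step(1) by (simp add: E' or(2))
  moreover have "measure_pmf.expectation (recourse_law m tie \<Delta> \<kappa> F (Insert u v)) real =
      rooted_tree_on.weight n G r \<kappa>"
    unfolding recourse_law_def or(1) rc coloring_law_def using step(3) by (simp add: or(2))
  moreover have "r = u \<or> r = v" using or(3) by auto
  ultimately show ?thesis using that[OF or(4) or(2)] or(8) E' uv by (simp add: fs)
qed

lemma delete_update:
  assumes F: "valid_state n \<Delta> \<kappa> F" and legal: "legal m \<Delta> n F (Delete u v)"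
    and k: "\<Delta> \<le> \<kappa>" "2 \<le> \<kappa>"
  obtains G r where "rooted_tree_on n G r" "\<And>x. deg (edges G) x \<le> \<Delta>" "deg (edges G) r < \<Delta>"
    "valid_state n \<Delta> \<kappa> (forest_step m tie \<Delta> F (Delete u v))"
    "edges (forest_step m tie \<Delta> F (Delete u v)) = edges F - {{u, v}}"
    "bind_pmf (coloring_law \<kappa> F) (recolor \<kappa> (orient m tie \<Delta> F (Delete u v))) =
      coloring_law \<kappa> (forest_step m tie \<Delta> F (Delete u v))"
    "measure_pmf.expectation (recourse_law m tie \<Delta> \<kappa> F (Delete u v)) real =
      rooted_tree_on.weight n G r \<kappa>"
proof -
  have FF: "rooted_forest_on n F" and degF: "\<And>v. deg (edges F) v \<le> \<Delta>"
    and ne: "colorings \<kappa> (edges F) \<noteq> {}" using F by (auto simp: valid_state_def)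
  interpret F: rooted_forest_on n F by (rule FF)
  obtain p r where or: "orient m tie \<Delta> F (Delete u v) = (F, Delete p r)"
    "{p, r} = {u, v}" "is_parent F p r"
    using orient_delete[OF FF legal] .
  let ?G = "cut p r F"
  have E: "edges ?G = edges F - {{p, r}}" by (simp add: cut_def)
  have pr: "{p, r} \<in> edges F" using F.parent_edge[OF or(3)] .
  then have EF: "edges F = insert {p, r} (edges ?G)" using E by auto
  have tree: "rooted_tree_on n ?G r" 
    using F.cut_forest[OF or(3)]
    by (simp add: rooted_tree_on_def rooted_tree_on_axioms_def) (simp add: cut_def)
  interpret G: rooted_tree_on n ?G r by (rule tree)
  have "r \<notin> tree (edges ?G) p" using F.acyclic_edge[OF pr] E by simp
  then have pT: "p \<notin> tree (edges ?G) r" using tree_sym by blast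
  have nE: "{p, r} \<notin> edges ?G" using E by simp
  have deg: "deg (edges F) x = deg (edges ?G) x + (if x = p \<or> x = r then 1 else 0)" for x
    using deg_insert[OF G.finite_edges nE] EF by metis
  have dG: "deg (edges ?G) x \<le> \<Delta>" for x using deg[of x] degF[of x] by simp
  have dr: "deg (edges ?G) r < \<Delta>" "deg (edges ?G) p < \<Delta>"
    using deg[of r] degF[of r] deg[of p] degF[of p] by auto
  have d: "deg (edges ?G) p < \<kappa>" "deg (edges ?G) r < \<kappa>" using dr k by auto
  have neG: "colorings \<kappa> (insert {p, r} (edges ?G)) \<noteq> {}" using ne EF by simp
  note step = G.delete_step[OF pT d k(2) neG]
  have fs: "forest_step m tie \<Delta> F (Delete u v) = ?G"
    unfolding forest_step_def or(1) by simp
  have rc: "recolor \<kappa> (F, Delete p r) = delete_recolor \<kappa> ?G p r" by (rule ext) simp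
  have "valid_state n \<Delta> \<kappa> ?G"
    using step(2) dG G.rooted_forest_on_axioms by (simp add: valid_state_def)
  moreover have "bind_pmf (coloring_law \<kappa> F) (recolor \<kappa> (orient m tie \<Delta> F (Delete u v))) =
      coloring_law \<kappa> ?G"
    unfolding or(1) rc coloring_law_def using step(1) EF by simp
  moreover have "measure_pmf.expectation (recourse_law m tie \<Delta> \<kappa> F (Delete u v)) real =
      rooted_tree_on.weight n ?G r \<kappa>"
    unfolding recourse_law_def or(1) rc coloring_law_def using step(3) EF by simp
  ultimately show ?thesis using that[OF tree dG dr(1)] E or(2) by (simp add: fs)
qed

section \<open>From single updates to sequences\<close>

lemma legal_from_append:
  "legal_from m tie \<Delta> n F (us @ vs) \<longleftrightarrow>
     legal_from m tie \<Delta> n F us \<and> legal_from m tie \<Delta> n (foldl (forest_step m tie \<Delta>) F us) vs"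
  by (induction us arbitrary: F) auto

lemma valid_update:
  assumes "valid_state n \<Delta> \<kappa> F" "legal m \<Delta> n F u" "\<Delta> \<le> \<kappa>" "2 \<le> \<kappa>"
  shows "valid_state n \<Delta> \<kappa> (forest_step m tie \<Delta> F u)"
    and "bind_pmf (coloring_law \<kappa> F) (recolor \<kappa> (orient m tie \<Delta> F u)) =
      coloring_law \<kappa> (forest_step m tie \<Delta> F u)"
  by (cases u; use assms insert_update delete_update in metis)+

lemma update_recourse_weight:
  assumes "valid_state n \<Delta> \<kappa> F" "legal m \<Delta> n F u" "\<Delta> \<le> \<kappa>" "2 \<le> \<kappa>"
  obtains G r where "rooted_tree_on n G r" "\<And>x. deg (edges G) x \<le> \<Delta>" "deg (edges G) r < \<Delta>"
    "measure_pmf.expectation (recourse_law m tie \<Delta> \<kappa> F u) real = rooted_tree_on.weight n G r \<kappa>"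
proof (cases u)
  case (Insert x y)
  have "\<And>x. deg (edges F) x \<le> \<Delta>" using assms(1) by (simp add: valid_state_def)
  then show ?thesis using insert_update[OF assms(1) assms(2)[unfolded Insert] assms(3,4)] that
    unfolding Insert by metis
next
  case (Delete x y)
  show ?thesis using delete_update[OF assms(1) assms(2)[unfolded Delete] assms(3,4)] that
    unfolding Delete by metis
qed

lemma valid_empty: "valid_state n \<Delta> \<kappa> (empty_forest n)"
  using empty_forest_on by (auto simp: valid_state_def empty_forest_def deg_def colorings_def)

text \<open>Obliviousness enters here: the sequence being fixed, the forest after each prefix is
  deterministic, and the uniform law of the coloring passes through the fold update by
  update.\<close>

lemma distmaint_law:
  assumes "legal_sequence m tie \<Delta> n us" "\<Delta> \<le> \<kappa>" "2 \<le> \<kappa>"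
  defines "F \<equiv> foldl (forest_step m tie \<Delta>) (empty_forest n) us"
  shows "valid_state n \<Delta> \<kappa> F"
    and "distmaint m tie \<Delta> \<kappa> n us = map_pmf (Pair F) (coloring_law \<kappa> F)"
proof -
  have main: "valid_state n \<Delta> \<kappa> (foldl (forest_step m tie \<Delta>) G us) \<and>
    foldl (\<lambda>M u. bind_pmf M (distmaint_step m tie \<Delta> \<kappa> u)) (map_pmf (Pair G) (coloring_law \<kappa> G)) us =
      map_pmf (Pair (foldl (forest_step m tie \<Delta>) G us))
        (coloring_law \<kappa> (foldl (forest_step m tie \<Delta>) G us))"
    if "valid_state n \<Delta> \<kappa> G" "legal_from m tie \<Delta> n G us" for G
    using that
  proof (induction us arbitrary: G)
    case (Cons u us)
    let ?G' = "forest_step m tie \<Delta> G u"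
    have l: "legal m \<Delta> n G u" "legal_from m tie \<Delta> n ?G' us" using Cons.prems by auto
    note v = valid_update[OF Cons.prems(1) l(1) assms(2,3), of tie]
    have "bind_pmf (map_pmf (Pair G) (coloring_law \<kappa> G)) (distmaint_step m tie \<Delta> \<kappa> u) =
      map_pmf (Pair ?G') (coloring_law \<kappa> ?G')"
      unfolding v(2)[symmetric] by (simp add: bind_map_pmf map_bind_pmf)
    then show ?case using Cons.IH[OF v(1) l(2)] by simp
  qed simp
  have "map_pmf (Pair (empty_forest n)) (coloring_law \<kappa> (empty_forest n)) =
      return_pmf (empty_forest n, Map.empty)"
  proof -
    have "colorings \<kappa> {} = {Map.empty}" by (auto simp: colorings_def)
    then show ?thesis by (simp add: coloring_law_def empty_forest_def pmf_of_set_singleton)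
  qed
  then show "valid_state n \<Delta> \<kappa> F"
    "distmaint m tie \<Delta> \<kappa> n us = map_pmf (Pair F) (coloring_law \<kappa> F)"
    using main[OF valid_empty] assms(1) unfolding F_def distmaint_def legal_sequence_def by metis+
qed

lemma expected_recourse_law:
  assumes legal: "legal_sequence m tie \<Delta> n us" and t: "t < length us" and k: "\<Delta> \<le> \<kappa>" "2 \<le> \<kappa>"
  defines "F \<equiv> foldl (forest_step m tie \<Delta>) (empty_forest n) (take t us)"
  shows "valid_state n \<Delta> \<kappa> F" "legal m \<Delta> n F (us ! t)"
    "expected_recourse m tie \<Delta> \<kappa> n us t =
      measure_pmf.expectation (recourse_law m tie \<Delta> \<kappa> F (us ! t)) real"
proof -
  have us: "us = take t us @ us ! t # drop (Suc t) us" using t by (rule id_take_nth_drop)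
  have "legal_from m tie \<Delta> n (empty_forest n) (take t us @ us ! t # drop (Suc t) us)"
    using legal us by (simp add: legal_sequence_def)
  then have l: "legal_sequence m tie \<Delta> n (take t us)" "legal m \<Delta> n F (us ! t)"
    by (simp_all add: legal_from_append legal_sequence_def F_def)
  note d = distmaint_law[OF l(1) k, folded F_def]
  show "valid_state n \<Delta> \<kappa> F" by (rule d(1))
  show "legal m \<Delta> n F (us ! t)" by (rule l(2))
  show "expected_recourse m tie \<Delta> \<kappa> n us t =
      measure_pmf.expectation (recourse_law m tie \<Delta> \<kappa> F (us ! t)) real"
    unfolding expected_recourse_def d(2) recourse_law_def
    by (simp add: bind_map_pmf map_pmf_def bind_assoc_pmf bind_return_pmf)
qed

section \<open>Upper estimates of the expected chain length\<close>

context rooted_tree_on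
begin

lemma card_children:
  assumes "y \<in> children F z"
  shows "card (children F y) \<le> deg (edges F) y - 1"
proof -
  let ?I = "{e \<in> edges F. y \<in> e}"
  have fin: "finite ?I" using finite_edges by simp
  have zy: "{z, y} \<in> ?I" using children_edge[OF assms] by simp
  have inj: "inj_on (\<lambda>x. {y, x}) (children F y)" by (auto simp: inj_on_def doubleton_eq_iff)
  have "(\<lambda>x. {y, x}) ` children F y \<subseteq> ?I - {{z, y}}"
  proof (rule image_subsetI)
    fix x assume x: "x \<in> children F y"
    have "x \<noteq> z" using x assms children_asym by blast
    then have "{y, x} \<noteq> {z, y}" by (metis doubleton_eq_iff)
    then show "{y, x} \<in> ?I - {{z, y}}" using children_edge[OF x] by simp
  qed
  then have "card ((\<lambda>x. {y, x}) ` children F y) \<le> card (?I - {{z, y}})"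
    using fin by (intro card_mono) auto
  then show ?thesis using card_image[OF inj] zy fin by (simp add: deg_def)
qed

text \<open>Every vertex below \<open>r\<close> spends one of its at most \<Delta> edges on its
  parent; \<open>r\<close> has no parent, but without the updated edge its degree is below
  \<Delta>.\<close>

lemma card_lev:
  assumes "\<And>x. deg (edges F) x \<le> \<Delta>" "deg (edges F) r < \<Delta>"
  shows "card (lev d) \<le> (\<Delta> - 1) ^ d"
proof (induction d)
  case (Suc d)
  have "card (children F y) \<le> \<Delta> - 1" if yl: "y \<in> lev d" for y
  proof (cases d)
    case 0
    then show ?thesis using yl card_children_root assms(2) by simp
  next
    case (Suc d')
    then obtain z where "y \<in> children F z" using yl by auto
    then show ?thesis using card_children[of y z] assms(1)[of y] by linarith
  qed
  then have "(\<Sum>y\<in>lev d. card (children F y)) \<le> card (lev d) * (\<Delta> - 1)"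
    using sum_bounded_above[of "lev d" "\<lambda>y. card (children F y)" "\<Delta> - 1"] by simp
  then have "card (lev (Suc d)) \<le> card (lev d) * (\<Delta> - 1)"
    using card_UN_le[OF finite_lev[of d], of "children F"] by simp
  also have "\<dots> \<le> (\<Delta> - 1) ^ d * (\<Delta> - 1)" by (rule mult_right_mono) (use Suc in auto)
  finally show ?case by (simp add: mult.commute)
qed simp

end

text \<open>To be read with \<open>K = \<kappa> - 1\<close> and \<open>a d\<close> vertices at depth
  \<open>d + 1\<close>. By \<open>a1\<close> each level contributes at most 1, which is used for
  \<open>d \<le> h\<close>; by \<open>a2\<close> the deeper levels share at most \<open>N\<close>
  vertices, each of weight at most \<open>1 / N\<close>.\<close>

lemma level_sum_log:
  fixes a :: "nat \<Rightarrow> real" and K N :: real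
  assumes K: "2 \<le> K" and N: "2 \<le> N"
    and a0: "\<And>d. 0 \<le> a d" and a1: "\<And>d. a d \<le> K ^ Suc d" and a2: "(\<Sum>d<n. a d) \<le> N"
  shows "(\<Sum>d<n. a d / ((K + 1) * K ^ d)) \<le> 3 * log K N"
proof (cases "K \<le> N")
  case True
  define h where "h = nat \<lfloor>log K N\<rfloor>"
  have "1 \<le> log K N" using True K by (simp add: le_log_iff)
  then have h: "1 \<le> h" "real h \<le> log K N" "log K N < real h + 1"
    by (auto simp: h_def le_nat_floor)
  have "N = K powr log K N" using K N by simp
  also have "\<dots> \<le> K powr (real (Suc h))" using h(3) K by (intro powr_mono) auto
  also have "\<dots> = K ^ Suc h" using K by (intro powr_realpow) auto
  finally have NK: "N \<le> K ^ Suc h" .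
  have "(\<Sum>d<n. a d / ((K + 1) * K ^ d)) \<le>
      (\<Sum>d<n. (if d \<in> {..h} then 1 else 0) + a d / K ^ Suc h)"
  proof (rule sum_mono)
    fix d
    show "a d / ((K + 1) * K ^ d) \<le> (if d \<in> {..h} then 1 else 0) + a d / K ^ Suc h"
    proof (cases "d \<le> h")
      case True
      have "a d \<le> (K + 1) * K ^ d"
        using a1[of d] K by (simp add: distrib_right) (smt (verit) zero_le_power)
      then have "a d / ((K + 1) * K ^ d) \<le> 1" using K by simp
      moreover have "0 \<le> a d / K ^ Suc h" using a0[of d] K by simp
      ultimately show ?thesis using True by simp
    next
      case False
      then have "K ^ Suc h \<le> K ^ d" using K by (intro power_increasing) auto
      also have "\<dots> \<le> (K + 1) * K ^ d" using K by (simp add: distrib_right)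
      finally have "a d / ((K + 1) * K ^ d) \<le> a d / K ^ Suc h"
        using a0[of d] K by (intro divide_left_mono) auto
      then show ?thesis using False by simp
    qed
  qed
  also have "\<dots> = real (card ({..<n} \<inter> {..h})) + (\<Sum>d<n. a d) / K ^ Suc h"
    by (simp add: sum.distrib sum.If_cases sum_divide_distrib Int_def)
  also have "\<dots> \<le> (real h + 1) + 1"
  proof (rule add_mono)
    have "card ({..<n} \<inter> {..h}) \<le> card {..h}" by (rule card_mono) auto
    then show "real (card ({..<n} \<inter> {..h})) \<le> real h + 1" by simp
    show "(\<Sum>d<n. a d) / K ^ Suc h \<le> 1" using a2 NK K by simp
  qed
  \<comment> \<open>\<open>h + 2 \<le> 3 * h\<close>, because \<open>K \<le> N\<close> gives
    \<open>h \<ge> 1\<close>.\<close>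
  also have "\<dots> \<le> 3 * log K N" using h by linarith
  finally show ?thesis .
next
  case False
  \<comment> \<open>The logarithm is below 1 here, and charging \<open>1 / K\<close> to every vertex
    suffices. To compare \<open>N / K\<close> with it, \<open>ln x \<le> x - 1\<close> is used at
    \<open>x = K / N\<close>, and \<open>ln N \<ge> 1 / 2\<close> absorbs the surplus
    \<open>K\<close>.\<close>
  have "(\<Sum>d<n. a d / ((K + 1) * K ^ d)) \<le> (\<Sum>d<n. a d / K)"
  proof (rule sum_mono)
    fix d
    have "K * 1 \<le> (K + 1) * K ^ d" using K by (intro mult_mono) auto
    then show "a d / ((K + 1) * K ^ d) \<le> a d / K"
      using a0[of d] K by (intro divide_left_mono) auto
  qed
  also have "\<dots> = (\<Sum>d<n. a d) / K" by (simp add: sum_divide_distrib)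
  also have "\<dots> \<le> N / K" using a2 K by (intro divide_right_mono) auto
  also have "\<dots> \<le> 3 * log K N"
  proof -
    have lnK: "0 < ln K" using K by simp
    have "ln (1 / 2 :: real) \<le> 1 / 2 - 1" by (rule ln_le_minus_one) simp
    then have "1 / 2 \<le> ln (2::real)" by (simp add: ln_div)
    also have "\<dots> \<le> ln N" using N by simp
    finally have "1 / 2 \<le> ln N" .
    then have KN: "K \<le> 2 * K * ln N" using K mult_left_mono[of "1/2" "ln N" "2 * K"] by simp
    have "ln K = ln N + ln (K / N)" using K N by (simp add: ln_div)
    also have "\<dots> \<le> ln N + (K / N - 1)" using K N by (intro add_left_mono ln_le_minus_one) auto
    finally have "N * ln K \<le> N * (ln N + (K / N - 1))" using N by (intro mult_left_mono) auto
    also have "\<dots> = N * ln N + K - N" using N by (simp add: field_simps)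
    also have "\<dots> \<le> K * ln N + K"
    proof -
      have "N * ln N \<le> K * ln N" by (rule mult_right_mono) (use N False in auto)
      then show ?thesis using N by linarith
    qed
    also have "\<dots> \<le> 3 * (K * ln N)" using KN by simp
    finally show ?thesis using lnK K by (simp add: log_def field_simps)
  qed
  finally show ?thesis .
qed

context rooted_tree_on
begin

lemma weight_le_log:
  assumes "\<And>x. deg (edges F) x \<le> \<Delta>" "deg (edges F) r < \<Delta>" "3 \<le> \<kappa>" "\<Delta> \<le> \<kappa>" "2 \<le> n"
  shows "weight \<kappa> \<le> 3 * log (real \<kappa> - 1) (real n)"
proof -
  have "(\<Sum>d<n. real (card (lev (Suc d))) / ((real \<kappa> - 1 + 1) * (real \<kappa> - 1) ^ d)) \<le>
      3 * log (real \<kappa> - 1) (real n)"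
  proof (rule level_sum_log)
    show "real (card (lev (Suc d))) \<le> (real \<kappa> - 1) ^ Suc d" for d
    proof -
      have "real (card (lev (Suc d))) \<le> real (\<Delta> - 1) ^ Suc d"
        using card_lev[OF assms(1,2), of "Suc d"] by (metis of_nat_le_iff of_nat_power)
      also have "\<dots> \<le> (real \<kappa> - 1) ^ Suc d" using assms(2-4) by (intro power_mono) auto
      finally show ?thesis .
    qed
    have "(\<Sum>d<n. card (lev (Suc d))) \<le> (\<Sum>d<Suc n. card (lev d))"
      by (simp only: sum.lessThan_Suc_shift)
    also have "\<dots> \<le> n" by (rule sum_card_lev)
    finally show "(\<Sum>d<n. real (card (lev (Suc d)))) \<le> real n" by (metis of_nat_le_iff of_nat_sum)
  qed (use assms in auto)
  then show ?thesis by (simp add: weight_def)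
qed

text \<open>Levels grow by a factor of at most \<Delta>-1 while the probability of being reached
  shrinks by \<kappa>-1 per level; the ratio \<open>?q\<close> of the geometric series misses 1 by
  \<open>c / (\<kappa> - 1)\<close>, the origin of \<Delta>/c.\<close>

lemma weight_le_ratio:
  assumes "\<And>x. deg (edges F) x \<le> \<Delta>" "deg (edges F) r < \<Delta>" "3 \<le> \<Delta>" "0 < c" "\<kappa> = \<Delta> + c"
  shows "weight \<kappa> \<le> real \<Delta> / real c"
proof -
  define b where "b = real \<Delta> - 1"
  define K where "K = real \<kappa> - 1"
  have bK: "2 \<le> b" "K = b + c" using assms by (auto simp: b_def K_def)
  have k: "real \<kappa> = K + 1" by (simp add: K_def)
  let ?q = "b / K"
  have q: "?q < 1" "0 \<le> ?q" "1 - ?q = real c / K" using bK assms by (auto simp: field_simps)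
  have "weight \<kappa> \<le> (\<Sum>d<n. b / (K + 1) * ?q ^ d)"
    unfolding weight_def
  proof (rule sum_mono)
    fix d
    have "real (card (lev (Suc d))) \<le> real (\<Delta> - 1) ^ Suc d"
      using card_lev[OF assms(1,2), of "Suc d"] by (metis of_nat_le_iff of_nat_power)
    then have "real (card (lev (Suc d))) \<le> b ^ Suc d" using assms by (simp add: b_def of_nat_diff)
    then have "real (card (lev (Suc d))) / ((K + 1) * K ^ d) \<le> b ^ Suc d / ((K + 1) * K ^ d)"
      using bK by (intro divide_right_mono) auto
    then show "real (card (lev (Suc d))) / (real \<kappa> * (real \<kappa> - 1) ^ d) \<le> b / (K + 1) * ?q ^ d"
      by (simp add: k power_divide)
  qed
  also have "\<dots> = b / (K + 1) * (\<Sum>d<n. ?q ^ d)" by (simp add: sum_distrib_left)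
  also have "\<dots> \<le> b / (K + 1) * (1 / (1 - ?q))"
  proof (rule mult_left_mono)
    have "(\<Sum>d<n. ?q ^ d) = (1 - ?q ^ n) / (1 - ?q)"
      using q(1) by (subst sum_gp_strict) auto
    also have "\<dots> \<le> 1 / (1 - ?q)" using q by (intro divide_right_mono) auto
    finally show "(\<Sum>d<n. ?q ^ d) \<le> 1 / (1 - ?q)" .
  qed (use bK in auto)
  also have "\<dots> = b * K / ((K + 1) * real c)" unfolding q(3) by simp
  also have "\<dots> \<le> b * (K + 1) / ((K + 1) * real c)"
    using bK by (intro divide_right_mono mult_left_mono) auto
  also have "\<dots> = b / real c" using bK by simp
  also have "\<dots> \<le> real \<Delta> / real c" by (intro divide_right_mono) (auto simp: b_def)
  finally show ?thesis .
qed

end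

lemma expected_recourse_upper:
  assumes D: "3 \<le> \<Delta>" and legal: "legal_sequence m tie \<Delta> n us" and t: "t < length us"
  shows "expected_recourse m tie \<Delta> (\<Delta> + c) n us t \<le> 3 * recourse_bound \<Delta> c n"
proof -
  let ?F = "foldl (forest_step m tie \<Delta>) (empty_forest n) (take t us)"
  have k: "\<Delta> \<le> \<Delta> + c" "2 \<le> \<Delta> + c" using D by auto
  note e = expected_recourse_law[OF legal t k]
  obtain G r where G: "rooted_tree_on n G r" "\<And>x. deg (edges G) x \<le> \<Delta>" "deg (edges G) r < \<Delta>"
    "measure_pmf.expectation (recourse_law m tie \<Delta> (\<Delta> + c) ?F (us ! t)) real =
      rooted_tree_on.weight n G r (\<Delta> + c)"
    using update_recourse_weight[where tie = tie, OF e(1,2) k] by blast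
  interpret rooted_tree_on n G r by (rule G(1))
  interpret F: rooted_forest_on n ?F using e(1) by (simp add: valid_state_def)
  \<comment> \<open>A legal update names two distinct vertices, so the logarithmic estimate
    applies.\<close>
  have n2: "2 \<le> n"
  proof -
    have "\<exists>x y. x < n \<and> y < n \<and> x \<noteq> y"
    proof (cases "us ! t")
      case (Insert x y)
      then have "x < n" "y < n" "x \<noteq> y" using e(2) by auto
      then show ?thesis by blast
    next
      case (Delete x y)
      then have xy: "{x, y} \<in> edges ?F" using e(2) by simp
      then show ?thesis using F.edge_less[OF xy] F.edge_neq[OF xy] by blast
    qed
    then show ?thesis by linarith
  qed
  have log: "weight (\<Delta> + c) \<le> 3 * log (real (\<Delta> + c) - 1) (real n)"
    by (rule weight_le_log[OF G(2,3)]) (use D n2 in auto)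
  have ratio: "weight (\<Delta> + c) \<le> 3 * (real \<Delta> / real c)" if "c \<noteq> 0"
  proof -
    have "weight (\<Delta> + c) \<le> real \<Delta> / real c"
      by (rule weight_le_ratio[OF G(2,3) D]) (use that in auto)
    moreover have "0 \<le> real \<Delta> / real c" by simp
    ultimately show ?thesis by linarith
  qed
  show ?thesis unfolding e(3) G(4) recourse_bound_def Let_def
    using log ratio by (auto simp: min_def)
qed

subsection \<open>The lower bound\<close>

locale heap_pair =
  fixes b M :: nat
  assumes b: "2 \<le> b" and M: "2 \<le> M"
begin

text \<open>The array layout of a \<open>b\<close>-ary heap, with the children of \<open>u\<close>
  at \<open>b * u + 1\<close> to \<open>b * u + b\<close>, on the vertices below \<open>M\<close>,
  and its translate by \<open>M\<close>. It yields trees of any size whose levels are full except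
  perhaps the last.\<close>

definition par :: "vertex \<Rightarrow> vertex" where
  "par v = (if v < M then (v - 1) div b else M + (v - M - 1) div b)"

definition nonroots :: "vertex set" where
  "nonroots = {1..<M} \<union> {M + 1..<2 * M}"

definition par_edge :: "vertex \<Rightarrow> edge" where
  "par_edge v = {par v, v}"

lemma par_less:
  assumes "v \<in> nonroots"
  shows "par v < v"
proof (cases "v < M")
  case True
  moreover have "1 \<le> v" using True assms by (auto simp: nonroots_def)
  moreover have "(v - 1) div b \<le> v - 1" by (rule div_le_dividend)
  moreover have "par v = (v - 1) div b" using True by (simp add: par_def)
  ultimately show ?thesis by linarith
next
  case False
  moreover have "M + 1 \<le> v" using False assms by (auto simp: nonroots_def)
  moreover have "(v - M - 1) div b \<le> v - M - 1" by (rule div_le_dividend)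
  moreover have "par v = M + (v - M - 1) div b" using False by (simp add: par_def)
  ultimately show ?thesis by linarith
qed

lemma par_side: "v \<in> nonroots \<Longrightarrow> par v < M \<longleftrightarrow> v < M"
  using par_less[of v] by (auto simp: par_def)

lemma par_cases: "v \<in> nonroots \<Longrightarrow> par v \<in> nonroots \<or> par v = (if v < M then 0 else M)"
  using par_less[of v] by (auto simp: nonroots_def par_def)

lemma card_par_children:
  shows "finite {v \<in> nonroots. par v = u}" "card {v \<in> nonroots. par v = u} \<le> b"
proof -
  let ?x = "if u < M then b * u else M + b * (u - M)"
  have div: "b * k + 1 \<le> i \<and> i \<le> b * k + b" if "(i - 1) div b = k" "1 \<le> i" for i k
  proof -
    have "i - 1 = b * k + (i - 1) mod b" using that(1) by (metis mult_div_mod_eq)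
    moreover have "(i - 1) mod b < b" using b by simp
    ultimately show ?thesis using that(2) by linarith
  qed
  have sub: "{v \<in> nonroots. par v = u} \<subseteq> {?x + 1..?x + b}"
  proof
    fix v assume "v \<in> {v \<in> nonroots. par v = u}"
    then have v: "v \<in> nonroots" "par v = u" by auto
    show "v \<in> {?x + 1..?x + b}"
    proof (cases "v < M")
      case True
      then have "(v - 1) div b = u" "1 \<le> v" using v by (auto simp: par_def nonroots_def)
      moreover have "u < M" using par_side[OF v(1)] v(2) True by simp
      ultimately show ?thesis using div[of v u] by auto
    next
      case False
      then have "(v - M - 1) div b = u - M" "1 \<le> v - M" using v by (auto simp: par_def nonroots_def)
      moreover have "\<not> u < M" using par_side[OF v(1)] v(2) False by simp
      ultimately show ?thesis using div[of "v - M" "u - M"] by auto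
    qed
  qed
  show "finite {v \<in> nonroots. par v = u}" using sub finite_subset by blast
  show "card {v \<in> nonroots. par v = u} \<le> b" using card_mono[OF _ sub] by simp
qed

lemma deg_par_edges:
  assumes "S \<subseteq> nonroots"
  shows "deg (par_edge ` S) u \<le> card {v \<in> S. par v = u} + (if u \<in> S then 1 else 0)"
proof -
  have fin: "finite S" using assms by (rule finite_subset) (simp add: nonroots_def)
  have "{e \<in> par_edge ` S. u \<in> e} \<subseteq> par_edge ` ({v \<in> S. par v = u} \<union> (if u \<in> S then {u} else {}))"
    by (auto simp: par_edge_def)
  then have "deg (par_edge ` S) u \<le>
      card (par_edge ` ({v \<in> S. par v = u} \<union> (if u \<in> S then {u} else {})))"
    unfolding deg_def using fin by (intro card_mono) auto
  also have "\<dots> \<le> card ({v \<in> S. par v = u} \<union> (if u \<in> S then {u} else {}))"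
    using fin by (intro card_image_le) auto
  also have "\<dots> \<le> card {v \<in> S. par v = u} + card (if u \<in> S then {u} else {})"
    by (rule card_Un_le)
  finally show ?thesis by (auto split: if_splits)
qed

lemma isolated_tree:
  assumes "\<And>e. e \<in> E \<Longrightarrow> v \<notin> e" "v \<in> tree E u"
  shows "u = v"
proof -
  have "u \<in> tree E v" using assms(2) by (rule tree_sym)
  then show ?thesis by (induction rule: tree_induct) (use assms(1) in auto)
qed

lemma tree_side:
  assumes "y \<in> tree (par_edge ` nonroots) x"
  shows "y < M \<longleftrightarrow> x < M"
  using assms
proof (induction rule: tree_induct)
  case (step y z)
  then obtain v where v: "v \<in> nonroots" "{y, z} = {par v, v}" by (auto simp: par_edge_def)
  then have "y = par v \<and> z = v \<or> y = v \<and> z = par v" by (metis doubleton_eq_iff)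
  then show ?case using step.IH par_side[OF v(1)] by auto
qed simp

section \<open>Building the heaps and toggling the edge between their tops\<close>

definition build :: "vertex list \<Rightarrow> update list" where
  "build vs = map (\<lambda>v. Insert (par v) v) vs"

text \<open>Heap parents are smaller than their children, so in increasing order each insertion
  attaches an isolated vertex. In the general model the roots depend on the naming rule, and only
  edges are tracked; in the rooted model it suffices that vertices not yet attached are still
  roots.\<close>

lemma build_legal:
  fixes m :: model and tie :: tie_rule and n :: nat
  assumes nM: "2 * M \<le> n" and \<Delta>: "\<Delta> = b + 1" and k: "\<Delta> \<le> \<kappa>"
    and "valid_state n \<Delta> \<kappa> F" "edges F = par_edge ` S" "S \<union> set vs \<subseteq> nonroots"
    and "\<And>s v. s \<in> S \<Longrightarrow> v \<in> set vs \<Longrightarrow> s < v" "sorted_wrt (<) vs"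
    and "m = Rooted \<Longrightarrow> {..<n} - S \<subseteq> roots F"
  defines "F' \<equiv> foldl (forest_step m tie \<Delta>) F (build vs)"
  shows "legal_from m tie \<Delta> n F (build vs) \<and> valid_state n \<Delta> \<kappa> F' \<and>
    edges F' = par_edge ` (S \<union> set vs) \<and> (m = Rooted \<longrightarrow> {..<n} - (S \<union> set vs) \<subseteq> roots F')"
  using assms(4-9) unfolding F'_def
proof (induction vs arbitrary: F S)
  case Nil
  then show ?case by (simp add: build_def)
next
  case (Cons v vs)
  note valid = Cons.prems(1) and E = Cons.prems(2)
  have v: "v \<in> nonroots" and S: "S \<subseteq> nonroots" using Cons.prems(3) by auto
  have vS: "v \<notin> S" using Cons.prems(4)[of v v] by auto
  have vn: "v < n" using v nM by (auto simp: nonroots_def)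
  have iso: "v \<notin> e" if e: "e \<in> edges F" for e
  proof -
    obtain w where w: "w \<in> S" "e = {par w, w}" using e unfolding E par_edge_def by blast
    have "w < v" using Cons.prems(4)[OF w(1)] by simp
    moreover have "par w < w" using par_less S w(1) by blast
    ultimately show ?thesis unfolding w(2) by simp
  qed
  have "v \<notin> tree (edges F) (par v)"
  proof
    assume "v \<in> tree (edges F) (par v)"
    then have "par v = v" by (rule isolated_tree[rotated]) (rule iso)
    then show False using par_less[OF v] by simp
  qed
  moreover have "deg (edges F) v < \<Delta>"
  proof -
    have "{e \<in> edges F. v \<in> e} = {}" using iso by blast
    then show ?thesis using \<Delta> by (simp only: deg_def) simp
  qed
  moreover have "deg (edges F) (par v) < \<Delta>"
  proof -
    \<comment> \<open>Of the at most \<open>b\<close> children of the parent, \<open>v\<close>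
      itself is still missing; together with a possible edge to its own parent this keeps the degree
      at most \<open>b\<close>.\<close>
    have "{w \<in> S. par w = par v} \<subset> {w \<in> nonroots. par w = par v}" using S v vS by auto
    then have "card {w \<in> S. par w = par v} < b"
      using psubset_card_mono[OF card_par_children(1)] card_par_children(2)[of "par v"]
      by (meson order_less_le_trans)
    then show ?thesis using deg_par_edges[OF S, of "par v"] \<Delta> E by (auto split: if_splits)
  qed
  moreover have "m = Rooted \<Longrightarrow> v \<in> roots F" using Cons.prems(6) vS vn by auto
  ultimately have legal: "legal m \<Delta> n F (Insert (par v) v)"
    using vn par_less[OF v] by simp
  let ?F = "forest_step m tie \<Delta> F (Insert (par v) v)"
  have k2: "2 \<le> \<kappa>" using k \<Delta> b by simp
  have "valid_state n \<Delta> \<kappa> ?F" using valid_update(1)[OF valid legal k k2] .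
  moreover have "edges ?F = par_edge ` insert v S"
    using insert_update[OF valid legal k k2, of tie] E by (metis image_insert par_edge_def)
  moreover have "insert v S \<union> set vs \<subseteq> nonroots" using Cons.prems(3) by auto
  moreover have "s < w" if "s \<in> insert v S" "w \<in> set vs" for s w
    using that Cons.prems(4,5) by auto
  moreover have "sorted_wrt (<) vs" using Cons.prems(5) by simp
  moreover have "{..<n} - insert v S \<subseteq> roots ?F" if "m = Rooted"
    using Cons.prems(6)[OF that] that by (auto simp: forest_step_def link_def)
  ultimately show ?case using Cons.IH[of ?F "insert v S"] legal
    by (simp add: build_def insert_is_Un[symmetric] Un_insert_left)
qed

definition flicker :: "update list" where
  "flicker = [Insert 0 M, Delete 0 M]"

text \<open>The invariant between flickers. In the rooted model \<open>M\<close> must be a root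
  again for the next insertion; in the general model the insertion reroots by itself.\<close>

definition full_state :: "nat \<Rightarrow> nat \<Rightarrow> nat \<Rightarrow> model \<Rightarrow> rooted_forest \<Rightarrow> bool" where
  "full_state n \<Delta> \<kappa> m F \<longleftrightarrow> valid_state n \<Delta> \<kappa> F \<and> edges F = par_edge ` nonroots \<and>
     (m = Rooted \<longrightarrow> M \<in> roots F)"

lemma build_full:
  assumes nM: "2 * M \<le> n" and \<Delta>: "\<Delta> = b + 1" and k: "\<Delta> \<le> \<kappa>"
  defines "us \<equiv> build ([1..<M] @ [M + 1..<2 * M])"
  shows "legal_from m tie \<Delta> n (empty_forest n) us"
    and "full_state n \<Delta> \<kappa> m (foldl (forest_step m tie \<Delta>) (empty_forest n) us)"
proof -
  have "sorted_wrt (<) ([1..<M] @ [M + 1..<2 * M])"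
    by (auto simp: sorted_wrt_append)
  moreover have "set ([1..<M] @ [M + 1..<2 * M]) = nonroots" by (auto simp: nonroots_def)
  moreover have "M \<in> {..<n} - nonroots" using nM M by (auto simp: nonroots_def)
  ultimately show "legal_from m tie \<Delta> n (empty_forest n) us"
    "full_state n \<Delta> \<kappa> m (foldl (forest_step m tie \<Delta>) (empty_forest n) us)"
    using build_legal[OF nM \<Delta> k valid_empty, of "{}" "[1..<M] @ [M + 1..<2 * M]" m tie]
    by (auto simp: us_def full_state_def empty_forest_def)
qed

lemma flicker_full:
  assumes nM: "2 * M \<le> n" and \<Delta>: "\<Delta> = b + 1" and k: "\<Delta> \<le> \<kappa>" and F: "full_state n \<Delta> \<kappa> m F"
  shows "legal_from m tie \<Delta> n F flicker"
    and "full_state n \<Delta> \<kappa> m (foldl (forest_step m tie \<Delta>) F flicker)"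
proof -
  let ?H = "par_edge ` nonroots"
  have valid: "valid_state n \<Delta> \<kappa> F" and E: "edges F = ?H" and R: "m = Rooted \<Longrightarrow> M \<in> roots F"
    using F by (auto simp: full_state_def)
  interpret F: rooted_forest_on n F using valid by (simp add: valid_state_def)
  have k2: "2 \<le> \<kappa>" using k \<Delta> b by simp
  have M0: "M \<notin> tree ?H 0" using tree_side[of M 0] M by auto
  have "deg ?H u < \<Delta>" if "u \<notin> nonroots" for u
    using deg_par_edges[of nonroots u] card_par_children(2)[of u] that \<Delta> by simp
  then have "deg ?H 0 < \<Delta>" "deg ?H M < \<Delta>" by (auto simp: nonroots_def)
  then have l1: "legal m \<Delta> n F (Insert 0 M)" using M M0 nM R E by auto
  let ?F1 = "forest_step m tie \<Delta> F (Insert 0 M)"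
  have v1: "valid_state n \<Delta> \<kappa> ?F1" using valid_update(1)[OF valid l1 k k2] .
  have E1: "edges ?F1 = insert {0, M} ?H" using insert_update[OF valid l1 k k2, of tie] E by metis
  have nH: "{0, M} \<notin> ?H" using M0 tree_edge by blast
  have par: "is_parent ?F1 0 M" if "m = Rooted"
  proof -
    obtain z where "z \<in> roots F" "z \<in> tree ?H 0" using F.ex1_root[of 0] nM M unfolding E by auto
    moreover have "z \<noteq> M" using calculation(2) M0 by metis
    moreover have "edges ?F1 - {{0, M}} = ?H" using E1 nH by blast
    moreover have "roots ?F1 = roots F - {M}" using that by (simp add: forest_step_def link_def)
    ultimately have "z \<in> tree (edges ?F1 - {{0, M}}) 0 \<inter> roots ?F1" by simp
    then show ?thesis unfolding is_parent_def using E1 by blast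
  qed
  have l2: "legal m \<Delta> n ?F1 (Delete 0 M)" using E1 par by simp
  let ?F2 = "forest_step m tie \<Delta> ?F1 (Delete 0 M)"
  have "valid_state n \<Delta> \<kappa> ?F2" using valid_update(1)[OF v1 l2 k k2] .
  moreover have "edges ?F2 = ?H"
  proof -
    have "edges ?F2 = edges ?F1 - {{0, M}}" using delete_update[OF v1 l2 k k2, of tie] by metis
    also have "\<dots> = ?H" using E1 nH by blast
    finally show ?thesis .
  qed
  moreover have "M \<in> roots ?F2" if "m = Rooted"
  proof -
    have "orient m tie \<Delta> ?F1 (Delete 0 M) = (?F1, Delete 0 M)" using par[OF that] that by simp
    then show ?thesis unfolding forest_step_def[of m tie \<Delta> ?F1] by (simp add: cut_def)
  qed
  ultimately show "full_state n \<Delta> \<kappa> m (foldl (forest_step m tie \<Delta>) F flicker)"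
    by (simp add: full_state_def flicker_def)
  show "legal_from m tie \<Delta> n F flicker" using l1 l2 by (simp add: flicker_def)
qed

lemma flickers_full:
  assumes "2 * M \<le> n" "\<Delta> = b + 1" "\<Delta> \<le> \<kappa>" "full_state n \<Delta> \<kappa> m F"
  shows "legal_from m tie \<Delta> n F (concat (replicate k flicker)) \<and>
    full_state n \<Delta> \<kappa> m (foldl (forest_step m tie \<Delta>) F (concat (replicate k flicker)))"
  using assms(4)
proof (induction k arbitrary: F)
  case (Suc k)
  let ?F = "foldl (forest_step m tie \<Delta>) F flicker"
  have "legal_from m tie \<Delta> n F flicker" "full_state n \<Delta> \<kappa> m ?F"
    using flicker_full[OF assms(1-3) Suc.prems] by auto
  then show ?case using Suc.IH[of ?F] by (simp add: legal_from_append)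
qed simp

text \<open>The index of the first heap vertex of depth \<open>d\<close>, found by following
  leftmost children; in closed form (b^d - 1) / (b - 1).\<close>

primrec level_start :: "nat \<Rightarrow> nat" where
  "level_start 0 = 0"
| "level_start (Suc d) = b * level_start d + 1"

lemma level_start_Suc: "level_start (Suc d) = level_start d + b ^ d"
  by (induction d) (auto simp: algebra_simps)

lemma level_start_ge: "d \<le> level_start d"
proof (induction d)
  case (Suc d)
  have "1 \<le> b ^ d" using b by simp
  then show ?case using Suc level_start_Suc[of d] by linarith
qed simp

lemma level_start_le: "level_start d + 1 \<le> b ^ d"
proof (induction d)
  case (Suc d)
  have "2 * b ^ d \<le> b ^ Suc d" using b by simp
  then show ?case using Suc level_start_Suc[of d] by linarith
qed simp

context
  fixes n :: nat and G :: rooted_forest and r :: vertex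
  assumes tree: "rooted_tree_on n G r" and nM: "2 * M \<le> n"
    and E: "edges G = par_edge ` nonroots" and r: "r = 0 \<or> r = M"
begin

interpretation rooted_tree_on n G r by (rule tree)

text \<open>Since \<open>r\<close> is the top of its heap, the parents derived from the root agree
  with the arithmetic ones. An edge directed the other way would give a parent to \<open>r\<close>,
  or a second one to \<open>par v\<close>, which by induction has its heap parent already.\<close>

lemma heap_child:
  assumes "v \<in> nonroots" "v < M \<longleftrightarrow> r < M"
  shows "v \<in> children G (par v)"
  using assms
proof (induction v rule: less_induct)
  case (less v)
  have "{par v, v} \<in> edges G" using less.prems E by (auto simp: par_edge_def)
  then have "v \<in> children G (par v) \<or> par v \<in> children G v" by (rule edge_children)
  moreover have "par v \<notin> children G v"
  proof
    assume c: "par v \<in> children G v"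
    then have "par v \<noteq> r" using root_not_child by blast
    then have p: "par v \<in> nonroots" using par_cases[OF less.prems(1)] less.prems(2) r M by auto
    moreover have "par v < M \<longleftrightarrow> r < M" using par_side less.prems by blast
    ultimately have "par v \<in> children G (par (par v))"
      using less.IH par_less[OF less.prems(1)] by blast
    then have "v = par (par v)" using c children_unique by blast
    then show False using par_less[OF p] par_less[OF less.prems(1)] by simp
  qed
  ultimately show ?case by blast
qed

lemma heap_level:
  assumes "level_start d \<le> i" "i < level_start (Suc d)" "i < M"
  shows "r + i \<in> lev d"
  using assms
proof (induction d arbitrary: i)
  case 0
  then show ?case by simp
next
  case (Suc d)
  let ?j = "(i - 1) div b"
  have i: "1 \<le> i" using Suc.prems(1) by simp
  have jM: "?j < M" using Suc.prems(3) div_le_dividend[of "i - 1" b] by linarith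
  have "level_start d \<le> ?j"
    using Suc.prems(1) b by (simp add: less_eq_div_iff_mult_less_eq mult.commute)
  moreover have "?j < level_start (Suc d)"
  proof -
    have "i - 1 < level_start (Suc d) * b" using Suc.prems(2) i by (simp add: mult.commute)
    then show ?thesis by (rule less_mult_imp_div_less)
  qed
  ultimately have "r + ?j \<in> lev d" using Suc.IH jM by blast
  moreover have "r + i \<in> nonroots" "r + i < M \<longleftrightarrow> r < M"
    using r i Suc.prems(3) M by (auto simp: nonroots_def)
  moreover have "par (r + i) = r + ?j" using r Suc.prems(3) by (auto simp: par_def)
  ultimately show ?case using heap_child[of "r + i"] by auto
qed

lemma card_heap_level: "min M (level_start (Suc d)) - level_start d \<le> card (lev d)"
proof -
  have "(+) r ` {level_start d..<min M (level_start (Suc d))} \<subseteq> lev d"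
    by (intro image_subsetI heap_level) (auto simp del: level_start.simps)
  then have "card ((+) r ` {level_start d..<min M (level_start (Suc d))}) \<le> card (lev d)"
    using finite_lev card_mono by blast
  then show ?thesis by (simp add: card_image)
qed

text \<open>For heaps so shallow that no level below the top is full.\<close>

lemma weight_ge_level1:
  assumes "0 < \<kappa>"
  shows "real (min b (M - 1)) / real \<kappa> \<le> weight \<kappa>"
proof -
  have "min b (M - 1) \<le> card (lev (Suc 0))" using card_heap_level[of "Suc 0"] by simp
  then have "real (min b (M - 1)) / real \<kappa> \<le> real (card (lev (Suc 0))) / real \<kappa>"
    by (intro divide_right_mono) auto
  also have "\<dots> = (\<Sum>d\<in>{0}. real (card (lev (Suc d))) / (real \<kappa> * (real \<kappa> - 1) ^ d))" by simp
  also have "\<dots> \<le> weight \<kappa>"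
    unfolding weight_def using nM M assms by (intro sum_mono2) auto
  finally show ?thesis .
qed

lemma weight_ge_levels:
  assumes "level_start (Suc h) \<le> M" "0 < \<kappa>"
  shows "(\<Sum>d<h. real b ^ Suc d / (real \<kappa> * (real \<kappa> - 1) ^ d)) \<le> weight \<kappa>"
proof -
  have "h < n" using level_start_ge[of "Suc h"] assms(1) nM M by linarith
  have mono: "level_start d \<le> M" if "d \<le> Suc h" for d
  proof -
    have "level_start d \<le> level_start (Suc h)"
      by (rule lift_Suc_mono_le[of level_start, OF _ that])
        (simp add: level_start_Suc del: level_start.simps)
    then show ?thesis using assms(1) by linarith
  qed
  have "(\<Sum>d<h. real b ^ Suc d / (real \<kappa> * (real \<kappa> - 1) ^ d)) \<le>
      (\<Sum>d<h. real (card (lev (Suc d))) / (real \<kappa> * (real \<kappa> - 1) ^ d))"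
  proof (rule sum_mono)
    fix d assume d: "d \<in> {..<h}"
    have "level_start (Suc (Suc d)) \<le> M" using d by (intro mono) auto
    then have "b ^ Suc d \<le> card (lev (Suc d))"
      using card_heap_level[of "Suc d"] level_start_Suc[of "Suc d"] by (simp add: min_absorb2)
    then have "real b ^ Suc d \<le> real (card (lev (Suc d)))" by (metis of_nat_le_iff of_nat_power)
    then show "real b ^ Suc d / (real \<kappa> * (real \<kappa> - 1) ^ d) \<le>
        real (card (lev (Suc d))) / (real \<kappa> * (real \<kappa> - 1) ^ d)"
      using assms(2) by (intro divide_right_mono) auto
  qed
  also have "\<dots> \<le> weight \<kappa>"
    unfolding weight_def using \<open>h < n\<close> assms(2) by (intro sum_mono2) auto
  finally show ?thesis .
qed

end

end

text \<open>Bernoulli's inequality for \<open>1 / q\<close> gives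
  \<open>q ^ h \<le> 1 / (1 + h * (1 - q))\<close>, so the sum is at least
  \<open>h / (1 + h * (1 - q))\<close>, and the denominator is at most twice the larger of its two
  terms.\<close>

lemma geometric_sum_ge:
  fixes q :: real
  assumes "0 < q" "q < 1"
  shows "min (real h) (1 / (1 - q)) / 2 \<le> (\<Sum>d<h. q ^ d)"
proof -
  let ?\<epsilon> = "1 - q"
  have e: "0 < ?\<epsilon>" using assms by simp
  have "1 + real h * ?\<epsilon> \<le> 1 + real h * (1 / q - 1)"
  proof -
    have "?\<epsilon> \<le> ?\<epsilon> / q" using assms by (simp add: le_divide_eq mult_left_le)
    also have "\<dots> = 1 / q - 1" using assms by (simp add: diff_divide_distrib)
    finally show ?thesis by (simp add: mult_left_mono)
  qed
  also have "\<dots> \<le> (1 + (1 / q - 1)) ^ h" using assms by (intro Bernoulli_inequality) simp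
  also have "\<dots> = 1 / q ^ h" using assms by (simp add: power_one_over)
  finally have "q ^ h * (1 + real h * ?\<epsilon>) \<le> 1" using assms by (simp add: le_divide_eq mult.commute)
  moreover have pos: "0 < 1 + real h * ?\<epsilon>" using e by (intro add_pos_nonneg) auto
  ultimately have qh: "q ^ h \<le> 1 / (1 + real h * ?\<epsilon>)" by (simp add: le_divide_eq)
  have "(\<Sum>d<h. q ^ d) = (1 - q ^ h) / ?\<epsilon>" using assms by (subst sum_gp_strict) auto
  also have "\<dots> \<ge> (1 - 1 / (1 + real h * ?\<epsilon>)) / ?\<epsilon>" using qh e by (intro divide_right_mono) auto
  also have "(1 - 1 / (1 + real h * ?\<epsilon>)) / ?\<epsilon> = real h / (1 + real h * ?\<epsilon>)"
  proof -
    have "(1 - 1 / (1 + real h * x)) / x = real h / (1 + real h * x)" if "0 < x" for x :: real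
    proof -
      have "0 < 1 + real h * x" using that by (intro add_pos_nonneg) auto
      then have "1 - 1 / (1 + real h * x) = real h * x / (1 + real h * x)" by (simp add: field_simps)
      then show ?thesis using that by simp
    qed
    then show ?thesis using e by blast
  qed
  finally have "real h / (1 + real h * ?\<epsilon>) \<le> (\<Sum>d<h. q ^ d)" by simp
  moreover have "min (real h) (1 / ?\<epsilon>) / 2 \<le> real h / (1 + real h * ?\<epsilon>)"
  proof (cases "real h * ?\<epsilon> \<le> 1")
    case True
    have "min (real h) (1 / ?\<epsilon>) / 2 \<le> real h / 2" by simp
    also have "\<dots> \<le> real h / (1 + real h * ?\<epsilon>)" using True pos by (intro divide_left_mono) auto
    finally show ?thesis .
  next
    case False
    have "min (real h) (1 / ?\<epsilon>) / 2 \<le> 1 / ?\<epsilon> / 2" by (intro divide_right_mono) auto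
    also have "\<dots> \<le> real h / (1 + real h * ?\<epsilon>)" using False pos e by (simp add: field_simps)
    finally show ?thesis .
  qed
  ultimately show ?thesis by linarith
qed

context heap_pair
begin

text \<open>\<open>h\<close> is the depth of the last full level.\<close>

lemma obtain_height:
  obtains h where "level_start (Suc h) \<le> M" "M < level_start (Suc (Suc h))"
proof -
  have "M < level_start (Suc M)" using level_start_ge[of "Suc M"] by linarith
  then obtain k where k: "\<And>i. i < k \<Longrightarrow> \<not> M < level_start i" "M < level_start k"
    using ex_least_nat_le[of "\<lambda>k. M < level_start k"] by blast
  have "k \<noteq> 0" "k \<noteq> Suc 0" using k(2) M by (auto intro: ccontr)
  then obtain h where "k = Suc (Suc h)" by (metis not0_implies_Suc)
  then show ?thesis using that[of h] k(1)[of "Suc h"] k(2) by (simp del: level_start.simps)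
qed

text \<open>The constant covers two cases. If \<open>h = 0\<close>, the bound is at most 3 and the
  weight at least 1/8, a ratio of 1/24. Otherwise the logarithm is at most \<open>4 * h\<close>, and
  the full levels give 1/16.\<close>

lemma weight_ge_bound:
  assumes tree: "rooted_tree_on n G r" and E: "edges G = par_edge ` nonroots" and r: "r = 0 \<or> r = M"
    and n: "2 * M \<le> n" "n \<le> 2 * M + 1" "b + 2 \<le> n" and \<Delta>: "\<Delta> = b + 1" and c: "c + 1 \<le> b"
  shows "recourse_bound \<Delta> c n / 36 \<le> rooted_tree_on.weight n G r (\<Delta> + c)"
proof -
  define \<kappa> where "\<kappa> = \<Delta> + c"
  define K where "K = real b + real c"
  define W where "W = rooted_tree_on.weight n G r \<kappa>"
  have k: "real \<kappa> = K + 1" "0 < \<kappa>" by (auto simp: \<kappa>_def K_def \<Delta>)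
  have K: "real b \<le> K" "K + 1 \<le> 2 * real b" "2 \<le> real b" using b c by (auto simp: K_def)
  note W = weight_ge_level1[OF tree n(1) E r k(2), folded W_def]
    weight_ge_levels[OF tree n(1) E r _ k(2), folded W_def]
  obtain h where h: "level_start (Suc h) \<le> M" "M < level_start (Suc (Suc h))"
    using obtain_height .
  \<comment> \<open>The heap ends within depth \<open>h + 1\<close>, so
    \<open>M < b ^ (h + 2)\<close>; passing from \<open>M\<close> to \<open>n\<close> costs at most
    one more factor \<open>b\<close>.\<close>
  have L: "log K (real n) \<le> real h + 3"
  proof -
    have "M + 2 \<le> b ^ Suc (Suc h)" using h(2) level_start_le[of "Suc (Suc h)"] by linarith
    then have "n \<le> 2 * b ^ Suc (Suc h)" using n(2) by linarith
    also have "\<dots> \<le> b * b ^ Suc (Suc h)" using b by (intro mult_right_mono) auto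
    also have "\<dots> = b ^ (h + 3)" by (simp add: eval_nat_numeral)
    finally have "real n \<le> real b ^ (h + 3)" by (metis of_nat_le_iff of_nat_power)
    also have "\<dots> \<le> K ^ (h + 3)" using K by (intro power_mono) auto
    finally have "log K (real n) \<le> log K (K ^ (h + 3))" using K n(3) by (intro log_mono) auto
    also have "\<dots> = real h + 3" using K by simp
    finally show ?thesis .
  qed
  have bound: "recourse_bound \<Delta> c n = (if c = 0 then log K (real n) else min (real \<Delta> / real c) (log K (real n)))"
    using k(1) by (simp add: recourse_bound_def Let_def \<kappa>_def)
  show ?thesis
  proof (cases "h = 0")
    case True
    \<comment> \<open>The requirement \<open>b + 2 \<le> n\<close> guarantees the top of the heap a
      constant fraction of \<open>b\<close> children.\<close>
    have "real b / 4 \<le> real (min b (M - 1))"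
    proof -
      have "b \<le> 4 * (M - 1)" using n b by linarith
      then have "b \<le> 4 * min b (M - 1)" by simp
      then show ?thesis by linarith
    qed
    then have "real b / 4 / real \<kappa> \<le> W" using W(1) by (meson divide_right_mono of_nat_0_le_iff order_trans)
    moreover have "1 / 8 \<le> real b / 4 / real \<kappa>" using K by (simp add: k(1) field_simps)
    moreover have "recourse_bound \<Delta> c n \<le> 3" using L True bound by auto
    ultimately show ?thesis by (simp add: W_def \<kappa>_def)
  next
    case False
    let ?q = "real b / K"
    \<comment> \<open>This is where \<open>c \<le> \<Delta> - 2\<close> enters: it makes
      \<open>K + 1 \<le> 2 * b\<close>.\<close>
    have "1 / 2 * (\<Sum>d<h. ?q ^ d) \<le> real b / (K + 1) * (\<Sum>d<h. ?q ^ d)"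
      using K by (intro mult_right_mono sum_nonneg) (auto simp: field_simps)
    also have "\<dots> = (\<Sum>d<h. real b ^ Suc d / (real \<kappa> * (real \<kappa> - 1) ^ d))"
      by (simp add: sum_distrib_left k(1) power_divide)
    also have "\<dots> \<le> W" by (rule W(2)[OF h(1)])
    finally have W': "(\<Sum>d<h. ?q ^ d) / 2 \<le> W" by simp
    have L': "log K (real n) \<le> 4 * real h" using L False by simp
    have "recourse_bound \<Delta> c n / 8 \<le> (\<Sum>d<h. ?q ^ d)"
    proof (cases "c = 0")
      case True
      then have "?q = 1" using K by (simp add: K_def)
      then have "(\<Sum>d<h. ?q ^ d) = real h" by simp
      then show ?thesis using L' True bound by simp
    next
      case c0: False
      then have q: "0 < ?q" "?q < 1" using K by (auto simp: K_def)
      have "1 - ?q = real c / K" using K by (simp add: K_def field_simps)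
      then have "1 / (1 - ?q) = K / real c" by simp
      moreover have "real \<Delta> \<le> K" using c0 by (simp add: K_def \<Delta>)
      then have "real \<Delta> / real c \<le> K / real c" by (rule divide_right_mono) simp
      ultimately have "min (real \<Delta> / real c) (real h) \<le> min (real h) (1 / (1 - ?q))" by simp
      moreover have "recourse_bound \<Delta> c n \<le> 4 * min (real \<Delta> / real c) (real h)"
      proof -
        have "min x y \<le> 4 * min x z" if "0 \<le> x" "y \<le> 4 * z" for x y z :: real
          using that by (auto simp: min_def)
        from this[OF _ L', of "real \<Delta> / real c"] show ?thesis using c0 unfolding bound by simp
      qed
      moreover have "R / 8 \<le> S" if "x \<le> y" "R \<le> 4 * x" "y / 2 \<le> S" for x y R S :: real
        using that by linarith
      ultimately show ?thesis using geometric_sum_ge[OF q, of h] by blast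
    qed
    then have "recourse_bound \<Delta> c n / 16 \<le> W" using W' by linarith
    moreover have "0 \<le> recourse_bound \<Delta> c n"
      unfolding bound using K n(3) by (auto simp: zero_le_log_cancel_iff)
    ultimately show ?thesis unfolding W_def \<kappa>_def by linarith
  qed
qed

end

section \<open>Amortization\<close>

lemma expected_recourse_nonneg: "0 \<le> expected_recourse m tie \<Delta> \<kappa> n us t"
  unfolding expected_recourse_def by (rule Bochner_Integration.integral_nonneg) simp

lemma amortized_recourse_lower:
  assumes D: "3 \<le> \<Delta>" and c: "c \<le> \<Delta> - 2" and n: "\<Delta> < n"
  obtains us where "N \<le> length us" "legal_sequence m tie \<Delta> n us"
    "1 / 108 * recourse_bound \<Delta> c n \<le> amortized_recourse m tie \<Delta> (\<Delta> + c) n us"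
proof -
  define b where "b = \<Delta> - 1"
  define M where "M = n div 2"
  interpret heap_pair b M by unfold_locales (use D n in \<open>auto simp: b_def M_def\<close>)
  have \<Delta>: "\<Delta> = b + 1" using D by (simp add: b_def)
  have nM: "2 * M \<le> n" "n \<le> 2 * M + 1" by (auto simp: M_def)
  have k: "\<Delta> \<le> \<Delta> + c" "2 \<le> \<Delta> + c" using D by auto
  define pre where "pre = build ([1..<M] @ [M + 1..<2 * M])"
  \<comment> \<open>More flickers than building steps, so that \<open>us\<close> has at most
    \<open>3 * k\<close> updates; \<open>N\<close> makes the sequence as long as desired.\<close>
  define k where "k = Suc (length pre + N)"
  define us where "us = pre @ concat (replicate k flicker)"
  define B where "B = recourse_bound \<Delta> c n / 36"
  let ?E = "expected_recourse m tie \<Delta> (\<Delta> + c) n us"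
  let ?run = "foldl (forest_step m tie \<Delta>)"
  note full = build_full[OF nM(1) \<Delta> \<open>\<Delta> \<le> \<Delta> + c\<close>, of m tie, folded pre_def]
  note flick = flickers_full[OF nM(1) \<Delta> \<open>\<Delta> \<le> \<Delta> + c\<close> full(2), of tie]
  have legal: "legal_sequence m tie \<Delta> n us"
    using full(1) flick by (simp add: legal_sequence_def us_def legal_from_append)
  have len_flick: "length (concat (replicate j flicker)) = 2 * j" for j
    by (induction j) (auto simp: flicker_def)
  have len: "length us = length pre + 2 * k" by (simp add: us_def len_flick)
  have E: "B \<le> ?E (length pre + 2 * i)" if i: "i < k" for i
  proof -
    let ?t = "length pre + 2 * i"
    let ?F = "?run (empty_forest n) (take ?t us)"
    have "replicate k flicker = replicate i flicker @ flicker # replicate (k - Suc i) flicker"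
      using i by (metis Suc_diff_Suc le_add_diff_inverse less_imp_le replicate_Suc replicate_add)
    then have us: "us = (pre @ concat (replicate i flicker)) @ flicker @ concat (replicate (k - Suc i) flicker)"
      by (simp add: us_def)
    have len': "length (pre @ concat (replicate i flicker)) = ?t" by (simp add: len_flick)
    have take: "take ?t us = pre @ concat (replicate i flicker)"
      unfolding us using len' by (metis append_eq_conv_conj)
    have ut: "us ! ?t = Insert 0 M"
      unfolding us using len' by (simp add: nth_append flicker_def)
    have fullF: "full_state n \<Delta> (\<Delta> + c) m ?F" unfolding take using flick by simp
    note e = expected_recourse_law[OF legal _ \<open>\<Delta> \<le> \<Delta> + c\<close> \<open>2 \<le> \<Delta> + c\<close>, of ?t]
    have tl: "?t < length us" using i len by simp
    obtain G r where G: "rooted_tree_on n G r" "edges G = edges ?F" "r = 0 \<or> r = M"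
      "measure_pmf.expectation (recourse_law m tie \<Delta> (\<Delta> + c) ?F (Insert 0 M)) real =
        rooted_tree_on.weight n G r (\<Delta> + c)"
      by (rule insert_update[where tie = tie, OF e(1)[OF tl] e(2)[OF tl, unfolded ut]
            \<open>\<Delta> \<le> \<Delta> + c\<close> \<open>2 \<le> \<Delta> + c\<close>]) (rule that, assumption+)
    have "edges G = par_edge ` nonroots" using G(2) fullF by (simp add: full_state_def)
    then have "B \<le> rooted_tree_on.weight n G r (\<Delta> + c)"
      unfolding B_def using weight_ge_bound[OF G(1) _ G(3) nM _ \<Delta>] n c b \<Delta> by simp
    then show ?thesis using e(3)[OF tl] G(4) by (simp add: ut)
  qed
  \<comment> \<open>Only the \<open>k\<close> insertions of the flickers are counted, out of at most
    \<open>3 * k\<close> updates: the factor 3 between 36 and 108.\<close>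
  have "real k * B \<le> (\<Sum>i<k. ?E (length pre + 2 * i))"
    using sum_bounded_below[of "{..<k}" B "\<lambda>i. ?E (length pre + 2 * i)"] E by simp
  also have "\<dots> = (\<Sum>t\<in>(\<lambda>i. length pre + 2 * i) ` {..<k}. ?E t)"
    by (rule sum.reindex[symmetric, unfolded o_def]) (auto simp: inj_on_def)
  also have "\<dots> \<le> (\<Sum>t<length us. ?E t)"
    using len expected_recourse_nonneg by (intro sum_mono2) auto
  finally have sum: "real k * B \<le> (\<Sum>t<length us. ?E t)" .
  have B: "0 \<le> B"
    using n D by (auto simp: B_def recourse_bound_def Let_def zero_le_log_cancel_iff)
  have "real (length us) * (B / 3) \<le> real (3 * k) * (B / 3)"
    using B len by (intro mult_right_mono) (auto simp: k_def)
  also have "\<dots> \<le> (\<Sum>t<length us. ?E t)" using sum by simp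
  finally have "B / 3 \<le> amortized_recourse m tie \<Delta> (\<Delta> + c) n us"
    using len by (simp add: amortized_recourse_def le_divide_eq k_def mult.commute)
  then show ?thesis using that[of us] legal len by (simp add: B_def k_def)
qed

theorem theorem2p12:
  shows
    "(\<exists>C>0. \<forall>m tie \<Delta> c n us t.
        3 \<le> \<Delta> \<longrightarrow> c \<le> \<Delta> - 2 \<longrightarrow>
        legal_sequence m tie \<Delta> n us \<longrightarrow> t < length us \<longrightarrow>
        expected_recourse m tie \<Delta> (\<Delta> + c) n us t \<le> C * recourse_bound \<Delta> c n)
     \<and>
     (\<exists>C>0. \<forall>m tie \<Delta> c n.
        3 \<le> \<Delta> \<longrightarrow> c \<le> \<Delta> - 2 \<longrightarrow> \<Delta> < n \<longrightarrow>
        (\<forall>N. \<exists>us. N \<le> length us \<and> legal_sequence m tie \<Delta> n us \<and>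
           C * recourse_bound \<Delta> c n \<le> amortized_recourse m tie \<Delta> (\<Delta> + c) n us))"
proof (rule conjI; rule exI; rule conjI)
  show "\<forall>m tie \<Delta> c n us t. 3 \<le> \<Delta> \<longrightarrow> c \<le> \<Delta> - 2 \<longrightarrow>
      legal_sequence m tie \<Delta> n us \<longrightarrow> t < length us \<longrightarrow>
      expected_recourse m tie \<Delta> (\<Delta> + c) n us t \<le> 3 * recourse_bound \<Delta> c n"
    using expected_recourse_upper by blast
  show "\<forall>m tie \<Delta> c n. 3 \<le> \<Delta> \<longrightarrow> c \<le> \<Delta> - 2 \<longrightarrow> \<Delta> < n \<longrightarrow>
      (\<forall>N. \<exists>us. N \<le> length us \<and> legal_sequence m tie \<Delta> n us \<and>
        1 / 108 * recourse_bound \<Delta> c n \<le> amortized_recourse m tie \<Delta> (\<Delta> + c) n us)"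
    by (metis amortized_recourse_lower)
qed simp_all

end
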